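(* Let $\mathbb{M}=(M_n)_{n\ge0}$ be a strongly regular sequence admitting a nonzero proximate order. Let $m_1,m_2$ be sequences of moments associated with kernel functions for $\mathbb{M}_1$-summability and $\mathbb{M}_2$-summability respectively, where $\mathbb{M}_1,\mathbb{M}_2$ are strongly regular sequences admitting nonzero proximate orders, and assume that $m_1$ and $m_2$ are $\mathbb{M}$-sequences of orders $s_1>0$ and $s_2>0$ respectively. Let $1\le k<p$ be integers with $s_1k\ge s_2p$. Let $r>0$, $D=D(0,r)$, let $a$ be such that $a(z),a(z)^{-1}\in\mathcal{O}(\overline D)$, let $\hat f\in\mathbb{C}[[t,z]]$ and $\varphi_j\in\mathcal{O}(\overline D)$ for $j=0,\dots,k-1$. Let $\hat u(t,z)\in\mathbb{C}[[t,z]]$ be the formal solution of the Cauchy problem $$\left(\partial_{m_1,t}^{k}-a(z)\partial_{m_2,z}^{p}\right)u(t,z)=\hat f(t,z),\qquad \partial_{m_1,t}^{j}u(0,z)=\varphi_j(z),\quad j=0,\dots,k-1.$$ Then the following statements are equivalent: (i) $\hat u(t,z)$ is convergent in a neighborhood of the origin; (ii) $\hat f(t,z)$ and $\partial_{m_2,z}^{j}\hat u(t,0)$ for $j=0,\dots,p-1$ are convergent in a neighborhood of the origin.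
   Context: $\mathcal{O}(\overline D)$ denotes functions holomorphic on (a neighborhood of) the closed disc $\overline D$. $S_d(\theta)=\{z\in\mathcal{R}:|\arg(z)-d|<\theta/2\}$, where $\mathcal{R}$ is the Riemann surface of the logarithm. Strongly regular sequences. A sequence $\mathbb{M}=(M_p)_{p\ge0}$ of positive reals with $M_0=1$ is strongly regular if: (lc) $M_p^2\le M_{p-1}M_{p+1}$ for $p\ge1$; (mg) there is $A_1>0$ with $M_{p+q}\le A_1^{p+q}M_pM_q$ for all $p,q\ge0$; (snq) there is $A_2>0$ with $\sum_{q\ge p}\frac{M_q}{(q+1)M_{q+1}}\le A_2\frac{M_p}{M_{p+1}}$ for all $p\ge0$. Its associated function is $M(t)=\sup_{p\ge0}\log(t^p/M_p)$ for $t>0$, $M(0)=0$. Put $\rho(M)=\limsup_{t\to\infty}\max\{0,\log M(t)/\log t\}\in(0,\infty)$ and $\omega(\mathbb{M})=1/\rho(M)$. $\mathbb{M}$ admits a nonzero proximate order if there are a nonnegative, continuous, piecewise continuously differentiable function $\varrho(t)$ on some $(c,\infty)$ with $\lim_{t\to\infty}\varrho(t)\in(0,\infty)$ and $\lim_{t\to\infty}t\varrho'(t)\log t=0$, and constants $A,B\in\mathbb{R}$ with $A\le\log(t)\left(\varrho(t)-\frac{\log M(t)}{\log t}\right)\le B$ for $t$ large. A sequence $(m(p))_{p\ge0}$ of positive reals is an $\mathbb{M}$-sequence of order $s$ if there are $A_3,A_4>0$ with $A_3^pM_p^s\le m(p)\le A_4^pM_p^s$ for all $p\ge0$. Kernel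 functions and moments. Let $\mathbb{M}$ be strongly regular with $\omega(\mathbb{M})<2$. Functions $e,E$ are kernel functions for $\mathbb{M}$-summability if: (1) $e$ is holomorphic on $S_0(\omega(\mathbb{M})\pi)$; there is $t_0>0$ such that every $z_0\in S_0(\omega(\mathbb{M})\pi)$ has a neighborhood $U\subseteq S_0(\omega(\mathbb{M})\pi)$ with $\int_0^{t_0}\sup_{z\in U}|e(t/z)|\frac{dt}{t}<\infty$; for every $\epsilon>0$ there are $c,k>0$ with $|e(z)|\le c\exp(-M(|z|/k))$ on $S_0(\omega(\mathbb{M})\pi-\epsilon)$; $e(x)\in\mathbb{R}$ for $x>0$. (2) $E$ is entire, $|E(z)|\le\tilde c\exp(M(|z|/\tilde k))$ on $\mathbb{C}$ for some $\tilde c,\tilde k>0$; and there is $\beta>0$ such that for all $0<\tilde\theta<2\pi-\omega(\mathbb{M})\pi$ and $M_E>0$ there is $\tilde c_2>0$ with $|E(z)|\le\tilde c_2|z|^{-\beta}$ on $S_\pi(\tilde\theta)\setminus D(0,M_E)$. (3) $m_e(z)=\int_0^\infty t^{z-1}e(t)\,dt$ is continuous on $\{\mathrm{Re}(z)\ge0\}$, holomorphic on $\{\mathrm{Re}(z)>0\}$, and $E(z)=\sum_{p\ge0}z^p/m_e(p)$. The associated sequence of moments is $m_e=(m_e(p))_{p\ge0}$; it is a known fact that it is strongly regular and equivalent to $\mathbb{M}$ (i.e. $B_1^pM_p\le m_e(p)\le B_2^pM_p$ for some $B_1,B_2>0$). Moment differentiation. $\partial_{m,z}\left(\sum_{p\ge0}\frac{u_p}{m(p)}z^p\right)=\sum_{p\ge0}\frac{u_{p+1}}{m(p)}z^p$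 on formal power series in the indicated variable (with coefficients possibly depending on the other variable). The Cauchy problem has a unique formal solution in $\mathbb{C}[[t,z]]$. *)

theory Defs
  imports "HOL-Complex_Analysis.Complex_Analysis"
begin

definition strongly_regular :: "(nat \<Rightarrow> real) \<Rightarrow> bool" where
  "strongly_regular M \<longleftrightarrow>
     (\<forall>p. M p > 0) \<and> M 0 = 1 \<and>
     (\<forall>p\<ge>1. (M p)\<^sup>2 \<le> M (p - 1) * M (p + 1)) \<and>
     (\<exists>A>0. \<forall>p q. M (p + q) \<le> A ^ (p + q) * M p * M q) \<and>
     (\<exists>A>0. \<forall>p.
        (\<lambda>q. M q / ((real q + 1) * M (q + 1))) summable_on {p..} \<and>
        (\<Sum>\<^sub>\<infinity>q\<in>{p..}. M q / ((real q + 1) * M (q + 1))) \<le> A * (M p / M (p + 1)))"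

text \<open>
  For strongly regular \<open>M\<close> the quotients \<open>M (p + 1) / M p\<close> tend to infinity, so the
  real-valued supremum below is over a set that is bounded above.
\<close>

definition assoc_fun :: "(nat \<Rightarrow> real) \<Rightarrow> real \<Rightarrow> real" where
  "assoc_fun M t = (if t = 0 then 0 else (SUP p. ln (t ^ p / M p)))"

definition growth_order :: "(nat \<Rightarrow> real) \<Rightarrow> ereal" where
  "growth_order M = Limsup at_top (\<lambda>t. ereal (max 0 (ln (assoc_fun M t) / ln t)))"

text \<open>For strongly regular \<open>M\<close> the growth order is finite and positive.\<close>

definition omega_index :: "(nat \<Rightarrow> real) \<Rightarrow> real" where
  "omega_index M = 1 / real_of_ereal (growth_order M)"

text \<open>
  Piecewise continuous differentiability on the unbounded interval allows exceptional points
  that accumulate only at the ends of the interval, hence the restriction to compact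
  subintervals. The limit of \<open>t * \<rho>'(t) * ln t\<close> is taken along the points where the
  derivative exists, since \<open>deriv\<close> is unspecified elsewhere.
\<close>

definition nonzero_proximate_order :: "(real \<Rightarrow> real) \<Rightarrow> bool" where
  "nonzero_proximate_order \<rho> \<longleftrightarrow>
     (\<exists>c. (\<forall>t>c. \<rho> t \<ge> 0) \<and> continuous_on {c<..} \<rho> \<and>
          (\<forall>a b. c < a \<longrightarrow> \<rho> piecewise_C1_differentiable_on {a..b})) \<and>
     (\<exists>L>0. (\<rho> \<longlongrightarrow> L) at_top) \<and>
     ((\<lambda>t. t * deriv \<rho> t * ln t) \<longlongrightarrow> 0)
       (inf at_top (principal {t. \<rho> differentiable (at t)}))"

definition admits_nonzero_proximate_order :: "(nat \<Rightarrow> real) \<Rightarrow> bool" where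
  "admits_nonzero_proximate_order M \<longleftrightarrow>
     (\<exists>\<rho>. nonzero_proximate_order \<rho> \<and>
       (\<exists>A B. \<forall>\<^sub>F t in at_top.
          A \<le> ln t * (\<rho> t - ln (assoc_fun M t) / ln t) \<and>
          ln t * (\<rho> t - ln (assoc_fun M t) / ln t) \<le> B))"

definition sequence_of_order :: "(nat \<Rightarrow> real) \<Rightarrow> real \<Rightarrow> (nat \<Rightarrow> real) \<Rightarrow> bool" where
  "sequence_of_order M s m \<longleftrightarrow>
     (\<forall>p. m p > 0) \<and>
     (\<exists>A>0. \<exists>B>0. \<forall>p. A ^ p * M p powr s \<le> m p \<and> m p \<le> B ^ p * M p powr s)"

text \<open>
  The projection to the punctured plane of the sector with bisecting direction \<open>d\<close> and
  opening \<open>\<theta>\<close> on the Riemann surface of the logarithm. Only openings below \<open>2 * pi\<close> are used,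
  for which the projection is injective.
\<close>

definition sector :: "real \<Rightarrow> real \<Rightarrow> complex set" where
  "sector d \<theta> = {rcis x \<phi> | x \<phi>. x > 0 \<and> \<bar>\<phi> - d\<bar> < \<theta> / 2}"

definition moment_function :: "(complex \<Rightarrow> complex) \<Rightarrow> complex \<Rightarrow> complex" where
  "moment_function e z =
     set_lebesgue_integral lborel {0<..} (\<lambda>t. of_real t powr (z - 1) * e (of_real t))"

text \<open>
  The moments are required to be nonzero because the expansion of \<open>E\<close> divides by them.
\<close>

definition kernel_functions ::
  "(nat \<Rightarrow> real) \<Rightarrow> (complex \<Rightarrow> complex) \<Rightarrow> (complex \<Rightarrow> complex) \<Rightarrow> bool" where
  "kernel_functions M e E \<longleftrightarrow>
     (let \<omega> = omega_index M; S = sector 0 (\<omega> * pi) in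
       \<omega> < 2 \<and>
       e holomorphic_on S \<and>
       (\<exists>t0>0. \<forall>z0\<in>S. \<exists>U. open U \<and> z0 \<in> U \<and> U \<subseteq> S \<and>
          (\<integral>\<^sup>+t\<in>{0<..<t0}. (SUP z\<in>U. ennreal (cmod (e (of_real t / z)))) / ennreal t \<partial>lborel) < \<infinity>) \<and>
       (\<forall>\<epsilon>>0. \<exists>c>0. \<exists>k>0. \<forall>z\<in>sector 0 (\<omega> * pi - \<epsilon>).
          cmod (e z) \<le> c * exp (- assoc_fun M (cmod z / k))) \<and>
       (\<forall>x::real. x > 0 \<longrightarrow> e (of_real x) \<in> \<real>) \<and>
       E holomorphic_on UNIV \<and>
       (\<exists>c>0. \<exists>k>0. \<forall>z. cmod (E z) \<le> c * exp (assoc_fun M (cmod z / k))) \<and>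
       (\<exists>\<beta>>0. \<forall>\<theta> R. 0 < \<theta> \<and> \<theta> < 2 * pi - \<omega> * pi \<and> R > 0 \<longrightarrow>
          (\<exists>c>0. \<forall>z \<in> sector pi \<theta> - ball 0 R. cmod (E z) \<le> c * cmod z powr (- \<beta>))) \<and>
       continuous_on {z. Re z \<ge> 0} (moment_function e) \<and>
       moment_function e holomorphic_on {z. Re z > 0} \<and>
       (\<forall>p. moment_function e (of_nat p) \<noteq> 0) \<and>
       (\<forall>z. (\<lambda>p. z ^ p / moment_function e (of_nat p)) sums E z))"

text \<open>The moments are real because \<open>e\<close> is real-valued on the positive half-line.\<close>

definition moment_sequence :: "(nat \<Rightarrow> real) \<Rightarrow> (nat \<Rightarrow> real) \<Rightarrow> bool" where
  "moment_sequence M m \<longleftrightarrow>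
     (\<exists>e E. kernel_functions M e E \<and> (\<forall>p. of_real (m p) = moment_function e (of_nat p)))"

text \<open>
  A series in \<open>\<complex>[[t,z]]\<close> is an element of \<^typ>\<open>complex fps fps\<close>: the outer variable is \<open>t\<close>,
  and the coefficient of \<open>t ^ n\<close> is a power series in \<open>z\<close>. Moment differentiation maps
  the series with coefficients \<open>u p / m p\<close> to the one with coefficients \<open>u (p + 1) / m p\<close>.
\<close>

definition moment_deriv :: "(nat \<Rightarrow> real) \<Rightarrow> complex fps \<Rightarrow> complex fps" where
  "moment_deriv m f = Abs_fps (\<lambda>p. of_real (m (p + 1)) * f $ (p + 1) / of_real (m p))"

lemma moment_deriv_Abs_fps:
  assumes "\<And>p. m p \<noteq> 0"
  shows "moment_deriv m (Abs_fps (\<lambda>p. u p / of_real (m p))) =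
         Abs_fps (\<lambda>p. u (p + 1) / of_real (m p))"
  using assms by (simp add: moment_deriv_def fps_eq_iff)

definition moment_deriv_t :: "(nat \<Rightarrow> real) \<Rightarrow> complex fps fps \<Rightarrow> complex fps fps" where
  "moment_deriv_t m u =
     Abs_fps (\<lambda>n. fps_const (of_real (m (n + 1) / m n)) * u $ (n + 1))"

lemma moment_deriv_t_Abs_fps:
  assumes "\<And>n. m n \<noteq> 0"
  shows "moment_deriv_t m (Abs_fps (\<lambda>n. fps_const (1 / of_real (m n)) * u n)) =
         Abs_fps (\<lambda>n. fps_const (1 / of_real (m n)) * u (n + 1))"
  using assms by (simp add: moment_deriv_t_def fps_eq_iff)

definition moment_deriv_z :: "(nat \<Rightarrow> real) \<Rightarrow> complex fps fps \<Rightarrow> complex fps fps" where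
  "moment_deriv_z m u = Abs_fps (\<lambda>n. moment_deriv m (u $ n))"

definition at_t_zero :: "complex fps fps \<Rightarrow> complex fps" where
  "at_t_zero u = u $ 0"

definition at_z_zero :: "complex fps fps \<Rightarrow> complex fps" where
  "at_z_zero u = Abs_fps (\<lambda>n. u $ n $ 0)"

definition convergent_fps :: "complex fps \<Rightarrow> bool" where
  "convergent_fps f \<longleftrightarrow> fps_conv_radius f > 0"

definition convergent_fps2 :: "complex fps fps \<Rightarrow> bool" where
  "convergent_fps2 u \<longleftrightarrow>
     (\<exists>R>0. \<forall>t z. cmod t < R \<and> cmod z < R \<longrightarrow>
        (\<lambda>(n, j). u $ n $ j * t ^ n * z ^ j) summable_on UNIV)"

definition formal_solution ::
  "(nat \<Rightarrow> real) \<Rightarrow> (nat \<Rightarrow> real) \<Rightarrow> nat \<Rightarrow> nat \<Rightarrow> (complex \<Rightarrow> complex) \<Rightarrow>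
   complex fps fps \<Rightarrow> (nat \<Rightarrow> complex \<Rightarrow> complex) \<Rightarrow> complex fps fps \<Rightarrow> bool" where
  "formal_solution m1 m2 k p a f \<phi> u \<longleftrightarrow>
     (moment_deriv_t m1 ^^ k) u - fps_const (fps_expansion a 0) * (moment_deriv_z m2 ^^ p) u = f \<and>
     (\<forall>j<k. at_t_zero ((moment_deriv_t m1 ^^ j) u) = fps_expansion (\<phi> j) 0)"

end

theory Submission
  imports Defs
begin

text \<open>
  The implication from (i) to (ii) is read off the coefficients. Conversely, the initial data
  \<open>\<phi> j\<close> are analytic, so it suffices to propagate the coefficient bounds in the direction of \<open>t\<close>,
  as in the Cauchy-Kowalevski theorem: since \<open>s1 * k \<ge> s2 * p\<close>, the division by \<open>m1 (n + k) / m1 n\<close>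
  compensates \<open>p\<close> moment derivatives in \<open>z\<close>.

  Multiplication by \<open>a z\<close> costs a factor \<open>m2 j / m2 i\<close> for a jump from \<open>i\<close> to \<open>j\<close>, so geometric
  equivalence of \<open>m2\<close> with \<open>M2\<close> is not enough: one needs \<open>m2 (j + 1) / m2 j \<le> D * M2 (j + 1) / M2 j\<close>.
  The kernel \<open>e\<close> is only real-valued, so its moments need not be log-convex. Instead, the
  moment function has no zeros in the right half-plane, because for every \<open>s\<close> its product with the
  Mellin transform of a Taylor remainder of \<open>E\<close> is \<open>\<plusminus> \<Gamma>(n + 1 - s) \<Gamma>(s - n + 1)\<close>. Hence it has a
  holomorphic logarithm, whose real part satisfies a one-sided linear bound after subtraction of
  an affine function, and Cauchy's estimate controls the increments of the logarithm.
\<close>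

text \<open>Geometric equivalence of \<open>m2\<close> with \<open>M2\<close> bounds
  \<open>m2 j / m2 i\<close> only up to a factor \<open>K ^ (i + j)\<close>. The recursion in
  \<open>t\<close> would pay it in every step, and after about \<open>n / k\<close> steps the
  product is no longer geometric in \<open>n + j\<close>. A factor \<open>D ^ (j - i)\<close>, in
  contrast, is absorbed by the convolution with the coefficients of \<open>a\<close>, with the same
  constant in each step. For the moment function an upper bound is available on a whole disc about
  \<open>N\<close>, but a lower bound only at the centre, from the Taylor coefficients of
  \<open>E\<close>. The absence of zeros is what makes these two suffice. The compensation between
  \<open>t\<close> and \<open>z\<close> rests on the identity
  \<open>(j + p) * k + n * p = j * k + (n + k) * p\<close>: a function of
  \<open>j * k + n * p\<close> does not see \<open>p\<close> derivatives in \<open>z\<close> being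
  traded for \<open>k\<close> in \<open>t\<close>. Since \<open>M2 (j * k + n * p)\<close> is
  comparable to \<open>M2 j ^ k * M2 n ^ p\<close>, its \<open>k\<close>-th root stands for
  \<open>m2 j\<close> times \<open>M n powr (s2 * p / k)\<close>. The power of \<open>M n\<close>
  missing to \<open>m1 n\<close> has the exponent \<open>s1 - s2 * p / k\<close>, and its being
  nonnegative is the hypothesis on the orders.\<close>

definition quot :: "(nat \<Rightarrow> real) \<Rightarrow> nat \<Rightarrow> real" where
  "quot M p = M (Suc p) / M p"

section \<open>Quotients and associated function of a strongly regular sequence\<close>

lemma strongly_regularD:
  assumes "strongly_regular M"
  shows strongly_regular_pos: "M p > 0"
    and strongly_regular_0: "M 0 = 1"
    and strongly_regular_quot_pos: "quot M p > 0"
    and strongly_regular_quot_Suc: "quot M p \<le> quot M (Suc p)"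
proof -
  have pos: "M p > 0" for p
    using assms by (auto simp: strongly_regular_def)
  show "M p > 0" "quot M p > 0"
    using pos by (auto simp: quot_def)
  show "M 0 = 1"
    using assms by (auto simp: strongly_regular_def)
  have "(M (Suc p))\<^sup>2 \<le> M p * M (Suc (Suc p))"
    using assms unfolding strongly_regular_def by (metis Suc_eq_plus1 diff_Suc_1 le_add2)
  then show "quot M p \<le> quot M (Suc p)"
    using pos[of p] pos[of "Suc p"] by (simp add: quot_def field_simps power2_eq_square)
qed

lemma strongly_regular_mg:
  assumes "strongly_regular M"
  obtains A where "A \<ge> 1" and "\<And>p q. M (p + q) \<le> A ^ (p + q) * M p * M q"
proof -
  obtain A where A: "A > 0" "\<And>p q. M (p + q) \<le> A ^ (p + q) * M p * M q"
    using assms by (auto simp: strongly_regular_def)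
  have "M (p + q) \<le> max 1 A ^ (p + q) * M p * M q" for p q
    using A(1) strongly_regular_pos[OF assms]
    by (intro order.trans[OF A(2)] mult_right_mono power_mono) (auto intro: less_imp_le)
  with that[of "max 1 A"] show thesis by auto
qed

lemma quot_mono:
  assumes "strongly_regular M" "p \<le> q"
  shows "quot M p \<le> quot M q"
  by (rule lift_Suc_mono_le[of "quot M", OF _ assms(2)]) (rule strongly_regular_quot_Suc[OF assms(1)])

text \<open>\<open>M n\<close> is the product of its first \<open>n\<close> quotients, and none of
  them exceeds \<open>quot M n\<close>. This is how the \<open>N\<close>-th root of
  \<open>M N\<close> in the moment bounds is finally replaced by a quotient.\<close>

lemma le_quot_power:
  assumes "strongly_regular M"
  shows "M n \<le> quot M n ^ n"
proof (induction n)
  case (Suc n)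
  note pos = strongly_regular_pos[OF assms] strongly_regular_quot_pos[OF assms]
  have "M (Suc n) = M n * quot M n"
    using pos(1)[of n] by (simp add: quot_def)
  also have "\<dots> \<le> quot M n ^ n * quot M n"
    using Suc pos by (intro mult_right_mono) (auto intro: less_imp_le)
  also have "\<dots> = quot M n ^ Suc n"
    by simp
  also have "\<dots> \<le> quot M (Suc n) ^ Suc n"
    using pos quot_mono[OF assms, of n "Suc n"] by (intro power_mono) (auto intro: less_imp_le)
  finally show ?case .
qed (simp add: strongly_regular_0[OF assms])

text \<open>Consecutive terms of \<open>t ^ p / M p\<close> have the ratio
  \<open>t / quot M p\<close>. For \<open>t = quot M N\<close> this is at least 1 up to
  \<open>p = N\<close> and at most 1 from there on, so the maximum sits at \<open>N\<close>.\<close>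

lemma power_div_le_at_quot:
  assumes sr: "strongly_regular M"
  shows "quot M N ^ p / M p \<le> quot M N ^ N / M N"
proof -
  define h where "h p = quot M N ^ p / M p" for p
  note pos = strongly_regular_pos[OF sr] strongly_regular_quot_pos[OF sr]
  have h_Suc: "h (Suc p) = h p * (quot M N / quot M p)" for p
    using pos(1)[of p] pos(1)[of "Suc p"] by (simp add: h_def quot_def field_simps)
  have h_pos: "h p > 0" for p
    using pos by (simp add: h_def)
  have up: "h p \<le> h (Suc p)" if "p \<le> N" for p
    using mult_left_mono[of 1 "quot M N / quot M p" "h p"] quot_mono[OF sr that] pos h_pos[of p]
    by (simp add: h_Suc)
  have down: "h (Suc p) \<le> h p" if "N \<le> p" for p
    using mult_left_mono[of "quot M N / quot M p" 1 "h p"] quot_mono[OF sr that] pos h_pos[of p]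
    by (simp add: h_Suc)
  have "h p \<le> h N"
  proof (cases "p \<le> N")
    case True
    then show ?thesis
    proof (induction p rule: inc_induct)
      case (step n)
      then show ?case using up[of n] by simp
    qed simp
  next
    case False
    then have "N \<le> p" by simp
    then show ?thesis
    proof (induction p rule: dec_induct)
      case (step n)
      then show ?case using down[of n] by simp
    qed simp
  qed
  then show ?thesis by (simp add: h_def)
qed

text \<open>Bounded quotients would make the series in (snq) dominate a multiple of the harmonic
  series.\<close>

lemma quot_unbounded:
  assumes sr: "strongly_regular M"
  shows "\<exists>N. t \<le> quot M N"
proof (rule ccontr)
  assume "\<not> ?thesis"
  then have less: "quot M N < t" for N
    by (simp add: not_le)
  then have t: "t > 0"
    using strongly_regular_quot_pos[OF sr, of 0] by (meson less_trans)
  note pos = strongly_regular_pos[OF sr]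
  have "(\<lambda>q. M q / ((real q + 1) * M (q + 1))) summable_on {0..}"
    using sr unfolding strongly_regular_def by blast
  then have "summable (\<lambda>q. M q / ((real q + 1) * M (q + 1)))"
    by (simp add: summable_on_UNIV_nonneg_real_iff pos less_imp_le atLeast_0)
  then have "summable (\<lambda>q. inverse t * inverse (real (Suc q)))"
  proof (rule summable_comparison_test'[where N = 0])
    fix q
    have "inverse t \<le> M q / M (q + 1)"
      using less[of q] pos[of q] pos[of "q + 1"] t by (simp add: quot_def field_simps)
    then have "inverse t * inverse (real (Suc q)) \<le> M q / M (q + 1) * inverse (real (Suc q))"
      by (intro mult_right_mono) auto
    then show "norm (inverse t * inverse (real (Suc q))) \<le> M q / ((real q + 1) * M (q + 1))"
      using t by (simp add: field_simps)
  qed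
  then have "summable (\<lambda>q. inverse (real (Suc q)))"
    using t by (simp add: summable_cmult_iff)
  then show False
    using not_summable_harmonic[where 'a = real] by (subst (asm) summable_Suc_iff) auto
qed

text \<open>Unboundedness of the quotients bounds the set under the real-valued \<open>SUP\<close>,
  without which the supremum would say nothing. At the radius \<open>quot M N\<close> the supremum
  is attained at index \<open>N\<close>, which makes these radii the right ones for Cauchy
  estimates.\<close>

lemma exp_assoc_fun:
  assumes sr: "strongly_regular M"
  shows power_div_le_exp_assoc_fun: "t > 0 \<Longrightarrow> t ^ p / M p \<le> exp (assoc_fun M t)"
    and exp_assoc_fun_quot: "exp (assoc_fun M (quot M N)) \<le> quot M N ^ N / M N"
proof -
  note pos = strongly_regular_pos[OF sr] strongly_regular_quot_pos[OF sr]
  show "t ^ p / M p \<le> exp (assoc_fun M t)" if t: "t > 0"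
  proof -
    obtain N where N: "t \<le> quot M N"
      using quot_unbounded[OF sr] by blast
    have "t ^ q / M q \<le> quot M N ^ N / M N" for q
      using t N pos
      by (intro order.trans[OF _ power_div_le_at_quot[OF sr, of N q]] divide_right_mono power_mono)
        (auto intro: less_imp_le)
    then have "bdd_above (range (\<lambda>q. ln (t ^ q / M q)))"
      using t pos by (intro bdd_aboveI[where M = "ln (quot M N ^ N / M N)"]) auto
    then have "ln (t ^ p / M p) \<le> assoc_fun M t"
      using t by (auto simp: assoc_fun_def intro!: cSUP_upper)
    then show ?thesis
      using t pos by (metis exp_le_cancel_iff exp_ln divide_pos_pos zero_less_power)
  qed
  have "assoc_fun M (quot M N) \<le> ln (quot M N ^ N / M N)"
    using pos power_div_le_at_quot[OF sr]
    by (auto simp: assoc_fun_def less_imp_neq[THEN not_sym] intro!: cSUP_least)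
  then show "exp (assoc_fun M (quot M N)) \<le> quot M N ^ N / M N"
    using pos by (metis exp_le_cancel_iff exp_ln divide_pos_pos zero_less_power)
qed

text \<open>A proximate order differs from \<open>ln (assoc_fun M t) / ln t\<close> by
  \<open>O(1 / ln t)\<close>, so the growth order is its limit, finite and positive. By the defaults
  of \<open>real_of_ereal\<close> and of division, an infinite or zero growth order would give index
  0 and hence an empty sector for \<open>e\<close>.\<close>

lemma omega_index_pos:
  assumes "admits_nonzero_proximate_order M"
  shows "omega_index M > 0"
proof -
  define r where "r t = ln (assoc_fun M t) / ln t" for t
  obtain \<rho> A B where \<rho>: "nonzero_proximate_order \<rho>"
    and AB: "\<forall>\<^sub>F t in at_top. A \<le> ln t * (\<rho> t - r t) \<and> ln t * (\<rho> t - r t) \<le> B"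
    using assms by (auto simp: admits_nonzero_proximate_order_def r_def)
  obtain L where L: "L > 0" "(\<rho> \<longlongrightarrow> L) at_top"
    using \<rho> by (auto simp: nonzero_proximate_order_def)
  have "((\<lambda>t. \<rho> t - r t) \<longlongrightarrow> 0) at_top"
  proof (rule tendsto_sandwich)
    have "((\<lambda>t. c / ln t) \<longlongrightarrow> 0) at_top" for c :: real
      by (rule real_tendsto_divide_at_top[OF tendsto_const ln_at_top])
    then show "((\<lambda>t. A / ln t) \<longlongrightarrow> 0) at_top" "((\<lambda>t. B / ln t) \<longlongrightarrow> 0) at_top"
      by blast+
    show "\<forall>\<^sub>F t in at_top. A / ln t \<le> \<rho> t - r t" "\<forall>\<^sub>F t in at_top. \<rho> t - r t \<le> B / ln t"
      using AB eventually_gt_at_top[of 1] by (eventually_elim, simp add: field_simps)+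
  qed
  with L(2) have "((\<lambda>t. \<rho> t - (\<rho> t - r t)) \<longlongrightarrow> L - 0) at_top"
    by (rule tendsto_diff)
  then have "(r \<longlongrightarrow> L) at_top"
    by simp
  then have "((\<lambda>t. max 0 (r t)) \<longlongrightarrow> max 0 L) at_top"
    by (intro tendsto_max tendsto_const)
  then have "((\<lambda>t. ereal (max 0 (r t))) \<longlongrightarrow> ereal L) at_top"
    using L(1) by (simp add: max_def)
  then have "growth_order M = ereal L"
    unfolding growth_order_def r_def by (intro lim_imp_Limsup) auto
  then show ?thesis
    using L by (simp add: omega_index_def)
qed

section \<open>Mellin transforms\<close>

lemma continuous_on_of_real_powr:
  "continuous_on {0<..} (\<lambda>t::real. complex_of_real t powr z)"
  by (intro continuous_intros) (auto simp: complex_nonpos_Reals_iff)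

text \<open>The integral is split at \<open>T\<close>, with the constant bound used before and the
  power bound after it. The cut stays free because \<open>abs_moment_bound\<close> places it where
  the two pieces balance.\<close>

lemma mellin_bound:
  fixes g :: "real \<Rightarrow> complex"
  assumes cont: "continuous_on {0<..} g"
    and x: "0 < Re z" "Re z < q" and pos: "T > 0" "b \<ge> 0" "B \<ge> 0"
    and b: "\<And>t. t > 0 \<Longrightarrow> norm (g t) \<le> b"
    and B: "\<And>t. t > 0 \<Longrightarrow> norm (g t) \<le> B * t powr (- q)"
  shows mellin_integrable: "set_integrable lborel {0<..} (\<lambda>t. of_real t powr (z - 1) * g t)"
    and mellin_norm_le: "(LINT t:{0<..}|lborel. norm (of_real t powr (z - 1) * g t))
           \<le> b * T powr Re z / Re z + B * T powr (Re z - q) / (q - Re z)"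
proof -
  define x where "x = Re z"
  define h where "h t = indicator {0<..} t *\<^sub>R (of_real t powr (z - 1) * g t)" for t :: real
  define I1 where "I1 = b * (T powr x / x)"
  define I2 where "I2 = B * (T powr (x - q) / (q - x))"
  have I: "I1 \<ge> 0" "I2 \<ge> 0"
    using pos x by (auto simp: I1_def I2_def x_def)
  have meas: "h \<in> borel_measurable borel"
    unfolding h_def
    by (intro borel_measurable_continuous_on_indicator continuous_intros cont
        continuous_on_of_real_powr) auto
  have "((\<lambda>t. t powr (x - 1)) has_integral (T powr x / x)) {0..T}"
    using has_integral_powr_from_0[of "x - 1" T] x pos by (simp add: x_def)
  then have 1: "((\<lambda>t. b * t powr (x - 1)) has_integral I1) {0..T}"
    unfolding I1_def by (rule has_integral_mult_right)
  have "((\<lambda>t. t powr (x - 1 - q)) has_integral (T powr (x - q) / (q - x))) {T..}"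
  proof -
    have "- (T powr (x - q)) / (x - q) = T powr (x - q) / (q - x)"
      by (metis minus_diff_eq minus_divide_divide minus_minus)
    then show ?thesis
      using has_integral_powr_to_inf[of "x - 1 - q" T] x pos by (simp add: x_def)
  qed
  then have 2: "((\<lambda>t. B * t powr (x - 1 - q)) has_integral I2) {T..}"
    unfolding I2_def by (rule has_integral_mult_right)
  have "(\<integral>\<^sup>+t. norm (h t) \<partial>lborel)
      \<le> (\<integral>\<^sup>+t. ennreal (indicator {0..T} t * (b * t powr (x - 1)))
              + ennreal (indicator {T..} t * (B * t powr (x - 1 - q))) \<partial>lborel)"
  proof (intro nn_integral_mono)
    fix t :: real
    have "norm (h t) \<le> indicator {0..T} t * (b * t powr (x - 1))
              + indicator {T..} t * (B * t powr (x - 1 - q))"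
    proof (cases "t > 0")
      case t: True
      have n: "norm (h t) = t powr (x - 1) * norm (g t)"
        using t by (simp add: h_def norm_mult norm_powr_real_powr x_def)
      show ?thesis
      proof (cases "t \<le> T")
        case True
        have "norm (h t) \<le> b * t powr (x - 1)"
          using b[OF t] mult_left_mono[of "norm (g t)" b "t powr (x - 1)"] by (simp add: n mult.commute)
        moreover have "0 \<le> B * t powr (x - 1 - q)"
          using pos by simp
        ultimately show ?thesis
          using True t by (auto simp: indicator_def)
      next
        case False
        have "norm (h t) \<le> t powr (x - 1) * (B * t powr (- q))"
          using B[OF t] by (simp add: n mult_left_mono)
        also have "\<dots> = B * t powr (x - 1 - q)"
          by (simp only: diff_conv_add_uminus powr_add mult_ac)
        finally show ?thesis
          using False t by (simp add: indicator_def)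
      qed
    qed (use pos in \<open>auto simp: h_def\<close>)
    then show "ennreal (norm (h t)) \<le> ennreal (indicator {0..T} t * (b * t powr (x - 1)))
              + ennreal (indicator {T..} t * (B * t powr (x - 1 - q)))"
      using pos by (simp add: ennreal_leI flip: ennreal_plus)
  qed
  also have "\<dots> = ennreal I1 + ennreal I2"
    using nn_integral_has_integral_lebesgue[OF _ 1] nn_integral_has_integral_lebesgue[OF _ 2] pos
    by (subst nn_integral_add) auto
  also have "\<dots> = ennreal (I1 + I2)"
    using I by simp
  finally have le: "(\<integral>\<^sup>+t. norm (h t) \<partial>lborel) \<le> ennreal (I1 + I2)" .
  have int: "integrable lborel h"
    using le meas by (intro integrableI_bounded) (auto intro: le_less_trans)
  then show "set_integrable lborel {0<..} (\<lambda>t. of_real t powr (z - 1) * g t)"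
    unfolding set_integrable_def h_def .
  have "ennreal (integral\<^sup>L lborel (\<lambda>t. norm (h t))) \<le> ennreal (I1 + I2)"
    using le int by (subst nn_integral_eq_integral[symmetric]) auto
  then have "integral\<^sup>L lborel (\<lambda>t. norm (h t)) \<le> I1 + I2"
    using I by (simp del: ennreal_plus flip: ennreal_plus)
  also have "integral\<^sup>L lborel (\<lambda>t. norm (h t)) = (LINT t:{0<..}|lborel. norm (of_real t powr (z - 1) * g t))"
    unfolding set_lebesgue_integral_def by (intro Bochner_Integration.integral_cong) (auto simp: h_def indicator_def)
  finally show "(LINT t:{0<..}|lborel. norm (of_real t powr (z - 1) * g t))
           \<le> b * T powr Re z / Re z + B * T powr (Re z - q) / (q - Re z)"
    by (simp add: I1_def I2_def x_def)
qed

text \<open>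
  Substituting \<open>u = x * t\<close> separates the variables of the double integral.
\<close>

lemma mellin_convolution:
  fixes f e :: "real \<Rightarrow> complex"
  assumes cont: "continuous_on {0<..} f" "continuous_on {0<..} e"
    and f: "set_integrable lborel {0<..} (\<lambda>u. of_real u powr (- s - 1) * f u)"
    and e: "set_integrable lborel {0<..} (\<lambda>t. of_real t powr (s - 1) * e t)"
  shows "(LINT x:{0<..}|lborel. of_real x powr (- s - 1) *
            (LINT t:{0<..}|lborel. f (x * t) * e t / of_real t)) =
         (LINT t:{0<..}|lborel. of_real t powr (s - 1) * e t) *
         (LINT u:{0<..}|lborel. of_real u powr (- s - 1) * f u)"
proof -
  define F where "F = (\<lambda>u::real. indicator {0<..} u *\<^sub>R (of_real u powr (- s - 1) * f u))"
  define G where "G = (\<lambda>t::real. indicator {0<..} t *\<^sub>R (of_real t powr (s - 1) * e t))"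
  \<comment> \<open>The factor \<open>of_real t\<close> cancels the \<open>1 / t\<close> that the
    substitution produces in the integral over \<open>x\<close>, which thereby becomes a constant
    times \<open>G t\<close>.\<close>
  define K where "K t x = of_real t * F (t * x) * G t" for t x :: real
  have F: "integrable lborel F" and G: "integrable lborel G"
    using f e by (auto simp: F_def G_def set_integrable_def)
  have [measurable]: "F \<in> borel_measurable borel" "G \<in> borel_measurable borel"
    using F G by (auto dest: borel_measurable_integrable)
  have scale: "(LINT x|lborel. F (t * x)) = integral\<^sup>L lborel F / of_real t"
    and scale_norm: "(LINT x|lborel. norm (F (t * x))) = (LINT x|lborel. norm (F x)) / t" 
    and int_scale: "integrable lborel (\<lambda>x. F (t * x))" if "t > 0" for t
    using lborel_integral_real_affine[of t F 0] lborel_integral_real_affine[of t "\<lambda>x. norm (F x)" 0] that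
      lborel_integrable_real_affine[of F t 0] F
    by (auto simp: scaleR_conv_of_real)
  have K_eq: "K t x = indicator {0<..} x *\<^sub>R indicator {0<..} t *\<^sub>R
      (of_real x powr (- s - 1) * (f (x * t) * e t / of_real t))" for t x
  proof (cases "t > 0 \<and> x > 0")
    case True
    then have "complex_of_real (t * x) powr (- s - 1) =
        of_real t powr (- s - 1) * of_real x powr (- s - 1)"
      by (simp add: powr_times_real)
    then have "K t x = (of_real t * of_real t powr (- s - 1) * of_real t powr (s - 1)) *
        (of_real x powr (- s - 1) * (f (x * t) * e t))"
      using True by (simp add: K_def F_def G_def mult_ac zero_less_mult_iff)
    also have "of_real t * of_real t powr (- s - 1) * of_real t powr (s - 1) = 1 / complex_of_real t"
    proof -
      have "of_real t * of_real t powr (- s - 1) * of_real t powr (s - 1) = 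
         complex_of_real t powr 1 * of_real t powr (- s - 1) * of_real t powr (s - 1)"
        using True by simp
      also have "\<dots> = of_real t powr (1 + (- s - 1) + (s - 1))"
        by (simp only: powr_add)
      also have "\<dots> = 1 / complex_of_real t"
        using True by (simp add: powr_minus divide_inverse)
      finally show ?thesis .
    qed
    finally show ?thesis
      using True by simp
  next
    case False
    then show ?thesis
      by (auto simp: K_def F_def G_def zero_less_mult_iff split: split_indicator)
  qed
  have int: "integrable (lborel \<Otimes>\<^sub>M lborel) (case_prod K)"
  proof (rule lborel_pair.Fubini_integrable)
    show "case_prod K \<in> borel_measurable (lborel \<Otimes>\<^sub>M lborel)"
      unfolding K_def by measurable
    have "(\<lambda>t. LINT x|lborel. norm (case_prod K (t, x))) = 
        (\<lambda>t. (LINT x|lborel. norm (F x)) * norm (G t))"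
    proof
      fix t :: real
      show "(LINT x|lborel. norm (case_prod K (t, x))) = (LINT x|lborel. norm (F x)) * norm (G t)"
      proof (cases "t > 0")
        case True
        then show ?thesis
          by (simp add: K_def norm_mult scale_norm)
      qed (simp add: K_def G_def)
    qed
    then show "integrable lborel (\<lambda>t. LINT x|lborel. norm (case_prod K (t, x)))"
      using G by simp
    have "integrable lborel (\<lambda>x. K t x)" for t
      by (cases "t > 0") (auto simp: K_def G_def intro!: integrable_mult_left integrable_mult_right int_scale)
    then show "AE t in lborel. integrable lborel (\<lambda>x. case_prod K (t, x))"
      by simp
  qed
  have "(LINT x:{0<..}|lborel. of_real x powr (- s - 1) *
            (LINT t:{0<..}|lborel. f (x * t) * e t / of_real t)) = (LINT x|lborel. LINT t|lborel. K t x)"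
    unfolding set_lebesgue_integral_def K_eq
    by (intro Bochner_Integration.integral_cong refl)
      (simp flip: integral_mult_right_zero integral_scaleR_right)
  also have "\<dots> = (LINT t|lborel. LINT x|lborel. K t x)"
    using int by (rule lborel_pair.Fubini_integral)
  also have "(\<lambda>t. LINT x|lborel. K t x) = (\<lambda>t. integral\<^sup>L lborel F * G t)"
  proof
    fix t :: real
    show "(LINT x|lborel. K t x) = integral\<^sup>L lborel F * G t"
    proof (cases "t > 0")
      case True
      then show ?thesis by (simp add: K_def scale)
    qed (simp add: K_def G_def)
  qed
  also have "(LINT t|lborel. integral\<^sup>L lborel F * G t) = integral\<^sup>L lborel G * integral\<^sup>L lborel F"
    by (simp add: mult.commute)
  finally show ?thesis
    by (simp add: set_lebesgue_integral_def F_def G_def)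
qed

text \<open>Dominating \<open>F\<close> itself is enough: Cauchy's estimate turns the majorant
  \<open>h\<close> into the majorant \<open>h t * (2 / r)\<close> of the difference quotients on the
  disc of half the radius, and dominated convergence applies along every sequence tending to
  \<open>z\<close>.\<close>

lemma holomorphic_on_dominated_integral:
  fixes F :: "complex \<Rightarrow> real \<Rightarrow> complex"
  assumes S: "open S"
    and holo: "\<And>t. t \<in> T \<Longrightarrow> (\<lambda>z. F z t) holomorphic_on S"
    and meas: "\<And>z. z \<in> S \<Longrightarrow> set_borel_measurable lborel T (F z)"
    and dom: "\<And>z. z \<in> S \<Longrightarrow> \<exists>r>0. \<exists>h. cball z r \<subseteq> S \<and> set_integrable lborel T h \<and>
               (\<forall>w\<in>cball z r. \<forall>t\<in>T. cmod (F w t) \<le> h t)"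
  shows "(\<lambda>z. LINT t:T|lborel. F z t) holomorphic_on S"
proof -
  have int: "set_integrable lborel T (F z)" if "z \<in> S" for z
  proof -
    from dom[OF that] obtain r and h :: "real \<Rightarrow> real" where h: "r > 0" "set_integrable lborel T h"
      "\<And>w t. w \<in> cball z r \<Longrightarrow> t \<in> T \<Longrightarrow> cmod (F w t) \<le> h t"
      by blast
    from h(2) have "integrable lborel (\<lambda>t. indicator T t *\<^sub>R h t)"
      by (simp add: set_integrable_def)
    then show ?thesis
      unfolding set_integrable_def
      by (rule Bochner_Integration.integrable_bound)
        (use meas[OF that] h(1) h(3)[of z] in
          \<open>auto simp: set_borel_measurable_def indicator_def intro!: AE_I2 order.trans[OF _ abs_ge_self]\<close>)
  qed
  have "(\<lambda>z. LINT t:T|lborel. F z t) field_differentiable at z" if z: "z \<in> S" for z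
  proof -
    from dom[OF z] obtain r and h :: "real \<Rightarrow> real" where r: "r > 0" "cball z r \<subseteq> S"
      and h: "set_integrable lborel T h" "\<And>w t. w \<in> cball z r \<Longrightarrow> t \<in> T \<Longrightarrow> cmod (F w t) \<le> h t"
      by blast
    have d: "((\<lambda>z. F z t) has_field_derivative deriv (\<lambda>z. F z t) w) (at w)" if "t \<in> T" "w \<in> S" for t w
      using holomorphic_derivI[OF holo[OF that(1)] S that(2)] .
    define q where "q w t = indicator T t *\<^sub>R ((F w t - F z t) / (w - z))" for w t
    define q' where "q' t = indicator T t *\<^sub>R deriv (\<lambda>z. F z t) z" for t
    have q_bound: "cmod (q w t) \<le> indicator T t *\<^sub>R (h t * (2 / r))"
      if w: "w \<in> ball z (r / 2)" "w \<noteq> z" for w t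
    proof (cases "t \<in> T")
      case True
      have "cmod (deriv (\<lambda>z. F z t) v) \<le> h t * (2 / r)" if v: "v \<in> ball z (r / 2)" for v
      proof -
        have sub: "cball v (r / 2) \<subseteq> cball z r"
        proof
          fix y assume "y \<in> cball v (r / 2)"
          then show "y \<in> cball z r"
            using v dist_triangle[of z y v] by (simp add: dist_commute)
        qed
        have "(\<lambda>z. F z t) holomorphic_on cball v (r / 2)"
          using sub r holo[OF True] by (blast intro: holomorphic_on_subset)
        then have "cmod ((deriv ^^ 1) (\<lambda>z. F z t) v) \<le> fact 1 * h t / (r / 2) ^ 1"
        proof (intro Cauchy_inequality)
          fix y assume "cmod (v - y) = r / 2"
          then have "y \<in> cball v (r / 2)"
            by (simp add: dist_norm)
          with sub True show "cmod (F y t) \<le> h t"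
            using h(2) by blast
        qed (use r in \<open>auto intro: holomorphic_on_subset holomorphic_on_imp_continuous_on\<close>)
        then show ?thesis by (simp add: field_simps)
      qed
      moreover have "((\<lambda>z. F z t) has_field_derivative deriv (\<lambda>z. F z t) v) (at v within ball z (r / 2))"
        if v: "v \<in> ball z (r / 2)" for v
      proof -
        have "v \<in> cball z r"
          using v r(1) by simp
        with r(2) d[OF True] show ?thesis
          by (blast intro: has_field_derivative_at_within)
      qed
      ultimately have "cmod (F w t - F z t) \<le> h t * (2 / r) * cmod (w - z)"
        using w r
        by (intro field_differentiable_bound[where S = "ball z (r / 2)"
              and f' = "deriv (\<lambda>z. F z t)"]) auto
      then show ?thesis
        using True w by (simp add: q_def norm_divide divide_le_eq)
    qed (simp add: q_def)
    have "((\<lambda>w. ((LINT t:T|lborel. F w t) - (LINT t:T|lborel. F z t)) / (w - z)) \<longlongrightarrow> integral\<^sup>L lborel q') (at z)"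
      unfolding tendsto_at_iff_sequentially comp_def
    proof (intro allI impI)
      fix X :: "nat \<Rightarrow> complex"
      assume X: "\<forall>i. X i \<in> UNIV - {z}" "X \<longlonglongrightarrow> z"
      obtain N where N: "\<And>i. i \<ge> N \<Longrightarrow> X i \<in> ball z (r / 2)"
        using X(2) r unfolding lim_sequentially by (metis dist_commute half_gt_zero mem_ball)
      define Y where "Y i = X (i + N)" for i
      have Y: "Y i \<in> ball z (r / 2)" "Y i \<noteq> z" "Y i \<in> S" for i
        using N[of "i + N"] X(1) r by (auto simp: Y_def subset_eq)
      have Ylim: "Y \<longlonglongrightarrow> z"
        unfolding Y_def using X(2) by (rule LIMSEQ_ignore_initial_segment)
      have qm: "q (Y i) \<in> borel_measurable lborel" for i
      proof -
        have "q (Y i) = (\<lambda>t. (indicator T t *\<^sub>R F (Y i) t - indicator T t *\<^sub>R F z t) / (Y i - z))"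
          by (auto simp: q_def indicator_def)
        then show ?thesis
          using meas[OF Y(3)[of i]] meas[OF z] by (simp add: set_borel_measurable_def)
      qed
      have qlim: "(\<lambda>i. q (Y i) t) \<longlonglongrightarrow> q' t" for t
      proof (cases "t \<in> T")
        case True
        have "((\<lambda>w. (F w t - F z t) / (w - z)) \<longlongrightarrow> deriv (\<lambda>z. F z t) z) (at z)"
          using d[OF True z] by (simp add: has_field_derivative_iff)
        then have "(\<lambda>i. (F (Y i) t - F z t) / (Y i - z)) \<longlonglongrightarrow> deriv (\<lambda>z. F z t) z"
          unfolding tendsto_at_iff_sequentially comp_def using Y(2) Ylim by blast
        with True show ?thesis
          by (simp add: q_def q'_def)
      qed (simp add: q_def q'_def)
      \<comment> \<open>No joint measurability of the derivative is assumed; it is a pointwise limit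
        of measurable difference quotients.\<close>
      have "q' \<in> borel_measurable lborel"
        using qm qlim by (rule borel_measurable_LIMSEQ_metric)
      then have "(\<lambda>i. integral\<^sup>L lborel (q (Y i))) \<longlonglongrightarrow> integral\<^sup>L lborel q'"
      proof (rule integral_dominated_convergence[OF _ qm, of _ "\<lambda>t. indicator T t *\<^sub>R (h t * (2 / r))"])
        show "integrable lborel (\<lambda>t. indicat_real T t *\<^sub>R (h t * (2 / r)))"
          using h(1) set_integrable_mult_left[of "2 / r" lborel T h] by (simp add: set_integrable_def)
      qed (use qlim q_bound Y in auto)
      moreover have "integral\<^sup>L lborel (q (Y i)) =
          ((LINT t:T|lborel. F (Y i) t) - (LINT t:T|lborel. F z t)) / (Y i - z)" for i
      proof -
        have "q (Y i) = (\<lambda>t. (indicator T t *\<^sub>R (F (Y i) t - F z t)) / (Y i - z))"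
          by (simp add: q_def fun_eq_iff scaleR_conv_of_real)
        then have "integral\<^sup>L lborel (q (Y i)) = (LINT t:T|lborel. F (Y i) t - F z t) / (Y i - z)"
          by (simp add: set_lebesgue_integral_def)
        also have "(LINT t:T|lborel. F (Y i) t - F z t) =
            (LINT t:T|lborel. F (Y i) t) - (LINT t:T|lborel. F z t)"
          using int[OF Y(3)[of i]] int[OF z] by (rule set_integral_diff)
        finally show ?thesis .
      qed
      ultimately have "(\<lambda>i. ((LINT t:T|lborel. F (X (i + N)) t) - (LINT t:T|lborel. F z t)) / (X (i + N) - z))
          \<longlonglongrightarrow> integral\<^sup>L lborel q'"
        by (simp add: Y_def)
      then show "(\<lambda>i. ((LINT t:T|lborel. F (X i) t) - (LINT t:T|lborel. F z t)) / (X i - z))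
          \<longlonglongrightarrow> integral\<^sup>L lborel q'"
        by (rule LIMSEQ_offset)
    qed
    then show ?thesis
      unfolding field_differentiable_def has_field_derivative_iff by blast
  qed
  then show ?thesis
    using S by (auto simp: holomorphic_on_open field_differentiable_def)
qed

section \<open>Kernel functions and their moments\<close>

text \<open>The properties of kernel functions in the form in which they are used: decay of
  \<open>e\<close> on the positive half-line only, and mere boundedness of \<open>E\<close> near the
  negative half-line, with the sector replaced by a cone of slope \<open>\<kappa>\<close>. The
  threshold \<open>1 / 2\<close> leaves room for Cauchy discs about points of modulus at least
  1.\<close>

locale kernel =
  fixes M :: "nat \<Rightarrow> real" and e E :: "complex \<Rightarrow> complex" and c k cE kE \<kappa> cD :: real
  assumes sr: "strongly_regular M"
    and params: "c > 0" "k > 0" "cE > 0" "kE > 0" "\<kappa> > 0"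
    and e_cont: "continuous_on {0<..} (\<lambda>t::real. e (of_real t))"
    and e_bound: "\<And>t. t > 0 \<Longrightarrow> cmod (e (of_real t)) \<le> c * exp (- assoc_fun M (t / k))"
    and E_holo: "E holomorphic_on UNIV"
    and E_bound: "\<And>z. cmod (E z) \<le> cE * exp (assoc_fun M (cmod z / kE))"
    and E_cone: "\<And>z. \<lbrakk>Re z > 0; \<bar>Im z\<bar> < \<kappa> * Re z; cmod z \<ge> 1 / 2\<rbrakk> \<Longrightarrow> cmod (E (- z)) \<le> cD"
    and moment_holo: "moment_function e holomorphic_on {z. Re z > 0}"
    and moment_nz: "moment_function e (of_nat p) \<noteq> 0"
    and E_sums: "(\<lambda>p. z ^ p / moment_function e (of_nat p)) sums E z"
begin

lemmas M_pos = strongly_regular_pos[OF sr]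
lemmas quot_pos = strongly_regular_quot_pos[OF sr]

text \<open>Keeps a single term of the supremum in the associated function; \<open>q\<close> is then
  chosen according to the abscissa of the Mellin transform.\<close>

lemma e_le_power:
  assumes "t > 0"
  shows "cmod (e (of_real t)) \<le> c * M q * k ^ q * t powr (- real q)"
proof -
  have "(t / k) ^ q / M q \<le> exp (assoc_fun M (t / k))"
    using assms params by (intro power_div_le_exp_assoc_fun[OF sr]) auto
  moreover have "(t / k) ^ q / M q > 0"
    using assms params M_pos by simp
  ultimately have "inverse (exp (assoc_fun M (t / k))) \<le> inverse ((t / k) ^ q / M q)"
    by (rule le_imp_inverse_le)
  then have "exp (- assoc_fun M (t / k)) \<le> M q * (k / t) ^ q"
    by (simp add: exp_minus power_divide mult.commute)
  then have "c * exp (- assoc_fun M (t / k)) \<le> c * (M q * (k / t) ^ q)"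
    using params by (intro mult_left_mono) auto
  also have "\<dots> = c * M q * k ^ q * t powr (- real q)"
    using assms by (simp add: powr_minus powr_realpow power_divide field_simps)
  finally show ?thesis
    using e_bound[OF assms] by simp
qed

lemma e_le:
  assumes "t > 0"
  shows "cmod (e (of_real t)) \<le> c"
  using e_le_power[OF assms, of 0] assms strongly_regular_0[OF sr] by simp

lemma moment_integrable:
  assumes "Re z > 0"
  shows "set_integrable lborel {0<..} (\<lambda>t. of_real t powr (z - 1) * e (of_real t))"
proof -
  obtain q where q: "Re z < real q"
    using reals_Archimedean2 by blast
  show ?thesis
    using assms q e_le e_le_power[of _ q] params M_pos[of q]
    by (intro mellin_integrable[where b = c and B = "c * M q * k ^ q" and q = "real q" and T = 1] e_cont)
      auto
qed

lemma moment_norm_le: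
  assumes "Re z > 0"
  shows "cmod (moment_function e z) \<le> (LINT t:{0<..}|lborel. norm (of_real t powr (z - 1) * e (of_real t)))"
  using set_integral_norm_bound[OF moment_integrable[OF assms]] by (simp add: moment_function_def)

text \<open>The cut is at \<open>l = root N (M N)\<close> and the decay exponent is
  \<open>2 * N\<close>. By (mg), \<open>M (2 * N)\<close> is at most
  \<open>A ^ (2 * N) * (M N)\<^sup>2\<close>, so both pieces are \<open>l powr Re z\<close> up to a
  geometric factor. The range of \<open>Re z\<close> is that of a disc of radius
  \<open>N / 2\<close> about \<open>N\<close>, and \<open>N >= 2\<close> keeps both denominators at
  least 1. The absolute integral is bounded, and not just the moment, because termwise integration
  needs it.\<close>

lemma abs_moment_bound:
  obtains C where "C \<ge> 1"
    and "\<And>N z. \<lbrakk>N \<ge> 2; real N / 2 \<le> Re z; Re z \<le> 3 * real N / 2\<rbrakk> \<Longrightarrow>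
      (LINT t:{0<..}|lborel. norm (of_real t powr (z - 1) * e (of_real t)))
        \<le> C ^ N * root N (M N) powr Re z"
proof -
  obtain A where A: "A \<ge> 1" "\<And>p q. M (p + q) \<le> A ^ (p + q) * M p * M q"
    using strongly_regular_mg[OF sr] by blast
  define a where "a = (A * k)\<^sup>2"
  define C where "C = (c + 1) * (1 + a)"
  have a: "a \<ge> 0"
    by (simp add: a_def)
  have bound: "(LINT t:{0<..}|lborel. norm (of_real t powr (z - 1) * e (of_real t)))
        \<le> C ^ N * root N (M N) powr Re z"
    if N: "N \<ge> 2" "real N / 2 \<le> Re z" "Re z \<le> 3 * real N / 2" for N z
  proof -
    define x where "x = Re z"
    define l where "l = root N (M N)"
    have l: "l > 0" "l ^ N = M N"
      using N M_pos[of N] by (auto simp: l_def)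
    have x: "x \<ge> 1" "x > 0" "real (2 * N) - x \<ge> 1" "x < real (2 * N)"
      using N by (auto simp: x_def)
    have div: "y / d \<le> y" if "y \<ge> 0" "d \<ge> 1" for y d :: real
      using that divide_left_mono[of 1 d y] by simp
    have "M (2 * N) \<le> A ^ (2 * N) * M N * M N"
      using A(2)[of N N] by (simp add: mult_2)
    also have "\<dots> = A ^ (2 * N) * l ^ (2 * N)"
      by (simp add: l(2)[symmetric] mult_2 power_add)
    finally have M2: "M (2 * N) \<le> A ^ (2 * N) * l ^ (2 * N)" .
    have "(LINT t:{0<..}|lborel. norm (of_real t powr (z - 1) * e (of_real t)))
      \<le> c * l powr x / x + c * M (2 * N) * k ^ (2 * N) * l powr (x - real (2 * N)) / (real (2 * N) - x)"
      unfolding x_def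
      using x l(1) e_le e_le_power[of _ "2 * N"] params M_pos[of "2 * N"]
      by (intro mellin_norm_le e_cont) (auto simp: x_def)
    also have "\<dots> \<le> c * l powr x + c * M (2 * N) * k ^ (2 * N) * l powr (x - real (2 * N))"
      using x params M_pos[of "2 * N"] 
      by (intro add_mono div) auto
    also have "\<dots> \<le> c * l powr x + c * (A ^ (2 * N) * l ^ (2 * N)) * k ^ (2 * N) * l powr (x - real (2 * N))"
      using M2 params by (intro add_mono mult_right_mono mult_left_mono) auto
    also have "l powr (x - real (2 * N)) = l powr x / l ^ (2 * N)"
      using l(1) by (simp add: powr_diff powr_realpow del: of_nat_mult)
    also have "c * l powr x + c * (A ^ (2 * N) * l ^ (2 * N)) * k ^ (2 * N) * (l powr x / l ^ (2 * N))
      = c * (1 + a ^ N) * l powr x"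
    proof -
      have "a ^ N = A ^ (2 * N) * k ^ (2 * N)"
        by (simp add: a_def power_mult power_mult_distrib)
      then show ?thesis
        using l(1) by (simp add: field_simps)
    qed
    also have "\<dots> \<le> C ^ N * l powr x"
    proof (intro mult_right_mono)
      have "c \<le> c + 1" "1 \<le> c + 1"
        using params by auto
      then have 1: "c \<le> (c + 1) ^ N"
        using self_le_power[of "c + 1" N] N by linarith
      have "1 + a ^ N \<le> (1 + a) ^ N"
        using N(1)
      proof (induction N rule: dec_induct)
        case base
        then show ?case using a by (simp add: power2_eq_square algebra_simps)
      next
        case (step n)
        have "1 + a ^ Suc n \<le> (1 + (a) ^ n) * (1 + a)"
          using a by (simp add: algebra_simps)
        also have "\<dots> \<le> (1 + a) ^ n * (1 + a)"
          using step a by (intro mult_right_mono) auto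
        finally show ?case by (simp add: mult.commute)
      qed
      with 1 show "c * (1 + a ^ N) \<le> C ^ N"
        using params a unfolding C_def power_mult_distrib[of "c + 1"] by (intro mult_mono) auto
    qed simp
    finally show ?thesis
      by (simp add: x_def l_def)
  qed
  moreover have "1 * 1 \<le> C"
    unfolding C_def using params a by (intro mult_mono) auto
  ultimately show thesis
    using that[of C] by auto
qed

text \<open>Cauchy's inequality for the Taylor coefficient
  \<open>1 / moment_function e (of_nat N)\<close> of \<open>E\<close>. On the circle of radius
  \<open>kE * quot M N\<close> the growth bound of \<open>E\<close> is
  \<open>quot M N ^ N / M N\<close>, and the power of the quotient cancels against the
  radius.\<close>

lemma recip_moment_bound: "M N * kE ^ N \<le> cE * cmod (moment_function e (of_nat N))"
proof -
  define R where "R = kE * quot M N"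
  define m where "m = moment_function e (of_nat N)"
  have R: "R > 0"
    using params quot_pos by (simp add: R_def)
  have bound: "cmod (E z) \<le> cE * (quot M N ^ N / M N)" if "cmod (0 - z) = R" for z
  proof -
    have "cmod z / kE = quot M N"
      using that params by (simp add: R_def)
    then have "cmod (E z) \<le> cE * exp (assoc_fun M (quot M N))"
      using E_bound[of z] by simp
    also have "\<dots> \<le> cE * (quot M N ^ N / M N)"
      using params exp_assoc_fun_quot[OF sr] by (intro mult_left_mono) auto
    finally show ?thesis .
  qed
  have fps: "E has_fps_expansion Abs_fps (\<lambda>p. 1 / moment_function e (of_nat p))"
  proof (rule has_fps_expansionI)
    show "\<forall>\<^sub>F u in nhds 0. (\<lambda>n. fps_nth (Abs_fps (\<lambda>p. 1 / moment_function e (of_nat p))) n * u ^ n) sums E u"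
      using E_sums by (intro always_eventually allI) simp
  qed
  have "(deriv ^^ N) E 0 / fact N = 1 / m"
    using fps_nth_fps_expansion[OF fps, of N] by (simp add: m_def)
  then have eq: "(deriv ^^ N) E 0 = fact N / m"
    by (simp add: field_simps)
  have "cmod ((deriv ^^ N) E 0) \<le> fact N * (cE * (quot M N ^ N / M N)) / R ^ N"
    using bound R E_holo
    by (intro Cauchy_inequality) (auto intro: holomorphic_on_subset holomorphic_on_imp_continuous_on)
  then have "cmod ((deriv ^^ N) E 0) / fact N \<le> cE * (quot M N ^ N / M N) / R ^ N"
    by (subst pos_divide_le_eq) (simp_all add: mult_ac)
  then have "1 / cmod m \<le> cE * (quot M N ^ N / M N) / R ^ N"
    by (simp add: eq norm_divide)
  also have "\<dots> = cE / (kE ^ N * M N)"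
    using quot_pos[of N] by (simp add: R_def power_mult_distrib)
  finally show ?thesis
    using moment_nz[of N] M_pos[of N] params by (simp add: m_def field_simps)
qed

section \<open>A modified Taylor remainder of \<open>E\<close> and its size near the negative
  half-line\<close>

definition tail_coeff :: "nat \<Rightarrow> nat \<Rightarrow> complex" where
  "tail_coeff n p = (if p < n then 0 else (of_nat p - of_nat n) / moment_function e (of_nat p))"

text \<open>
  The combination \<open>z * E' z - n * E z\<close> cancels the coefficient of \<open>z ^ n\<close>. This gives the order \<open>n + 1\<close>
  at \<open>0\<close> and the growth order \<open>n - 1\<close> at infinity, and therefore a Mellin transform on a strip of
  width 2. A bare Taylor remainder would leave out the lines where \<open>Re s\<close> is an integer.
\<close>

definition mellin_tail :: "nat \<Rightarrow> complex \<Rightarrow> complex" where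
  "mellin_tail n z = z * deriv E z - of_nat n * E z -
     (\<Sum>p<n. (of_nat p - of_nat n) / moment_function e (of_nat p) * z ^ p)"

lemma mellin_tail_sums: "(\<lambda>p. tail_coeff n p * z ^ p) sums mellin_tail n z"
proof -
  define a where "a p = 1 / moment_function e (of_nat p)" for p
  have E: "(\<lambda>p. a p * y ^ p) sums E y" for y
    using E_sums[of y] by (simp add: a_def)
  then have sm: "summable (\<lambda>p. a p * y ^ p)" for y
    by (rule sums_summable)
  have "((\<lambda>y. \<Sum>p. a p * y ^ p) has_field_derivative (\<Sum>p. diffs a p * z ^ p)) (at z)"
    by (rule termdiffs_strong_converges_everywhere[OF sm])
  moreover have "(\<lambda>y. \<Sum>p. a p * y ^ p) = E"
    using E by (auto simp: sums_iff)
  ultimately have d: "deriv E z = (\<Sum>p. diffs a p * z ^ p)"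
    by (metis DERIV_imp_deriv)
  have "summable (\<lambda>p. diffs a p * z ^ p)"
    by (rule termdiff_converges_all[OF sm])
  then have "(\<lambda>p. of_nat p * a p * z ^ (p - Suc 0)) sums deriv E z"
    unfolding d by (rule diffs_equiv)
  then have "(\<lambda>p. z * (of_nat p * a p * z ^ (p - Suc 0))) sums (z * deriv E z)"
    by (rule sums_mult)
  moreover have "z * (of_nat p * a p * z ^ (p - Suc 0)) = of_nat p * a p * z ^ p" for p
    by (cases p) auto
  ultimately have "(\<lambda>p. of_nat p * a p * z ^ p) sums (z * deriv E z)"
    by simp
  from sums_diff[OF this sums_mult[OF E[of z], of "of_nat n"]]
  have "(\<lambda>p. (of_nat p - of_nat n) * a p * z ^ p) sums (z * deriv E z - of_nat n * E z)"
    by (simp add: algebra_simps)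
  from sums_diff[OF this sums_If_finite_set[of "{..<n}" "\<lambda>p. (of_nat p - of_nat n) * a p * z ^ p"]]
  have "(\<lambda>p. (of_nat p - of_nat n) * a p * z ^ p -
      (if p < n then (of_nat p - of_nat n) * a p * z ^ p else 0)) sums mellin_tail n z"
    by (simp add: mellin_tail_def a_def)
  moreover have "(of_nat p - of_nat n) * a p * z ^ p -
      (if p < n then (of_nat p - of_nat n) * a p * z ^ p else 0) = tail_coeff n p * z ^ p" for p
    by (simp add: tail_coeff_def a_def)
  ultimately show ?thesis
    by simp
qed

lemma holomorphic_on_mellin_tail: "mellin_tail n holomorphic_on UNIV"
  unfolding mellin_tail_def by (intro holomorphic_intros E_holo holomorphic_deriv) auto

lemma mellin_tail_near_zero:
  obtains C where "C \<ge> 0" and "\<And>z. cmod z \<le> 1 \<Longrightarrow> cmod (mellin_tail n z) \<le> C * cmod z ^ (n + 1)"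
proof -
  \<comment> \<open>Absolute convergence at 1 follows from convergence at the larger point
    2.\<close>
  have sm: "summable (\<lambda>p. norm (tail_coeff n p * 1 ^ p))"
    by (rule powser_insidea[OF sums_summable[OF mellin_tail_sums[of n 2]]]) auto
  have "cmod (mellin_tail n z) \<le> (\<Sum>p. norm (tail_coeff n p)) * cmod z ^ (n + 1)" if z: "cmod z \<le> 1" for z
  proof -
    have le: "norm (tail_coeff n p * z ^ p) \<le> norm (tail_coeff n p) * cmod z ^ (n + 1)" for p
    \<comment> \<open>The coefficient at \<open>p = n\<close> vanishes as well, through its factor
      \<open>p - n\<close>; hence the order is \<open>n + 1\<close> and not
      \<open>n\<close>.\<close>
    proof (cases "p \<le> n")
      case False
      then show ?thesis
        using z by (simp add: norm_mult norm_power mult_left_mono power_decreasing del: power_Suc)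
    qed (simp add: tail_coeff_def)
    have sm': "summable (\<lambda>p. norm (tail_coeff n p) * cmod z ^ (n + 1))"
      using sm by (intro summable_mult2) simp
    have sm'': "summable (\<lambda>p. norm (tail_coeff n p * z ^ p))"
      by (rule summable_comparison_test'[OF sm', of 0]) (use le in auto)
    have "cmod (mellin_tail n z) \<le> (\<Sum>p. norm (tail_coeff n p * z ^ p))"
      using mellin_tail_sums[of n z] summable_norm[OF sm''] by (simp add: sums_iff)
    also have "\<dots> \<le> (\<Sum>p. norm (tail_coeff n p) * cmod z ^ (n + 1))"
      by (intro suminf_le le sm' sm'')
    also have "\<dots> = (\<Sum>p. norm (tail_coeff n p)) * cmod z ^ (n + 1)"
      using sm by (subst suminf_mult2) auto
    finally show ?thesis .
  qed
  moreover have "(\<Sum>p. norm (tail_coeff n p)) \<ge> 0"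
    using sm by (intro suminf_nonneg) auto
  ultimately show thesis
    using that by blast
qed

text \<open>Half the slope of the cone in which \<open>E\<close> is bounded, so that discs of radius
  proportional to \<open>Re z\<close> stay inside the larger cone.\<close>

definition decay_cone :: "complex set" where
  "decay_cone = {z. Re z > 0 \<and> \<bar>Im z\<bar> < \<kappa> / 2 * Re z}"

lemma open_decay_cone: "open decay_cone"
  unfolding decay_cone_def by (intro open_Collect_conj open_Collect_less continuous_intros)

lemma convex_decay_cone: "convex decay_cone"
proof -
  have "decay_cone = {z. Re z > 0} \<inter> {z. (\<kappa> / 2) * Re z - Im z > 0} \<inter> {z. (\<kappa> / 2) * Re z + Im z > 0}"
    by (auto simp: decay_cone_def)
  also have "convex \<dots>"
  proof (intro convex_Int convex_halfspace_Re_gt)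
    have "{z. (\<kappa> / 2) * Re z - Im z > 0} = {z. inner (Complex (\<kappa> / 2) (- 1)) z > 0}"
      by (simp add: inner_complex_def)
    then show "convex {z. (\<kappa> / 2) * Re z - Im z > 0}"
      by (simp only: convex_halfspace_gt)
    have "{z. (\<kappa> / 2) * Re z + Im z > 0} = {z. inner (Complex (\<kappa> / 2) 1) z > 0}"
      by (simp add: inner_complex_def)
    then show "convex {z. (\<kappa> / 2) * Re z + Im z > 0}"
      by (simp only: convex_halfspace_gt)
  qed
  finally show ?thesis .
qed

lemma of_real_decay_cone: "x > 0 \<Longrightarrow> of_real x \<in> decay_cone"
  using params by (simp add: decay_cone_def)

lemma decay_cone_scale: "z \<in> decay_cone \<Longrightarrow> t > 0 \<Longrightarrow> z * of_real t \<in> decay_cone"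
  by (simp add: decay_cone_def abs_mult)

lemma cD_nonneg: "cD \<ge> 0"
  using E_cone[of 1] params by (simp add: order.trans[OF norm_ge_zero])

text \<open>Cauchy's estimate on a disc of radius proportional to \<open>Re z\<close> gains a factor
  \<open>1 / Re z\<close>, and in the cone \<open>cmod z\<close> is at most a multiple of
  \<open>Re z\<close>. Thus \<open>z * deriv E z\<close> is as harmless as
  \<open>E z\<close>.\<close>

lemma E_le_on_decay_cone:
  assumes "z \<in> decay_cone" "cmod z \<ge> 1"
  shows "cmod (E (- z)) \<le> cD"
    and "cmod z * cmod (deriv E (- z)) \<le> 4 * (1 + \<kappa>)\<^sup>2 / \<kappa> * cD"
proof -
  \<comment> \<open>Moving by \<open>\<eta> * Re z\<close> raises the slope from
    \<open>\<kappa> / 2\<close> to at most \<open>\<kappa>\<close> as soon as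
    \<open>\<eta> * (1 + \<kappa>)\<close> is at most \<open>\<kappa> / 2\<close>. The value taken
    here also gives \<open>\<eta> < 1 / 4\<close>, which keeps the modulus above
    \<open>1 / 2\<close>.\<close>
  define \<eta> where "\<eta> = \<kappa> / (4 * (1 + \<kappa>))"
  have "\<eta> * (1 + \<kappa>) = \<kappa> / 4"
    using params by (simp add: \<eta>_def divide_simps)
  then have \<eta>: "\<eta> > 0" "\<eta> < 1 / 4" "\<eta> + \<eta> * \<kappa> = \<kappa> / 4"
    using params by (simp add: \<eta>_def, simp add: \<eta>_def field_simps, simp add: distrib_left)
  have z: "Re z > 0" "\<bar>Im z\<bar> < \<kappa> / 2 * Re z"
    using assms by (auto simp: decay_cone_def)
  have decay_cone: "cmod (E y) \<le> cD" if "cmod (- z - y) \<le> \<eta> * Re z" for y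
  proof -
    have "\<bar>Re (- z - y)\<bar> \<le> \<eta> * Re z" "\<bar>Im (- z - y)\<bar> \<le> \<eta> * Re z"
      using that abs_Re_le_cmod[of "- z - y"] abs_Im_le_cmod[of "- z - y"] by linarith+
    then have 1: "Re (- y) \<ge> Re z - \<eta> * Re z" "\<bar>Im (- y)\<bar> < \<kappa> / 2 * Re z + \<eta> * Re z"
      using z by auto
    have "\<eta> * Re z \<le> 1 / 4 * Re z"
      using \<eta> z by (intro mult_right_mono) auto
    then have 2: "Re (- y) > 0"
      using 1 z by linarith
    have "\<kappa> / 2 * Re z + \<eta> * Re z + \<kappa> * (\<eta> * Re z) = (\<kappa> / 2 + (\<eta> + \<eta> * \<kappa>)) * Re z"
      by (simp add: algebra_simps)
    also have "\<dots> \<le> \<kappa> * Re z"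
      unfolding \<eta>(3) using z params by (simp add: algebra_simps)
    finally have "\<kappa> / 2 * Re z + \<eta> * Re z \<le> \<kappa> * (Re z - \<eta> * Re z)"
      by (simp add: algebra_simps)
    also have "\<dots> \<le> \<kappa> * Re (- y)"
      using params 1 by (intro mult_left_mono) auto
    finally have 3: "\<bar>Im (- y)\<bar> < \<kappa> * Re (- y)"
      using 1 by linarith
    have "Re z \<le> cmod z"
      using complex_Re_le_cmod .
    moreover have "cmod z \<le> cmod (- z - y) + cmod y"
      using norm_triangle_ineq[of "- z - y" y] by simp
    ultimately have "cmod (- y) \<ge> 1 / 2"
      using that \<open>\<eta> * Re z \<le> 1 / 4 * Re z\<close> assms(2) by simp
    with 2 3 show ?thesis
      using E_cone[of "- y"] by simp
  qed
  show "cmod (E (- z)) \<le> cD"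
    using \<eta> z by (intro decay_cone) simp
  have "cmod ((deriv ^^ 1) E (- z)) \<le> fact 1 * cD / (\<eta> * Re z) ^ 1"
    using \<eta> z decay_cone E_holo
    by (intro Cauchy_inequality) (auto intro: holomorphic_on_subset holomorphic_on_imp_continuous_on)
  then have "cmod (deriv E (- z)) \<le> cD / (\<eta> * Re z)"
    by simp
  moreover have "cmod z \<le> (1 + \<kappa>) * Re z"
  proof -
    have "cmod z \<le> \<bar>Re z\<bar> + \<bar>Im z\<bar>"
      by (rule cmod_le)
    also have "\<dots> \<le> Re z + \<kappa> / 2 * Re z"
      using z by auto
    also have "\<dots> \<le> (1 + \<kappa>) * Re z"
      using z params by (simp add: algebra_simps)
    finally show ?thesis .
  qed
  ultimately have "cmod z * cmod (deriv E (- z)) \<le> (1 + \<kappa>) * Re z * (cD / (\<eta> * Re z))"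
    using z params cD_nonneg by (intro mult_mono) auto
  also have "\<dots> = 4 * (1 + \<kappa>)\<^sup>2 / \<kappa> * cD"
    using z params by (simp add: \<eta>_def field_simps power2_eq_square)
  finally show "cmod z * cmod (deriv E (- z)) \<le> 4 * (1 + \<kappa>)\<^sup>2 / \<kappa> * cD" .
qed

text \<open>For large \<open>z\<close> the terms with \<open>E\<close> and its derivative are
  bounded and the subtracted polynomial has degree at most \<open>n - 1\<close>; near 0 the order is
  \<open>n + 1\<close>. Each bound extends to the whole cone because the two powers compare in the
  right direction on either side of modulus 1.\<close>

lemma mellin_tail_bounds:
  assumes n: "n \<ge> 1"
  shows "\<exists>C\<ge>0. \<forall>z\<in>decay_cone. cmod (mellin_tail n (- z)) \<le> C * cmod z ^ (n + 1) \<and>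
           cmod (mellin_tail n (- z)) \<le> C * cmod z ^ (n - 1)"
proof -
  obtain C0 where C0: "C0 \<ge> 0" "\<And>z. cmod z \<le> 1 \<Longrightarrow> cmod (mellin_tail n z) \<le> C0 * cmod z ^ (n + 1)"
    using mellin_tail_near_zero[of n] by blast
  define b where "b p = (of_nat p - of_nat n) / moment_function e (of_nat p)" for p
  define C1 where "C1 = 4 * (1 + \<kappa>)\<^sup>2 / \<kappa> * cD + n * cD + (\<Sum>p<n. cmod (b p))"
  have C1_nonneg: "C1 \<ge> 0"
    using params cD_nonneg by (auto simp: C1_def intro!: add_nonneg_nonneg sum_nonneg)
  have large: "cmod (mellin_tail n (- z)) \<le> C1 * cmod z ^ (n - 1)" if z: "z \<in> decay_cone" "cmod z \<ge> 1" for z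
  proof -
    have one: "1 \<le> cmod z ^ (n - 1)"
      using z by (intro one_le_power)
    have W: "mellin_tail n (- z) = (- z * deriv E (- z) - of_nat n * E (- z)) - (\<Sum>p<n. b p * (- z) ^ p)"
      by (simp add: mellin_tail_def b_def)
    have "cmod (\<Sum>p<n. b p * (- z) ^ p) \<le> (\<Sum>p<n. cmod (b p) * cmod z ^ p)"
      by (rule order.trans[OF norm_sum]) (simp add: norm_mult norm_power)
    also have "\<dots> \<le> (\<Sum>p<n. cmod (b p) * cmod z ^ (n - 1))"
      using z by (intro sum_mono mult_left_mono power_increasing) auto
    finally have 1: "cmod (\<Sum>p<n. b p * (- z) ^ p) \<le> (\<Sum>p<n. cmod (b p)) * cmod z ^ (n - 1)"
      by (simp add: sum_distrib_right)
    have "cmod (- z * deriv E (- z) - of_nat n * E (- z)) \<le>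
        cmod z * cmod (deriv E (- z)) + n * cmod (E (- z))"
      by (rule order.trans[OF norm_triangle_ineq4]) (simp add: norm_mult)
    also have "\<dots> \<le> 4 * (1 + \<kappa>)\<^sup>2 / \<kappa> * cD + n * cD"
      using E_le_on_decay_cone[OF z] by (intro add_mono mult_left_mono) auto
    also have "\<dots> \<le> (4 * (1 + \<kappa>)\<^sup>2 / \<kappa> * cD + n * cD) * cmod z ^ (n - 1)"
    proof -
      have "4 * (1 + \<kappa>)\<^sup>2 / \<kappa> * cD + n * cD \<ge> 0"
        using params cD_nonneg by (intro add_nonneg_nonneg) auto
      from mult_left_mono[OF one this] show ?thesis by simp
    qed
    finally have 2: "cmod (- z * deriv E (- z) - of_nat n * E (- z)) \<le> \<dots>" .
    have "cmod (mellin_tail n (- z)) \<le> cmod (- z * deriv E (- z) - of_nat n * E (- z)) + cmod (\<Sum>p<n. b p * (- z) ^ p)"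
      unfolding W by (rule norm_triangle_ineq4)
    also have "\<dots> \<le> C1 * cmod z ^ (n - 1)"
      using 1 2 by (simp add: C1_def algebra_simps)
    finally show ?thesis .
  qed
  define C where "C = max C0 C1"
  have C: "C \<ge> 0" "C0 \<le> C" "C1 \<le> C"
    using C0 by (auto simp: C_def)
  have b1: "cmod (mellin_tail n (- z)) \<le> C * cmod z ^ (n + 1)" if z: "z \<in> decay_cone" for z
  proof (cases "cmod z \<le> 1")
    case True
    then have "cmod (mellin_tail n (- z)) \<le> C0 * cmod z ^ (n + 1)"
      using C0(2)[of "- z"] by simp
    also have "\<dots> \<le> C * cmod z ^ (n + 1)"
      using C by (intro mult_right_mono) auto
    finally show ?thesis .
  next
    case False
    then have "cmod (mellin_tail n (- z)) \<le> C1 * cmod z ^ (n - 1)"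
      using large z by auto
    also have "\<dots> \<le> C * cmod z ^ (n + 1)"
      using C False by (intro mult_mono power_increasing) auto
    finally show ?thesis .
  qed
  have b2: "cmod (mellin_tail n (- z)) \<le> C * cmod z ^ (n - 1)" if z: "z \<in> decay_cone" for z
  proof (cases "cmod z \<le> 1")
    case True
    then have "cmod (mellin_tail n (- z)) \<le> C0 * cmod z ^ (n + 1)"
      using C0(2)[of "- z"] by simp
    also have "\<dots> \<le> C * cmod z ^ (n - 1)"
      using C True by (intro mult_mono power_decreasing) auto
    finally show ?thesis .
  next
    case False
    then have "cmod (mellin_tail n (- z)) \<le> C1 * cmod z ^ (n - 1)"
      using large z by auto
    also have "\<dots> \<le> C * cmod z ^ (n - 1)"
      using C by (intro mult_right_mono) auto
    finally show ?thesis .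
  qed
  show ?thesis
    using C(1) b1 b2 by (intro exI[of _ C]) simp
qed

section \<open>The moment function has no zeros in the right half-plane\<close>

text \<open>Integration against \<open>e (of_real t) / t\<close> multiplies the coefficient of
  \<open>z ^ p\<close> by the \<open>p\<close>-th moment and so undoes the division in
  \<open>tail_coeff\<close>, as the Laplace transform inverts the Borel transform. The minus sign
  leads to the half-line where \<open>E\<close> is bounded.\<close>

definition tail_transform :: "nat \<Rightarrow> complex \<Rightarrow> complex" where
  "tail_transform n z = (LINT t:{0<..}|lborel. mellin_tail n (- (z * of_real t)) * e (of_real t) / of_real t)"

lemma continuous_on_mellin_tail: "continuous_on UNIV (mellin_tail n)"
  by (intro holomorphic_on_imp_continuous_on holomorphic_on_mellin_tail)

lemma continuous_on_mellin_tail_comp: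
  "continuous_on A h \<Longrightarrow> continuous_on A (\<lambda>x. mellin_tail n (h x))"
  by (rule continuous_on_compose2[OF continuous_on_mellin_tail]) auto

lemma holomorphic_on_tail_transform:
  assumes n: "n \<ge> 1"
  shows "tail_transform n holomorphic_on decay_cone"
  unfolding tail_transform_def
proof (rule holomorphic_on_dominated_integral[OF open_decay_cone])
  obtain C where C: "C \<ge> 0" "\<And>z. z \<in> decay_cone \<Longrightarrow> cmod (mellin_tail n (- z)) \<le> C * cmod z ^ (n + 1)"
    using mellin_tail_bounds[OF n] by blast
  fix z assume z: "z \<in> decay_cone"
  have "(\<lambda>t. indicator {0<..} t *\<^sub>R (mellin_tail n (- (z * of_real t)) * e (of_real t) / of_real t))
      \<in> borel_measurable borel"
    by (intro borel_measurable_continuous_on_indicator continuous_on_mult continuous_on_divide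
        continuous_on_minus continuous_on_const continuous_on_id continuous_on_of_real e_cont
        continuous_on_mellin_tail_comp) auto
  then show "set_borel_measurable lborel {0<..} (\<lambda>t. mellin_tail n (- (z * of_real t)) * e (of_real t) / of_real t)"
    by (simp add: set_borel_measurable_def)
  obtain r where r: "r > 0" "cball z r \<subseteq> decay_cone"
    using open_decay_cone z by (meson open_contains_cball)
  \<comment> \<open>Up to a constant, this is the absolute integrand of the moment of index
    \<open>n + 1\<close>, available from the order of \<open>mellin_tail\<close> at 0.\<close>
  define h where "h t = C * (cmod z + r) ^ (n + 1) * norm (of_real t powr (of_nat (n + 1) - 1) * e (of_real t))"
    for t :: real
  have "set_integrable lborel {0<..} h"
    unfolding h_def
    by (intro set_integrable_mult_right set_integrable_norm moment_integrable) auto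
  moreover have "cmod (mellin_tail n (- (w * of_real t)) * e (of_real t) / of_real t) \<le> h t"
    if w: "w \<in> cball z r" and t: "t \<in> {0<..}" for w t
  proof -
    have "cmod w \<le> cmod z + r"
      using w norm_triangle_ineq2[of w z] by (simp add: dist_norm norm_minus_commute)
    then have "C * cmod (w * of_real t) ^ (n + 1) \<le> C * ((cmod z + r) * t) ^ (n + 1)"
      using t C(1) by (intro mult_left_mono power_mono) (auto simp: norm_mult)
    then have W: "cmod (mellin_tail n (- (w * of_real t))) \<le> C * ((cmod z + r) * t) ^ (n + 1)"
      using C(2)[OF decay_cone_scale[of w t]] w t r by force
    have "cmod (mellin_tail n (- (w * of_real t)) * e (of_real t) / of_real t) =
        cmod (mellin_tail n (- (w * of_real t))) * cmod (e (of_real t)) / t"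
      using t by (simp add: norm_mult norm_divide)
    also have "\<dots> \<le> C * ((cmod z + r) * t) ^ (n + 1) * cmod (e (of_real t)) / t"
      using t by (intro divide_right_mono mult_right_mono W) auto
    also have "\<dots> = C * (cmod z + r) ^ (n + 1) * (t ^ n * cmod (e (of_real t)))"
      using t by (simp add: power_mult_distrib)
    also have "\<dots> = h t"
      using t by (simp add: h_def norm_mult norm_power)
    finally show ?thesis .
  qed
  ultimately show "\<exists>r>0. \<exists>h. cball z r \<subseteq> decay_cone \<and> set_integrable lborel {0<..} h \<and>
      (\<forall>w\<in>cball z r. \<forall>t\<in>{0<..}. cmod (mellin_tail n (- (w * of_real t)) * e (of_real t) / of_real t) \<le> h t)"
    using r by blast
next
  fix t :: real
  show "(\<lambda>z. mellin_tail n (- (z * of_real t)) * e (of_real t) / of_real t) holomorphic_on decay_cone"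
    if "t \<in> {0<..}"
  proof -
    have "(mellin_tail n \<circ> (\<lambda>z. - (z * of_real t))) holomorphic_on decay_cone"
      by (intro holomorphic_on_compose holomorphic_intros holomorphic_on_subset[OF holomorphic_on_mellin_tail]) auto
    then show ?thesis
      using that by (intro holomorphic_intros) (auto simp: o_def)
  qed
qed

end

lemma Gamma_lborel_integral:
  assumes "Re z > 0"
  shows "set_integrable lborel {0<..} (\<lambda>t. of_real t powr (z - 1) * of_real (exp (- t)))"
    and "(LINT t:{0<..}|lborel. of_real t powr (z - 1) * of_real (exp (- t))) = Gamma z"
proof -
  have eq: "of_real t powr (z - 1) * of_real (exp (- t)) = of_real t powr (z - 1) / complex_of_real (exp t)" for t
    by (simp add: exp_minus divide_inverse)
  have "(\<lambda>t. indicator {0<..} t *\<^sub>R (of_real t powr (z - 1) / complex_of_real (exp t))) \<in> borel_measurable borel"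
    by (intro borel_measurable_continuous_on_indicator continuous_intros continuous_on_of_real_powr) auto
  then show int: "set_integrable lborel {0<..} (\<lambda>t. of_real t powr (z - 1) * of_real (exp (- t)))"
    using absolutely_integrable_Gamma_integral'[OF assms] unfolding eq
    by (simp add: set_integrable_def integrable_completion)
  show "(LINT t:{0<..}|lborel. of_real t powr (z - 1) * of_real (exp (- t))) = Gamma z"
    using set_borel_integral_eq_integral(2)[OF int] integral_unique[OF Gamma_integral_complex'[OF assms]]
    by (simp add: eq)
qed

text \<open>With \<open>a = 1 + x\<close> this produces the rational function
  \<open>1 / (1 + x)\<^sup>2\<close> from exponentials alone, for comparison with
  \<open>tail_transform\<close>.\<close>

lemma integral_times_exp_minus:
  assumes "a > 0"
  shows "(LINT t:{0<..}|lborel. complex_of_real (t * exp (- (a * t)))) = 1 / (of_real a)\<^sup>2"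
proof -
  define F where "F = (\<lambda>t::real. indicator {0<..} t *\<^sub>R complex_of_real (t * exp (- t)))"
  have "(LINT t:{0<..}|lborel. of_real t powr (2 - 1) * of_real (exp (- t))) = Gamma (2 :: complex)"
    by (rule Gamma_lborel_integral) simp
  then have "integral\<^sup>L lborel F = 1"
    using Gamma_fact[of 1, where 'a = complex] by (simp add: F_def set_lebesgue_integral_def)
  also have "integral\<^sup>L lborel F = of_real a * (LINT t|lborel. F (a * t))"
    using lborel_integral_real_affine[of a F 0] assms by (simp add: scaleR_conv_of_real)
  also have "(\<lambda>t. F (a * t)) = (\<lambda>t. indicator {0<..} t *\<^sub>R (of_real a * complex_of_real (t * exp (- (a * t)))))"
    using assms by (auto simp: F_def fun_eq_iff indicator_def zero_less_mult_iff)
  also have "integral\<^sup>L lborel \<dots> = of_real a * (LINT t:{0<..}|lborel. complex_of_real (t * exp (- (a * t))))"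
    unfolding set_lebesgue_integral_def[symmetric] by (rule set_integral_mult_right)
  finally have "of_real a * (of_real a * (LINT t:{0<..}|lborel. complex_of_real (t * exp (- (a * t))))) = 1"
    by simp
  then show ?thesis
    using assms by (simp add: field_simps power2_eq_square)
qed

lemma set_integral_cong_pos:
  fixes f h :: "real \<Rightarrow> complex"
  assumes "\<And>t. t > 0 \<Longrightarrow> f t = h t"
  shows "(LINT t:{0<..}|lborel. f t) = (LINT t:{0<..}|lborel. h t)"
  unfolding set_lebesgue_integral_def
  using assms by (intro Bochner_Integration.integral_cong) (auto simp: indicator_def)

lemma powr_add_nat:
  assumes "u > 0"
  shows "complex_of_real u powr (z + of_nat n) = of_real u powr z * of_real u ^ n"
  using assms by (simp add: powr_add powr_nat')

context kernel
begin

text \<open>Termwise integration leaves the sum of \<open>(p - n) * (- x) ^ p\<close> over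
  \<open>p > n\<close>, a differentiated geometric series. Since \<open>e\<close> may change sign,
  exchanging sum and integral requires comparing absolute moments with moments; they differ by a
  geometric factor, which is harmless only for small \<open>x\<close>.\<close>

lemma tail_transform_near_zero:
  assumes n: "n \<ge> 1"
  obtains x0 where "x0 > 0"
    and "\<And>x. \<lbrakk>0 < x; x < x0\<rbrakk> \<Longrightarrow> tail_transform n (of_real x) = (- of_real x) ^ (n + 1) / (1 + of_real x)\<^sup>2"
proof -
  define m where "m p = moment_function e (of_nat p)" for p
  define am where "am p = (LINT t:{0<..}|lborel. norm (of_real t powr (of_nat p - 1) * e (of_real t)))" for p
  obtain C where C: "C \<ge> 1" "\<And>N z. \<lbrakk>N \<ge> 2; real N / 2 \<le> Re z; Re z \<le> 3 * real N / 2\<rbrakk> \<Longrightarrow>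
      (LINT t:{0<..}|lborel. norm (of_real t powr (z - 1) * e (of_real t))) \<le> C ^ N * root N (M N) powr Re z"
    by (rule abs_moment_bound) blast
  \<comment> \<open>The ratio of the upper bound in \<open>abs_moment_bound\<close> to the lower
    bound in \<open>recip_moment_bound\<close>, per index.\<close>
  define y where "y = C / kE"
  have y: "y > 0"
    using C params by (simp add: y_def)
  have am_le: "am p / cmod (m p) \<le> cE * y ^ p" if p: "p \<ge> 2" for p
  proof -
    have "am p \<le> C ^ p * root p (M p) powr real p"
      using C(2)[of p "of_nat p"] p by (simp add: am_def)
    also have "root p (M p) powr real p = M p"
      using p M_pos[of p] by (simp add: powr_realpow)
    finally have 1: "am p \<le> C ^ p * M p" .
    have "M p \<le> cE * cmod (m p) / kE ^ p"
      using recip_moment_bound[of p] params by (simp add: m_def field_simps)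
    then have "C ^ p * M p \<le> C ^ p * (cE * cmod (m p) / kE ^ p)"
      using C by (intro mult_left_mono) auto
    with 1 have "am p \<le> cE * y ^ p * cmod (m p)"
      by (simp add: y_def power_divide field_simps)
    then show ?thesis
      using moment_nz[of p] by (subst pos_divide_le_eq) (auto simp: m_def)
  qed
  have g: "tail_transform n (of_real x) = (- of_real x) ^ (n + 1) / (1 + of_real x)\<^sup>2"
    if x: "0 < x" "x < min 1 (1 / y)" for x
  proof -
    have xy: "0 < x * y" "x * y < 1"
      using x y by (auto simp: field_simps)
    define f where "f p t = indicator {0<..} t *\<^sub>R (tail_coeff n p * (- of_real (x * t)) ^ p * e (of_real t) / of_real t)"
      for p and t :: real
    have f_eq: "f p t = indicator {0<..} t *\<^sub>R
        (tail_coeff n p * (- of_real x) ^ p * (of_real t powr (of_nat p - 1) * e (of_real t)))" for p t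
    proof (cases "t > 0")
      case True
      then have "of_real t powr (of_nat p - 1) = complex_of_real t ^ p / of_real t"
        by (simp add: powr_diff powr_nat')
      moreover have "(- complex_of_real (x * t)) ^ p = (- of_real x) ^ p * of_real t ^ p"
        by (simp flip: power_mult_distrib)
      ultimately show ?thesis
        by (simp add: f_def)
    qed (simp add: f_def)
    \<comment> \<open>Index 0 lies on the boundary of the half-plane where
      \<open>moment_integrable\<close> applies, but its coefficient vanishes since
      \<open>n >= 1\<close>.\<close>
    have cf0: "tail_coeff n 0 = 0"
      using n by (simp add: tail_coeff_def)
    have int: "integrable lborel (f p)" for p
    proof (cases "p = 0")
      case False
      then have "set_integrable lborel {0<..} (\<lambda>t. tail_coeff n p * (- of_real x) ^ p * (of_real t powr (of_nat p - 1) * e (of_real t)))"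
        by (intro set_integrable_mult_right moment_integrable) auto
      then show ?thesis
        unfolding set_integrable_def f_eq[abs_def] .
    qed (simp add: f_def[abs_def] cf0)
    have f_int: "integral\<^sup>L lborel (f p) = tail_coeff n p * (- of_real x) ^ p * m p" for p
    proof -
      have "integral\<^sup>L lborel (f p) =
          (LINT t:{0<..}|lborel. tail_coeff n p * (- of_real x) ^ p * (of_real t powr (of_nat p - 1) * e (of_real t)))"
        unfolding set_lebesgue_integral_def f_eq[abs_def] ..
      also have "\<dots> = tail_coeff n p * (- of_real x) ^ p * m p"
        unfolding m_def moment_function_def by (rule set_integral_mult_right)
      finally show ?thesis .
    qed
    have f_norm: "(LINT t|lborel. norm (f p t)) = cmod (tail_coeff n p) * x ^ p * am p" for p
    proof -
      have "(\<lambda>t. norm (f p t)) = (\<lambda>t. indicator {0<..} t *\<^sub>R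
          (cmod (tail_coeff n p) * x ^ p * norm (of_real t powr (of_nat p - 1) * e (of_real t))))"
        using x by (auto simp: f_eq fun_eq_iff norm_mult norm_power indicator_def)
      then have "(LINT t|lborel. norm (f p t)) = (LINT t:{0<..}|lborel.
          cmod (tail_coeff n p) * x ^ p * norm (of_real t powr (of_nat p - 1) * e (of_real t)))"
        by (simp only: set_lebesgue_integral_def)
      also have "\<dots> = cmod (tail_coeff n p) * x ^ p * am p"
        unfolding am_def by (rule set_integral_mult_right)
      finally show ?thesis .
    qed
    have sm: "summable (\<lambda>p. LINT t|lborel. norm (f p t))"
    proof (rule summable_comparison_test'[where N = 2])
      have "summable (\<lambda>p. of_nat (Suc p) * (x * y) ^ p)"
        using geometric_deriv_sums[of "x * y"] xy by (auto dest: sums_summable)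
      then show "summable (\<lambda>p. cE * (of_nat (Suc p) * (x * y) ^ p))"
        by (rule summable_mult)
      fix p :: nat assume p: "p \<ge> 2"
      have am0: "am p \<ge> 0"
        unfolding am_def set_lebesgue_integral_def by (intro integral_nonneg_AE) auto
      have "cmod (tail_coeff n p) \<le> of_nat (Suc p) / cmod (m p)"
      proof -
        have "cmod (of_nat p - of_nat n) \<le> of_nat (Suc p)" if "n \<le> p"
        proof -
          have "cmod (of_nat p - of_nat n) = of_nat (p - n)"
            using that by (metis norm_of_nat of_nat_diff)
          then show ?thesis by simp
        qed
        then show ?thesis
          by (auto simp: tail_coeff_def m_def norm_divide intro!: divide_right_mono)
      qed
      then have "cmod (tail_coeff n p) * x ^ p * am p \<le> of_nat (Suc p) / cmod (m p) * x ^ p * am p"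
        using x am0 by (intro mult_right_mono) auto
      also have "\<dots> = of_nat (Suc p) * x ^ p * (am p / cmod (m p))"
        by simp
      also have "\<dots> \<le> of_nat (Suc p) * x ^ p * (cE * y ^ p)"
        using x am_le[OF p] by (intro mult_left_mono) auto
      also have "\<dots> = cE * (of_nat (Suc p) * (x * y) ^ p)"
        by (simp add: power_mult_distrib)
      finally show "norm (LINT t|lborel. norm (f p t)) \<le> cE * (of_nat (Suc p) * (x * y) ^ p)"
        using x am0 by (simp add: f_norm)
    qed
    have ae: "AE t in lborel. summable (\<lambda>p. norm (f p t))"
    proof (intro AE_I2)
      fix t :: real
      show "summable (\<lambda>p. norm (f p t))"
      proof (cases "t > 0")
        case True
        have "norm (of_real (x * t) :: complex) < norm (of_real (2 * (x * t)) :: complex)"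
          using True x by (simp add: norm_mult)
        then have "summable (\<lambda>p. norm (tail_coeff n p * (- of_real (x * t)) ^ p))"
          by (intro powser_insidea[OF sums_summable[OF mellin_tail_sums[of n "of_real (2 * (x * t))"]]]) simp
        then have "summable (\<lambda>p. norm (tail_coeff n p * (- of_real (x * t)) ^ p) * norm (e (of_real t) / of_real t))"
          by (rule summable_mult2)
        then show ?thesis
          using True by (simp add: f_def norm_mult norm_divide)
      qed (simp add: f_def)
    qed
    have "(\<lambda>p. integral\<^sup>L lborel (f p)) sums (LINT t|lborel. (\<Sum>p. f p t))"
      by (rule sums_integral[OF int ae sm])
    moreover have "(LINT t|lborel. (\<Sum>p. f p t)) = tail_transform n (of_real x)"
      unfolding tail_transform_def set_lebesgue_integral_def
    proof (rule Bochner_Integration.integral_cong[OF refl])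
      fix t :: real
      have "(\<lambda>p. tail_coeff n p * (- of_real (x * t)) ^ p * (e (of_real t) / of_real t)) sums
          (mellin_tail n (- of_real (x * t)) * (e (of_real t) / of_real t))"
        by (intro sums_mult2 mellin_tail_sums)
      then have "(\<lambda>p. f p t) sums (indicator {0<..} t *\<^sub>R (mellin_tail n (- of_real (x * t)) * (e (of_real t) / of_real t)))"
        unfolding f_def by (intro sums_scaleR_right) simp
      then show "(\<Sum>p. f p t) = indicator {0<..} t *\<^sub>R (mellin_tail n (- (of_real x * of_real t)) * e (of_real t) / of_real t)"
        by (simp add: sums_iff)
    qed
    moreover have "(\<lambda>p. integral\<^sup>L lborel (f p)) sums ((- of_real x) ^ (n + 1) / (1 + of_real x)\<^sup>2)"
    proof -
      have "norm (- complex_of_real x) < 1"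
        using x by simp
      then have "(\<lambda>p. of_nat (Suc p) * (- of_real x) ^ p) sums (1 / (1 - (- complex_of_real x))\<^sup>2)"
        by (rule geometric_deriv_sums)
      then have "(\<lambda>p. (- of_real x) ^ (n + 1) * (of_nat (Suc p) * (- of_real x) ^ p)) sums
          ((- of_real x) ^ (n + 1) * (1 / (1 + complex_of_real x)\<^sup>2))"
        by (intro sums_mult) simp
      moreover have "(- of_real x) ^ (n + 1) * (of_nat (Suc p) * (- of_real x) ^ p) =
          integral\<^sup>L lborel (f (p + (n + 1)))" for p
        using moment_nz[of "p + (n + 1)"] by (simp add: f_int tail_coeff_def m_def power_add mult_ac)
      ultimately have "(\<lambda>p. integral\<^sup>L lborel (f (p + (n + 1)))) sums ((- of_real x) ^ (n + 1) / (1 + of_real x)\<^sup>2)"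
        by simp
      moreover have "(\<Sum>p<n + 1. integral\<^sup>L lborel (f p)) = 0"
        by (intro sum.neutral) (auto simp: f_int tail_coeff_def less_Suc_eq)
      ultimately show ?thesis
        by (subst (asm) sums_iff_shift) simp
    qed
    ultimately show ?thesis
      using sums_unique2 by metis
  qed
  show thesis
    using that[of "min 1 (1 / y)"] g y by simp
qed

text \<open>The identity theorem extends the formula from a short interval to the connected cone,
  where \<open>1 + z\<close> has positive real part. All positive reals are then covered, as a
  Mellin transform in \<open>x\<close> demands.\<close>

lemma tail_transform_eq:
  assumes n: "n \<ge> 1" and z: "z \<in> decay_cone"
  shows "tail_transform n z = (- z) ^ (n + 1) / (1 + z)\<^sup>2"
proof -
  obtain x0 where x0: "x0 > 0"
    "\<And>x. \<lbrakk>0 < x; x < x0\<rbrakk> \<Longrightarrow> tail_transform n (of_real x) = (- of_real x) ^ (n + 1) / (1 + of_real x)\<^sup>2"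
    by (rule tail_transform_near_zero[OF n]) blast
  have nz: "1 + w \<noteq> 0" if "w \<in> decay_cone" for w
  proof -
    have "Re (1 + w) > 0"
      using that by (simp add: decay_cone_def)
    then show ?thesis by force
  qed
  define U where "U = complex_of_real ` {0<..<x0}"
  have "tail_transform n z - (- z) ^ (n + 1) / (1 + z)\<^sup>2 = 0"
  proof (rule analytic_continuation[where S = decay_cone and U = U and \<xi> = "of_real (x0 / 2)"
        and f = "\<lambda>z. tail_transform n z - (- z) ^ (n + 1) / (1 + z)\<^sup>2"])
    show "(\<lambda>z. tail_transform n z - (- z) ^ (n + 1) / (1 + z)\<^sup>2) holomorphic_on decay_cone"
      using nz by (intro holomorphic_intros holomorphic_on_tail_transform n) auto
    show "connected decay_cone"
      by (intro convex_connected convex_decay_cone)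
    show "complex_of_real (x0 / 2) islimpt U"
      unfolding islimpt_approachable
    proof (intro allI impI)
      fix \<epsilon> :: real assume "\<epsilon> > 0"
      then show "\<exists>x'\<in>U. x' \<noteq> complex_of_real (x0 / 2) \<and> dist x' (complex_of_real (x0 / 2)) < \<epsilon>"
        using x0(1)
        by (intro bexI[of _ "of_real (x0 / 2 + min (\<epsilon> / 2) (x0 / 4))"])
          (auto simp: U_def dist_of_real dist_real_def min_def simp del: of_real_add of_real_divide)
    qed
  qed (use x0 z in \<open>auto simp: U_def open_decay_cone of_real_decay_cone simp del: of_real_divide\<close>)
  then show ?thesis by (simp only: right_minus_eq)
qed

text \<open>By \<open>mellin_convolution\<close>, the Mellin transform of
  \<open>tail_transform n\<close> along the half-line is the moment function at \<open>s\<close>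
  times the Mellin transform of the tail. Up to sign and a power of \<open>x\<close>, the same
  function arises from the pair \<open>exp (- u)\<close>, \<open>t\<^sup>2 * exp (- t)\<close>,
  whose transforms are values of \<open>Gamma\<close>. The product is therefore nonzero, and so is
  each factor.\<close>

lemma moment_function_nonzero:
  assumes s: "Re s > 0"
  shows "moment_function e s \<noteq> 0"
proof -
  \<comment> \<open>The tail has its transform in the strip \<open>n - 1 < Re s < n + 1\<close>, and
    the ceiling puts \<open>s\<close> strictly inside, also for integer real part.\<close>
  define n where "n = nat \<lceil>Re s\<rceil>"
  have n: "n \<ge> 1" "real n - 1 < Re s" "Re s < real n + 1"
    using s unfolding n_def by linarith+
  define f where "f u = mellin_tail n (- of_real u)" for u :: real
  obtain C where C: "C \<ge> 0" "\<And>z. z \<in> decay_cone \<Longrightarrow> cmod (mellin_tail n (- z)) \<le> C * cmod z ^ (n + 1)"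
    "\<And>z. z \<in> decay_cone \<Longrightarrow> cmod (mellin_tail n (- z)) \<le> C * cmod z ^ (n - 1)"
    using mellin_tail_bounds[OF n(1)] by blast
  have f_cont: "continuous_on A f" for A
    unfolding f_def by (intro continuous_on_mellin_tail_comp continuous_intros)
  have f_int: "set_integrable lborel {0<..} (\<lambda>u. of_real u powr (- s - 1) * f u)"
  proof -
    \<comment> \<open>After division by \<open>u ^ (n + 1)\<close> the tail is bounded and
      \<open>O(u powr - 2)\<close>, and the exponent \<open>n + 1 - s\<close> has real part strictly
      between 0 and 2.\<close>
    have "set_integrable lborel {0<..}
        (\<lambda>u. of_real u powr ((of_nat n + 1 - s) - 1) * (f u / of_real u ^ (n + 1)))"
    proof (rule mellin_integrable[where b = C and B = C and q = 2 and T = 1])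
      show "continuous_on {0<..} (\<lambda>u. f u / of_real u ^ (n + 1))"
        by (intro continuous_intros f_cont) auto
      fix u :: real assume u: "u > 0"
      show "cmod (f u / of_real u ^ (n + 1)) \<le> C"
        using C(2)[OF of_real_decay_cone[OF u]] u
        by (simp add: f_def norm_divide norm_power norm_mult divide_le_eq)
      have "cmod (f u / of_real u ^ (n + 1)) \<le> C * u ^ (n - 1) / u ^ (n + 1)"
        using C(3)[OF of_real_decay_cone[OF u]] u
        by (simp add: f_def norm_divide norm_power norm_mult divide_right_mono)
      also have "u ^ (n + 1) = u ^ (n - 1) * u ^ 2"
        using n by (simp flip: power_add)
      also have "C * u ^ (n - 1) / (u ^ (n - 1) * u ^ 2) = C * u powr - 2"
        using u by (simp add: powr_minus divide_inverse)
      finally show "cmod (f u / of_real u ^ (n + 1)) \<le> C * u powr - 2" .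
    qed (use n C in auto)
    also have "?this \<longleftrightarrow> ?thesis"
    proof (intro set_integrable_cong refl)
      fix u :: real assume "u \<in> {0<..}"
      then have u: "u > 0" by simp
      have "of_real u powr ((of_nat n + 1 - s) - 1) = of_real u powr ((- s - 1) + of_nat (n + 1))"
        by (simp add: algebra_simps)
      also have "\<dots> = of_real u powr (- s - 1) * of_real u ^ (n + 1)"
        using u by (rule powr_add_nat)
      finally show "of_real u powr ((of_nat n + 1 - s) - 1) * (f u / of_real u ^ (n + 1)) =
          of_real u powr (- s - 1) * f u"
        using u by simp
    qed
    finally show ?thesis .
  qed
  \<comment> \<open>The shift by \<open>n + 1\<close> absorbs the power of \<open>x\<close> in the
    formula for \<open>tail_transform\<close>. The square in \<open>e'\<close> shifts the argument
    back into the half-plane of convergence of the Gamma integral.\<close>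
  define s' where "s' = s - of_nat n - 1"
  define f' :: "real \<Rightarrow> complex" where "f' u = of_real (exp (- u))" for u
  define e' :: "real \<Rightarrow> complex" where "e' t = of_real (t\<^sup>2 * exp (- t))" for t
  have e'_eq: "of_real t powr (s' - 1) * e' t = of_real t powr ((s - of_nat n + 1) - 1) * of_real (exp (- t))"
    if t: "t > 0" for t
  proof -
    have "of_real t powr ((s - of_nat n + 1) - 1) = complex_of_real t powr ((s' - 1) + of_nat 2)"
      by (simp add: s'_def algebra_simps)
    also have "\<dots> = of_real t powr (s' - 1) * of_real t ^ 2"
      using t by (rule powr_add_nat)
    finally show ?thesis
      by (simp add: e'_def)
  qed
  have f'_eq: "of_real u powr (- s' - 1) * f' u = of_real u powr ((of_nat n + 1 - s) - 1) * of_real (exp (- u))" for u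
    by (simp add: s'_def f'_def algebra_simps)
  have re: "Re (s - of_nat n + 1) > 0" "Re (of_nat n + 1 - s) > 0"
    using n by auto
  have "moment_function e s * (LINT u:{0<..}|lborel. of_real u powr (- s - 1) * f u) =
      (LINT x:{0<..}|lborel. of_real x powr (- s - 1) *
            (LINT t:{0<..}|lborel. f (x * t) * e (of_real t) / of_real t))"
    unfolding moment_function_def
    by (rule mellin_convolution[symmetric, OF f_cont e_cont f_int moment_integrable[OF s]])
  also have "\<dots> = (LINT x:{0<..}|lborel. (- 1) ^ (n + 1) * (of_real x powr (- s' - 1) *
            (LINT t:{0<..}|lborel. f' (x * t) * e' t / of_real t)))"
  proof (rule set_integral_cong_pos)
    fix x :: real assume x: "x > 0"
    have "(LINT t:{0<..}|lborel. f (x * t) * e (of_real t) / of_real t) = tail_transform n (of_real x)"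
      by (simp add: tail_transform_def f_def)
    also have "\<dots> = (- of_real x) ^ (n + 1) / (1 + of_real x)\<^sup>2"
      by (intro tail_transform_eq n of_real_decay_cone x)
    finally have 1: "(LINT t:{0<..}|lborel. f (x * t) * e (of_real t) / of_real t) =
        (- 1) ^ (n + 1) * of_real x ^ (n + 1) / (1 + of_real x)\<^sup>2"
      by (simp flip: power_mult_distrib)
    have "(LINT t:{0<..}|lborel. f' (x * t) * e' t / of_real t) =
        (LINT t:{0<..}|lborel. complex_of_real (t * exp (- ((1 + x) * t))))"
    proof (rule set_integral_cong_pos)
      fix t :: real assume t: "t > 0"
      have "exp (- ((1 + x) * t)) = exp (- (x * t)) * exp (- t)"
        by (simp add: distrib_right flip: exp_add)
      then show "f' (x * t) * e' t / of_real t = complex_of_real (t * exp (- ((1 + x) * t)))"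
        using t by (simp add: f'_def e'_def power2_eq_square)
    qed
    also have "\<dots> = 1 / (1 + of_real x)\<^sup>2"
      using integral_times_exp_minus[of "1 + x"] x by simp
    finally have 2: "(LINT t:{0<..}|lborel. f' (x * t) * e' t / of_real t) = 1 / (1 + of_real x)\<^sup>2" .
    have "complex_of_real x powr (- s' - 1) = of_real x powr ((- s - 1) + of_nat (n + 1))"
      by (simp add: s'_def algebra_simps)
    also have "\<dots> = of_real x powr (- s - 1) * of_real x ^ (n + 1)"
      using x by (rule powr_add_nat)
    finally show "of_real x powr (- s - 1) * (LINT t:{0<..}|lborel. f (x * t) * e (of_real t) / of_real t) =
        (- 1) ^ (n + 1) * (of_real x powr (- s' - 1) * (LINT t:{0<..}|lborel. f' (x * t) * e' t / of_real t))"
      unfolding 1 2 by simp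
  qed
  also have "\<dots> = (- 1) ^ (n + 1) * (LINT x:{0<..}|lborel. of_real x powr (- s' - 1) *
            (LINT t:{0<..}|lborel. f' (x * t) * e' t / of_real t))"
    by (rule set_integral_mult_right)
  also have "(LINT x:{0<..}|lborel. of_real x powr (- s' - 1) *
            (LINT t:{0<..}|lborel. f' (x * t) * e' t / of_real t)) =
      (LINT t:{0<..}|lborel. of_real t powr (s' - 1) * e' t) *
      (LINT u:{0<..}|lborel. of_real u powr (- s' - 1) * f' u)"
  proof (rule mellin_convolution)
    show "set_integrable lborel {0<..} (\<lambda>u. of_real u powr (- s' - 1) * f' u)"
      unfolding f'_eq by (rule Gamma_lborel_integral(1)[OF re(2)])
    have "set_integrable lborel {0<..} (\<lambda>t. of_real t powr (s' - 1) * e' t) \<longleftrightarrow>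
        set_integrable lborel {0<..} (\<lambda>t. of_real t powr ((s - of_nat n + 1) - 1) * of_real (exp (- t)))"
      by (intro set_integrable_cong refl e'_eq) simp
    then show "set_integrable lborel {0<..} (\<lambda>t. of_real t powr (s' - 1) * e' t)"
      using Gamma_lborel_integral(1)[OF re(1)] by simp
  qed (auto simp: f'_def e'_def intro!: continuous_intros)
  also have "(LINT u:{0<..}|lborel. of_real u powr (- s' - 1) * f' u) = Gamma (of_nat n + 1 - s)"
    unfolding f'_eq by (rule Gamma_lborel_integral(2)[OF re(2)])
  also have "(LINT t:{0<..}|lborel. of_real t powr (s' - 1) * e' t) = Gamma (s - of_nat n + 1)"
    by (subst set_integral_cong_pos[OF e'_eq]) (use Gamma_lborel_integral(2)[OF re(1)] in auto)
  finally have "moment_function e s * (LINT u:{0<..}|lborel. of_real u powr (- s - 1) * f u) =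
      (- 1) ^ (n + 1) * (Gamma (s - of_nat n + 1) * Gamma (of_nat n + 1 - s))" .
  moreover have "Gamma z \<noteq> 0" if "Re z > 0" for z
    using that by (auto simp: Gamma_eq_zero_iff elim!: nonpos_Ints_cases)
  ultimately show ?thesis
    using re by fastforce
qed

text \<open>
  Cauchy's estimate is applied to \<open>Q\<close>, an \<open>N\<close>-th root of \<open>m z / (m N * l powr (z - N))\<close>, which is
  bounded by a constant on a disc of radius \<open>N / 2\<close>; so \<open>Q (N + 1) \<le> 1 + O(1 / N)\<close>.
\<close>

lemma moment_ratio_bound_large:
  obtains D where "D \<ge> 0"
    and "\<And>N. N \<ge> 5 \<Longrightarrow> cmod (moment_function e (of_nat (Suc N)))
           \<le> D * quot M N * cmod (moment_function e (of_nat N))"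
proof -
  define m where "m = moment_function e"
  obtain C where C: "C \<ge> 1" "\<And>N z. \<lbrakk>N \<ge> 2; real N / 2 \<le> Re z; Re z \<le> 3 * real N / 2\<rbrakk> \<Longrightarrow>
      (LINT t:{0<..}|lborel. norm (of_real t powr (z - 1) * e (of_real t))) \<le> C ^ N * root N (M N) powr Re z"
    by (rule abs_moment_bound) blast
  \<comment> \<open>\<open>C / kE\<close> compares the bounds on the disc and at its centre;
    \<open>max 1 cE\<close> is large enough for its \<open>N\<close>-th power to absorb the constant
    \<open>cE\<close>.\<close>
  define C' where "C' = C / kE * max 1 cE"
  have C': "C' > 0"
    using C params by (simp add: C'_def max_def)
  have bound: "cmod (m (of_nat (Suc N))) \<le> exp (4 * C') * quot M N * cmod (m (of_nat N))"
    if N: "N \<ge> 5" for N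
  proof -
    define l where "l = root N (M N)"
    have l: "l > 0" "l ^ N = M N"
      using N M_pos[of N] by (auto simp: l_def)
    define B where "B = ball (of_nat N :: complex) (real N / 2)"
    have B_Re: "real N / 2 \<le> Re z" "Re z \<le> 3 * real N / 2" "Re z > 0" if "z \<in> B" for z
    proof -
      have "\<bar>Re (of_nat N - z)\<bar> < real N / 2"
        using that abs_Re_le_cmod[of "of_nat N - z"] by (simp add: B_def dist_norm)
      then show "real N / 2 \<le> Re z" "Re z \<le> 3 * real N / 2" "Re z > 0"
        using N by (auto simp: abs_if split: if_splits)
    qed
    have "m holomorphic_on B"
      unfolding m_def using B_Re by (intro holomorphic_on_subset[OF moment_holo]) auto
    moreover have "simply_connected B" "locally path_connected B"
      unfolding B_def by (auto intro: convex_imp_simply_connected convex_imp_locally_path_connected)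
    moreover have "m z \<noteq> 0" if "z \<in> B" for z
      unfolding m_def using B_Re(3)[OF that] by (rule moment_function_nonzero)
    ultimately obtain L where L: "L holomorphic_on B" "\<And>z. z \<in> B \<Longrightarrow> m z = exp (L z)"
      using simply_connected_imp_holomorphic_log by metis
    define Q where "Q z = exp ((L z - L (of_nat N) - (z - of_nat N) * of_real (ln l)) / of_nat N)" for z
    have NB: "of_nat N \<in> B" 
      using N by (simp add: B_def)
    have SNB: "of_nat (Suc N) \<in> B"
    proof -
      have "dist (of_nat N) (of_nat (Suc N) :: complex) = 1"
        by (simp add: dist_norm)
      then show ?thesis
        using N by (simp add: B_def del: of_nat_Suc)
    qed
    have Q_pow: "cmod (Q z) ^ N = cmod (m z) / cmod (m (of_nat N)) / l powr (Re z - real N)"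
      if z: "z \<in> B" for z
    proof -
      have "Q z ^ N = exp (L z - L (of_nat N) - (z - of_nat N) * of_real (ln l))"
        using N by (simp add: Q_def flip: exp_of_nat_mult)
      also have "\<dots> = m z / m (of_nat N) / exp ((z - of_nat N) * of_real (ln l))"
        by (simp add: exp_diff L(2)[OF z] L(2)[OF NB])
      finally have "cmod (Q z ^ N) = cmod (m z / m (of_nat N) / exp ((z - of_nat N) * of_real (ln l)))"
        by simp
      then have "cmod (Q z) ^ N = cmod (m z) / cmod (m (of_nat N)) / exp ((Re z - real N) * ln l)"
        by (simp add: norm_power norm_divide norm_exp_eq_Re norm_mult)
      then show ?thesis
        using l by (simp add: powr_def)
    qed
    have mN: "cmod (m (of_nat N)) > 0"
      using moment_nz[of N] by (simp add: m_def)
    have Q_le: "cmod (Q z) \<le> C'" if z: "z \<in> B" for z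
    proof -
      have "Re z > 0"
        using B_Re(3)[OF z] .
      then have "cmod (m z) \<le> C ^ N * l powr Re z"
        using moment_norm_le[of z] C(2)[of N z] B_Re(1,2)[OF z] N by (simp add: m_def l_def)
      also have "l powr Re z = l powr (Re z - real N) * l ^ N"
        using l(1) by (simp add: powr_diff powr_realpow)
      finally have "cmod (m z) / l powr (Re z - real N) \<le> C ^ N * M N"
        using l by (simp add: divide_le_eq mult_ac)
      also have "C ^ N * M N \<le> C ^ N * (cE * cmod (m (of_nat N)) / kE ^ N)"
        using recip_moment_bound[of N] params C by (intro mult_left_mono) (auto simp: m_def field_simps)
      also have "\<dots> = (C / kE) ^ N * cE * cmod (m (of_nat N))"
        by (simp add: power_divide)
      also have "\<dots> \<le> (C / kE) ^ N * max 1 cE ^ N * cmod (m (of_nat N))"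
      proof -
        have "cE \<le> max 1 cE ^ N"
          using self_le_power[of "max 1 cE" N] N by linarith
        then show ?thesis
          using C params by (intro mult_right_mono mult_left_mono) auto
      qed
      also have "(C / kE) ^ N * max 1 cE ^ N = C' ^ N"
        unfolding C'_def power_mult_distrib ..
      finally have "cmod (m z) / l powr (Re z - real N) / cmod (m (of_nat N)) \<le> C' ^ N"
        using mN by (subst pos_divide_le_eq) auto
      then have "cmod (m z) / cmod (m (of_nat N)) / l powr (Re z - real N) \<le> C' ^ N"
        by (simp add: mult.commute)
      then have "cmod (Q z) ^ N \<le> C' ^ N"
        by (simp add: Q_pow[OF z])
      then show ?thesis
        using C' N by (simp add: power_mono_iff)
    qed
    have Q_holo: "Q holomorphic_on B"
      unfolding Q_def using N by (intro holomorphic_intros L(1)) auto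
    define Sg where "Sg = closed_segment (of_nat N) (of_nat (Suc N) :: complex)"
    \<comment> \<open>Points of these discs are at distance at most \<open>1 + N / 4\<close> from
      \<open>N\<close>, which is below \<open>N / 2\<close> exactly when
      \<open>N > 4\<close>.\<close>
    have Sg: "cball w (real N / 4) \<subseteq> B" if "w \<in> Sg" for w
    proof
      fix y assume y: "y \<in> cball w (real N / 4)"
      have "dist (of_nat N) w \<le> dist (of_nat N) (of_nat (Suc N) :: complex)"
        using segment_bound(1)[of w "of_nat N" "of_nat (Suc N)"] that
        by (simp add: Sg_def dist_norm norm_minus_commute del: of_nat_Suc)
      also have "\<dots> = 1"
        by (simp add: dist_norm)
      finally have "dist (of_nat N) y \<le> 1 + real N / 4"
        using dist_triangle[of "of_nat N" y w] y by simp
      then show "y \<in> B"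
        using N by (simp add: B_def)
    qed
    have Sg_sub: "Sg \<subseteq> B"
    proof
      fix w assume "w \<in> Sg"
      then show "w \<in> B"
        using Sg[of w] N by (auto simp: subset_eq)
    qed
    have "cmod (Q (of_nat (Suc N)) - Q (of_nat N)) \<le> 4 * C' / real N * cmod (of_nat (Suc N) - of_nat N)"
    proof (rule field_differentiable_bound[where S = Sg and f' = "deriv Q"])
      fix w assume w: "w \<in> Sg"
      show "(Q has_field_derivative deriv Q w) (at w within Sg)"
        using Sg_sub w holomorphic_derivI[OF Q_holo _, of w] by (auto simp: B_def intro: has_field_derivative_at_within)
      have "cmod ((deriv ^^ 1) Q w) \<le> fact 1 * C' / (real N / 4) ^ 1"
      proof (rule Cauchy_inequality)
        have "Q holomorphic_on cball w (real N / 4)"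
          by (rule holomorphic_on_subset[OF Q_holo Sg[OF w]])
        then show "continuous_on (cball w (real N / 4)) Q" "Q holomorphic_on ball w (real N / 4)"
          by (auto intro: holomorphic_on_imp_continuous_on holomorphic_on_subset)
        show "cmod (Q y) \<le> C'" if "cmod (w - y) = real N / 4" for y
          using Sg[OF w] that by (intro Q_le) (auto simp: dist_norm)
      qed (use N in auto)
      then show "cmod (deriv Q w) \<le> 4 * C' / real N"
        by (simp add: field_simps)
    qed (auto simp: Sg_def)
    then have "cmod (Q (of_nat (Suc N)) - Q (of_nat N)) \<le> 4 * C' / real N"
      by simp
    moreover have "Q (of_nat N) = 1"
      by (simp add: Q_def)
    ultimately have "cmod (Q (of_nat (Suc N))) \<le> 1 + 4 * C' / real N"
      using norm_triangle_ineq[of "Q (of_nat (Suc N)) - 1" 1] by simp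
    then have "cmod (Q (of_nat (Suc N))) ^ N \<le> (1 + 4 * C' / real N) ^ N"
      by (intro power_mono) auto
    also have "\<dots> \<le> exp (4 * C')"
      using C' N by (intro exp_ge_one_plus_x_over_n_power_n) auto
    finally have "cmod (m (of_nat (Suc N))) / cmod (m (of_nat N)) / l \<le> exp (4 * C')"
      using l by (subst (asm) Q_pow[OF SNB]) simp
    then have "cmod (m (of_nat (Suc N))) \<le> exp (4 * C') * l * cmod (m (of_nat N))"
      using mN l by (simp add: divide_le_eq mult_ac)
    also have "\<dots> \<le> exp (4 * C') * quot M N * cmod (m (of_nat N))"
    proof (intro mult_right_mono mult_left_mono)
      have "l ^ N \<le> quot M N ^ N"
        using le_quot_power[OF sr, of N] l by simp
      then show "l \<le> quot M N"
        using l(1) N quot_pos[of N] by (simp add: power_mono_iff)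
    qed auto
    finally show ?thesis .
  qed
  show thesis
    using that[of "exp (4 * C')"] bound by (simp add: m_def)
qed

lemma moment_ratio_bound:
  "\<exists>D. \<forall>N. cmod (moment_function e (of_nat (Suc N))) \<le> D * quot M N * cmod (moment_function e (of_nat N))"
proof -
  define m where "m p = cmod (moment_function e (of_nat p))" for p
  have m: "m p > 0" for p
    using moment_nz by (simp add: m_def)
  obtain D where D: "D \<ge> 0" "\<And>N. N \<ge> 5 \<Longrightarrow> m (Suc N) \<le> D * quot M N * m N"
    unfolding m_def by (rule moment_ratio_bound_large) blast
  define D' where "D' = D + (\<Sum>N<5. m (Suc N) / (quot M N * m N))"
  have "m (Suc N) \<le> D' * quot M N * m N" for N
  proof -
    have pos: "quot M N * m N > 0"
      using quot_pos m by simp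
    have sum: "(\<Sum>N<5. m (Suc N) / (quot M N * m N)) \<ge> 0"
      using quot_pos m by (intro sum_nonneg) (simp add: less_imp_le)
    have "m (Suc N) / (quot M N * m N) \<le> D'"
    proof (cases "N < 5")
      case True
      then have "m (Suc N) / (quot M N * m N) \<le> (\<Sum>N<5. m (Suc N) / (quot M N * m N))"
        using quot_pos m by (intro member_le_sum) (auto simp: less_imp_le)
      with D show ?thesis by (simp add: D'_def)
    next
      case False
      then have "m (Suc N) / (quot M N * m N) \<le> D"
        using D(2)[of N] pos by (simp add: pos_divide_le_eq mult_ac)
      with sum show ?thesis by (simp add: D'_def)
    qed
    then show ?thesis
      using pos by (simp add: pos_divide_le_eq mult_ac)
  qed
  then show ?thesis
    unfolding m_def by blast
qed

text \<open>Combines \<open>abs_moment_bound\<close> from above with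
  \<open>recip_moment_bound\<close> from below. The factor is \<open>N + 1\<close> because the
  moment of index 0 is not normalised to 1.\<close>

lemma moment_equivalent:
  "\<exists>B. \<forall>N. \<bar>ln (cmod (moment_function e (of_nat N))) - ln (M N)\<bar> \<le> B * real (N + 1)"
proof -
  define m where "m p = cmod (moment_function e (of_nat p))" for p
  have m: "m p > 0" for p
    using moment_nz by (simp add: m_def)
  obtain C where C: "C \<ge> 1" "\<And>N z. \<lbrakk>N \<ge> 2; real N / 2 \<le> Re z; Re z \<le> 3 * real N / 2\<rbrakk> \<Longrightarrow>
      (LINT t:{0<..}|lborel. norm (of_real t powr (z - 1) * e (of_real t))) \<le> C ^ N * root N (M N) powr Re z"
    by (rule abs_moment_bound) blast
  define d where "d N = ln (m N) - ln (M N)" for N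
  have upper: "d N \<le> real N * ln C" if "N \<ge> 2" for N
  proof -
    have "m N \<le> C ^ N * root N (M N) powr real N"
      using moment_norm_le[of "of_nat N"] C(2)[of N "of_nat N"] that by (simp add: m_def)
    also have "root N (M N) powr real N = M N"
      using that M_pos[of N] by (simp add: powr_realpow)
    finally have "ln (m N) \<le> ln (C ^ N * M N)"
      using m M_pos[of N] C by simp
    then show ?thesis
      using C M_pos[of N] by (simp add: ln_mult ln_realpow d_def)
  qed
  have lower: "- d N \<le> ln cE - real N * ln kE" for N
  proof -
    have "ln (M N * kE ^ N) \<le> ln (cE * m N)"
      using recip_moment_bound[of N] M_pos[of N] m[of N] params
      by (subst ln_le_cancel_iff) (auto simp: m_def)
    then show ?thesis
      using M_pos[of N] params m[of N] by (simp add: ln_mult ln_realpow d_def)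
  qed
  define B where "B = \<bar>d 0\<bar> + \<bar>d 1\<bar> + ln C + \<bar>ln cE\<bar> + \<bar>ln kE\<bar>"
  have "\<bar>d N\<bar> \<le> B * real (N + 1)" for N
  proof -
    have B1: "B \<le> B * real (N + 1)"
      using mult_left_mono[of 1 "real (N + 1)" B] C by (simp add: B_def)
    consider "N = 0" | "N = 1" | "N \<ge> 2" by linarith
    then show ?thesis
    proof cases
      case 3
      have "real N * ln C \<le> real (N + 1) * ln C"
        using C by (intro mult_right_mono) auto
      moreover have "\<bar>ln cE\<bar> \<le> real (N + 1) * \<bar>ln cE\<bar>"
        using mult_right_mono[of 1 "real (N + 1)" "\<bar>ln cE\<bar>"] by simp
      moreover have "\<bar>real N * ln kE\<bar> \<le> real (N + 1) * \<bar>ln kE\<bar>"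
        by (simp add: abs_mult mult_right_mono)
      moreover have "0 \<le> real (N + 1) * ln C" "0 \<le> real (N + 1) * (\<bar>d 0\<bar> + \<bar>d 1\<bar>)"
        "0 \<le> real (N + 1) * \<bar>ln kE\<bar>" "0 \<le> real (N + 1) * \<bar>ln cE\<bar>"
        using C by auto
      moreover have "B * real (N + 1) = real (N + 1) * (\<bar>d 0\<bar> + \<bar>d 1\<bar>) + real (N + 1) * ln C +
          real (N + 1) * \<bar>ln cE\<bar> + real (N + 1) * \<bar>ln kE\<bar>"
        by (simp only: B_def algebra_simps)
      ultimately show ?thesis
        using upper[OF 3] lower[of N] by linarith
    qed (use B1 C in \<open>auto simp: B_def\<close>)
  qed
  then show ?thesis
    unfolding d_def m_def by blast
qed

end

section \<open>From kernel functions to bounds on moment sequences\<close>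

lemma kernel_functions_imp_kernel:
  assumes K: "kernel_functions M e E" and sr: "strongly_regular M"
    and adm: "admits_nonzero_proximate_order M"
  shows "\<exists>c k cE kE \<kappa> cD. kernel M e E c k cE kE \<kappa> cD"
proof -
  define \<omega> where "\<omega> = omega_index M"
  define S where "S = sector 0 (\<omega> * pi)"
  have \<omega>: "\<omega> > 0" "\<omega> < 2"
    using omega_index_pos[OF adm] K by (auto simp: kernel_functions_def Let_def \<omega>_def)
  have holo: "e holomorphic_on S" and E: "E holomorphic_on UNIV"
    and moment: "moment_function e holomorphic_on {z. Re z > 0}"
      "\<And>p. moment_function e (of_nat p) \<noteq> 0"
      "\<And>z. (\<lambda>p. z ^ p / moment_function e (of_nat p)) sums E z"
    using K by (auto simp: kernel_functions_def Let_def \<omega>_def S_def)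
  have "\<forall>\<epsilon>>0. \<exists>c>0. \<exists>k>0. \<forall>z\<in>sector 0 (\<omega> * pi - \<epsilon>). cmod (e z) \<le> c * exp (- assoc_fun M (cmod z / k))"
    using K by (simp add: kernel_functions_def Let_def \<omega>_def)
  then obtain c k where ck: "c > 0" "k > 0"
    "\<And>z. z \<in> sector 0 (\<omega> * pi - \<omega> * pi / 2) \<Longrightarrow> cmod (e z) \<le> c * exp (- assoc_fun M (cmod z / k))"
    using \<omega> by (metis divide_pos_pos mult_pos_pos pi_gt_zero zero_less_numeral)
  have "\<exists>c>0. \<exists>k>0. \<forall>z. cmod (E z) \<le> c * exp (assoc_fun M (cmod z / k))"
    using K by (simp add: kernel_functions_def Let_def \<omega>_def)
  then obtain cE kE where cE: "cE > 0" "kE > 0" "\<And>z. cmod (E z) \<le> cE * exp (assoc_fun M (cmod z / kE))"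
    by blast
  have "\<exists>\<beta>>0. \<forall>\<theta> R. 0 < \<theta> \<and> \<theta> < 2 * pi - \<omega> * pi \<and> R > 0 \<longrightarrow>
          (\<exists>c>0. \<forall>z \<in> sector pi \<theta> - ball 0 R. cmod (E z) \<le> c * cmod z powr (- \<beta>))"
    using K by (simp add: kernel_functions_def Let_def \<omega>_def)
  then obtain \<beta> where \<beta>: "\<beta> > 0" "\<And>\<theta> R. \<lbrakk>0 < \<theta>; \<theta> < 2 * pi - \<omega> * pi; R > 0\<rbrakk> \<Longrightarrow>
          (\<exists>c>0. \<forall>z \<in> sector pi \<theta> - ball 0 R. cmod (E z) \<le> c * cmod z powr (- \<beta>))"
    by blast
  \<comment> \<open>Half of the admissible opening, positive because the index is below 2. A slope
    below \<open>\<theta> / 2\<close> ensures an angle below \<open>\<theta> / 2\<close>, as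
    \<open>arctan\<close> does not increase the modulus.\<close>
  define \<theta> where "\<theta> = (2 * pi - \<omega> * pi) / 2"
  have "\<omega> * pi < 2 * pi"
    using \<omega> by (intro mult_strict_right_mono) auto
  then have \<theta>: "0 < \<theta>" "\<theta> < 2 * pi - \<omega> * pi"
    by (auto simp: \<theta>_def)
  obtain c' where c': "c' > 0" "\<And>z. z \<in> sector pi \<theta> - ball 0 (1 / 2) \<Longrightarrow> cmod (E z) \<le> c' * cmod z powr (- \<beta>)"
    using \<beta>(2)[OF \<theta>, of "1 / 2"] by auto
  have real: "of_real t \<in> sector 0 a" if "t > 0" "a > 0" for t a
    unfolding sector_def using that
    by (intro CollectI exI[of _ t] exI[of _ "0 :: real"]) (simp add: rcis_def)
  have "kernel M e E c k cE kE (\<theta> / 2) (c' * (1 / 2) powr (- \<beta>))"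
  proof
    show "continuous_on {0<..} (\<lambda>t. e (of_real t))"
      by (rule continuous_on_compose2[OF holomorphic_on_imp_continuous_on[OF holo]])
        (use real \<omega> in \<open>auto simp: S_def intro!: continuous_intros\<close>)
    show "cmod (e (of_real t)) \<le> c * exp (- assoc_fun M (t / k))" if "t > 0" for t
      using ck(3)[OF real[OF that]] \<omega> that by simp
    fix z assume z: "Re z > 0" "\<bar>Im z\<bar> < \<theta> / 2 * Re z" "cmod z \<ge> 1 / 2"
    define t where "t = Im z / Re z"
    have t: "\<bar>arctan t\<bar> < \<theta> / 2"
    proof -
      have "\<bar>arctan t\<bar> \<le> \<bar>t\<bar>"
        using abs_arctan_le[of t] by simp
      also have "\<bar>t\<bar> < \<theta> / 2"
        using z by (simp add: t_def abs_divide divide_less_eq)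
      finally show ?thesis .
    qed
    have "(cmod z)\<^sup>2 = (Re z * sqrt (1 + t\<^sup>2))\<^sup>2"
      using z by (simp add: cmod_power2 t_def power_mult_distrib power_divide distrib_left add_nonneg_nonneg)
    then have cm: "cmod z = Re z * sqrt (1 + t\<^sup>2)"
      using z by (subst (asm) power2_eq_iff_nonneg) auto
    have "sqrt (1 + t\<^sup>2) > 0"
      by (simp add: add_pos_nonneg)
    then have "rcis (cmod z) (arctan t + pi) = - z"
      using z by (auto simp: complex_eq_iff cm cos_arctan sin_arctan t_def)
    then have "- z \<in> sector pi \<theta>"
      unfolding sector_def using t z by (smt (verit) mem_Collect_eq divide_pos_pos)
    then have "cmod (E (- z)) \<le> c' * cmod z powr (- \<beta>)"
      using c'(2)[of "- z"] z by simp
    also have "\<dots> \<le> c' * (1 / 2) powr (- \<beta>)"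
      using z c' \<beta> by (intro mult_left_mono powr_mono2') auto
    finally show "cmod (E (- z)) \<le> c' * (1 / 2) powr (- \<beta>)" .
  qed (use sr ck cE \<theta> E moment in auto)
  then show ?thesis
    by blast
qed

theorem moment_sequence_regular:
  assumes "moment_sequence M m" and "strongly_regular M" and "admits_nonzero_proximate_order M"
    and pos: "\<And>p. m p > 0"
  shows moment_sequence_ratio: "\<exists>D. \<forall>N. m (Suc N) \<le> D * quot M N * m N"
    and moment_sequence_equivalent: "\<exists>B. \<forall>N. \<bar>ln (m N) - ln (M N)\<bar> \<le> B * real (N + 1)"
proof -
  obtain e E where eE: "kernel_functions M e E" "\<And>p. of_real (m p) = moment_function e (of_nat p)"
    using assms(1) by (auto simp: moment_sequence_def)
  obtain c k cE kE \<kappa> cD where "kernel M e E c k cE kE \<kappa> cD"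
    using kernel_functions_imp_kernel[OF eE(1) assms(2,3)] by blast
  then interpret kernel M e E c k cE kE \<kappa> cD .
  have m: "cmod (moment_function e (of_nat p)) = m p" for p
    using pos[of p] by (simp flip: eE(2))
  show "\<exists>D. \<forall>N. m (Suc N) \<le> D * quot M N * m N"
    using moment_ratio_bound by (simp only: m)
  show "\<exists>B. \<forall>N. \<bar>ln (m N) - ln (M N)\<bar> \<le> B * real (N + 1)"
    using moment_equivalent by (simp only: m)
qed

section \<open>The formal Cauchy problem\<close>

unbundle no vec_syntax

section \<open>Convergence as geometric growth of coefficients\<close>

definition geometrically_bounded :: "(nat \<Rightarrow> nat \<Rightarrow> complex) \<Rightarrow> bool" where
  "geometrically_bounded c \<longleftrightarrow> (\<exists>C\<ge>0. \<exists>K\<ge>1. \<forall>n j. cmod (c n j) \<le> C * K ^ (n + j))"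

text \<open>A single term of an absolutely summable family at a point \<open>(x, x)\<close> is
  bounded by the whole sum. Conversely, for moduli below \<open>1 / (2 * K)\<close> the family is
  dominated by a double geometric series of ratio \<open>1 / 2\<close>.\<close>

lemma convergent_fps2_iff: "convergent_fps2 u \<longleftrightarrow> geometrically_bounded (\<lambda>n j. u $ n $ j)"
proof
  assume "convergent_fps2 u"
  then obtain R where R: "R > 0" "\<And>t z. cmod t < R \<Longrightarrow> cmod z < R \<Longrightarrow>
      (\<lambda>(n, j). u $ n $ j * t ^ n * z ^ j) summable_on UNIV"
    by (auto simp: convergent_fps2_def)
  define x where "x = min (R / 2) 1"
  have x: "0 < x" "x < R" "x \<le> 1"
    using R(1) by (auto simp: x_def)
  define h where "h = (\<lambda>(n, j). u $ n $ j * of_real x ^ n * of_real x ^ j)"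
  have "(\<lambda>p. norm (h p)) summable_on UNIV"
    using R(2)[of "of_real x" "of_real x"] x
    by (simp add: h_def summable_on_iff_abs_summable_on_complex)
  then have "(\<Sum>p\<in>{(n, j)}. norm (h p)) \<le> (\<Sum>\<^sub>\<infinity>p\<in>UNIV. norm (h p))" for n j
    by (intro finite_sum_le_infsum) auto
  then have le: "cmod (u $ n $ j) * x ^ (n + j) \<le> (\<Sum>\<^sub>\<infinity>p\<in>UNIV. norm (h p))" for n j
    using x by (simp add: h_def norm_mult norm_power power_add mult.assoc)
  have "cmod (u $ n $ j) \<le> (\<Sum>\<^sub>\<infinity>p\<in>UNIV. norm (h p)) * (1 / x) ^ (n + j)" for n j
    using le[of n j] x by (simp add: power_one_over field_simps)
  moreover have "(\<Sum>\<^sub>\<infinity>p\<in>UNIV. norm (h p)) \<ge> 0"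
    by (intro infsum_nonneg) auto
  moreover have "1 / x \<ge> 1"
    using x by simp
  ultimately show "geometrically_bounded (\<lambda>n j. u $ n $ j)"
    unfolding geometrically_bounded_def by blast
next
  assume "geometrically_bounded (\<lambda>n j. u $ n $ j)"
  then obtain C K where CK: "C \<ge> 0" "K \<ge> 1" "\<And>n j. cmod (u $ n $ j) \<le> C * K ^ (n + j)"
    by (auto simp: geometrically_bounded_def)
  have half: "(\<lambda>n::nat. c * (1 / 2) ^ n) sums (c * 2)" for c :: real
    using sums_mult[OF geometric_sums[of "1 / 2 :: real"], of c] by simp
  have major: "(\<lambda>(n, j). C * (1 / 2) ^ n * (1 / 2) ^ j) summable_on (UNIV \<times> UNIV)"
  proof (rule summable_on_SigmaI)
    fix n :: nat
    show "((\<lambda>j. case (n, j) of (n, j) \<Rightarrow> C * (1 / 2) ^ n * (1 / 2) ^ j) has_sum (C * (1 / 2) ^ n * 2)) UNIV"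
      using half[of "C * (1 / 2) ^ n"] CK by (intro sums_nonneg_imp_has_sum) auto
  next
    have "summable (\<lambda>n. C * (1 / 2) ^ n * 2)"
      using half[of "C * 2"] by (intro sums_summable) (simp add: mult_ac)
    then show "(\<lambda>n. C * (1 / 2) ^ n * 2) summable_on UNIV"
      using CK by (subst summable_on_UNIV_nonneg_real_iff) auto
  qed (use CK in auto)
  have "(\<lambda>(n, j). u $ n $ j * t ^ n * z ^ j) summable_on UNIV"
    if tz: "cmod t < 1 / (2 * K)" "cmod z < 1 / (2 * K)" for t z
  proof (rule Infinite_Sum.abs_summable_summable, rule Infinite_Sum.abs_summable_on_comparison_test)
    show "(\<lambda>p. norm (case p of (n, j) \<Rightarrow> C * (1 / 2) ^ n * (1 / 2) ^ j)) summable_on (UNIV :: (nat \<times> nat) set)"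
      using major CK by (simp add: case_prod_unfold abs_mult)
    fix p :: "nat \<times> nat"
    obtain n j where p: "p = (n, j)" by (cases p)
    have "cmod (u $ n $ j * t ^ n * z ^ j) \<le> C * K ^ (n + j) * (1 / (2 * K)) ^ n * (1 / (2 * K)) ^ j"
      unfolding norm_mult norm_power using CK tz by (intro mult_mono power_mono) auto
    also have "\<dots> = C * (1 / 2) ^ n * (1 / 2) ^ j"
      using CK by (simp add: power_add power_divide power_mult_distrib)
    finally show "norm (case p of (n, j) \<Rightarrow> u $ n $ j * t ^ n * z ^ j)
        \<le> norm (case p of (n, j) \<Rightarrow> C * (1 / 2) ^ n * (1 / 2) ^ j)"
      using CK by (simp add: p abs_mult)
  qed
  moreover have "1 / (2 * K) > 0"
    using CK by simp
  ultimately show "convergent_fps2 u"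
    unfolding convergent_fps2_def by blast
qed

lemma convergent_fps_iff:
  "convergent_fps f \<longleftrightarrow> (\<exists>C\<ge>0. \<exists>K\<ge>1. \<forall>n. cmod (f $ n) \<le> C * K ^ n)"
proof
  assume "convergent_fps f"
  then have "fps_conv_radius f > 0"
    by (simp add: convergent_fps_def)
  then obtain r where r: "0 < ereal r" "ereal r < fps_conv_radius f"
    using ereal_dense2 by blast
  define x where "x = min r 1"
  have x: "x > 0" "x \<le> 1" "ereal x < fps_conv_radius f"
    using r by (auto simp: x_def min_def) (metis ereal_less_eq(3) le_less_trans nle_le)
  have "summable (\<lambda>n. f $ n * of_real x ^ n)"
    using x by (intro summable_in_conv_radius) (auto simp: fps_conv_radius_def)
  then have "Bseq (\<lambda>n. f $ n * of_real x ^ n)"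
    by (intro convergent_imp_Bseq convergentI[OF summable_LIMSEQ_zero])
  then obtain C where C: "C > 0" "\<And>n. cmod (f $ n * of_real x ^ n) \<le> C"
    by (auto elim: BseqE)
  have "cmod (f $ n) \<le> C * (1 / x) ^ n" for n
    using C(2)[of n] x by (simp add: norm_mult norm_power power_one_over field_simps)
  then show "\<exists>C\<ge>0. \<exists>K\<ge>1. \<forall>n. cmod (f $ n) \<le> C * K ^ n"
    using C x by (intro exI[of _ C] conjI exI[of _ "1 / x"]) auto
next
  assume "\<exists>C\<ge>0. \<exists>K\<ge>1. \<forall>n. cmod (f $ n) \<le> C * K ^ n"
  then obtain C K where CK: "C \<ge> 0" "K \<ge> 1" "\<And>n. cmod (f $ n) \<le> C * K ^ n"
    by blast
  define z where "z = complex_of_real (1 / (2 * K))"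
  have "summable (\<lambda>n. f $ n * z ^ n)"
  proof (rule summable_comparison_test'[where N = 0])
    show "summable (\<lambda>n. C * (1 / 2) ^ n)"
      by (intro summable_mult summable_geometric) auto
    fix n
    have "norm (f $ n * z ^ n) \<le> C * K ^ n * (1 / (2 * K)) ^ n"
      unfolding norm_mult norm_power using CK
      by (intro mult_mono) (auto simp: z_def norm_divide norm_mult)
    also have "\<dots> = C * (1 / 2) ^ n"
      using CK by (simp add: power_divide power_mult_distrib)
    finally show "norm (f $ n * z ^ n) \<le> C * (1 / 2) ^ n" .
  qed
  then have "fps_conv_radius f \<ge> norm z"
    unfolding fps_conv_radius_def by (rule conv_radius_geI)
  moreover have "norm z > 0"
    using CK by (simp add: z_def)
  ultimately show "convergent_fps f"
    unfolding convergent_fps_def by (metis ereal_less(2) less_le_trans)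
qed

lemma convergent_fps_expansion:
  assumes "f analytic_on cball 0 r" "r > 0"
  shows "convergent_fps (fps_expansion f 0)"
proof -
  have "f holomorphic_on eball 0 (ereal r)"
    using assms by (intro analytic_imp_holomorphic) (auto elim: analytic_on_subset)
  then have "fps_conv_radius (fps_expansion f 0) \<ge> ereal r"
    by (rule conv_radius_fps_expansion)
  then show ?thesis
    using assms(2) unfolding convergent_fps_def by (metis ereal_less(2) less_le_trans)
qed

section \<open>The recursion for the coefficients and its growth\<close>

lemma moment_deriv_funpow_nth:
  assumes "\<And>p. m p > 0"
  shows "(moment_deriv m ^^ p) f $ j = of_real (m (j + p) / m j) * f $ (j + p)"
proof (induction p arbitrary: j)
  case 0
  then show ?case using assms[of j] by simp
next
  case (Suc p)
  have "(moment_deriv m ^^ Suc p) f $ j =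
      of_real (m (j + 1)) * (of_real (m (j + 1 + p) / m (j + 1)) * f $ (j + 1 + p)) / of_real (m j)"
    by (simp add: moment_deriv_def Suc.IH)
  then show ?case
    using assms[of "j + 1"] by simp
qed

lemma moment_deriv_z_funpow_nth: "(moment_deriv_z m ^^ p) u $ n = (moment_deriv m ^^ p) (u $ n)"
  by (induction p) (auto simp: moment_deriv_z_def)

lemma moment_deriv_t_funpow_nth:
  assumes "\<And>p. m p > 0"
  shows "(moment_deriv_t m ^^ k) u $ n = fps_const (of_real (m (n + k) / m n)) * u $ (n + k)"
proof (induction k arbitrary: n)
  case 0
  then show ?case using assms[of n] by simp
next
  case (Suc k)
  have "(moment_deriv_t m ^^ Suc k) u $ n =
      fps_const (of_real (m (n + 1) / m n)) * (fps_const (of_real (m (n + 1 + k) / m (n + 1))) * u $ (n + 1 + k))"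
    by (simp add: moment_deriv_t_def Suc.IH)
  also have "\<dots> = fps_const (of_real (m (n + 1) / m n) * of_real (m (n + 1 + k) / m (n + 1))) * u $ (n + 1 + k)"
    by (simp only: mult.assoc flip: fps_const_mult)
  also have "complex_of_real (m (n + 1) / m n) * of_real (m (n + 1 + k) / m (n + 1)) = of_real (m (n + Suc k) / m n)"
    using assms[of "n + 1"] by simp
  finally show ?case by simp
qed

lemma formal_solution_coeffs:
  assumes sol: "formal_solution m1 m2 k p a f \<phi> u"
    and pos: "\<And>n. m1 n > 0" "\<And>n. m2 n > 0"
  shows "of_real (m1 (n + k) / m1 n) * u $ (n + k) $ j =
      (\<Sum>i\<le>j. fps_expansion a 0 $ (j - i) * (of_real (m2 (i + p) / m2 i) * u $ n $ (i + p))) + f $ n $ j"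
    and "n < k \<Longrightarrow> of_real (m1 n / m1 0) * u $ n $ j = fps_expansion (\<phi> n) 0 $ j"
proof -
  define A where "A = fps_expansion a 0"
  have "((moment_deriv_t m1 ^^ k) u - fps_const A * (moment_deriv_z m2 ^^ p) u) $ n $ j = f $ n $ j"
    using sol by (simp add: formal_solution_def A_def)
  moreover have "(A * (moment_deriv m2 ^^ p) (u $ n)) $ j =
      (\<Sum>i\<le>j. A $ (j - i) * (of_real (m2 (i + p) / m2 i) * u $ n $ (i + p)))"
    by (subst mult.commute, subst fps_mult_nth)
      (simp add: moment_deriv_funpow_nth[OF pos(2)] atMost_atLeast0 mult.commute)
  ultimately show "of_real (m1 (n + k) / m1 n) * u $ (n + k) $ j =
      (\<Sum>i\<le>j. A $ (j - i) * (of_real (m2 (i + p) / m2 i) * u $ n $ (i + p))) + f $ n $ j"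
    by (simp add: moment_deriv_t_funpow_nth[OF pos(1)] moment_deriv_z_funpow_nth algebra_simps)
  show "of_real (m1 n / m1 0) * u $ n $ j = fps_expansion (\<phi> n) 0 $ j" if "n < k"
  proof -
    have "at_t_zero ((moment_deriv_t m1 ^^ n) u) = fps_expansion (\<phi> n) 0"
      using sol that by (simp add: formal_solution_def)
    then have "at_t_zero ((moment_deriv_t m1 ^^ n) u) $ j = fps_expansion (\<phi> n) 0 $ j"
      by simp
    then show ?thesis
      by (simp add: at_t_zero_def moment_deriv_t_funpow_nth[OF pos(1)])
  qed
qed

text \<open>The last term dominates, since the ratio of neighbours is at most \<open>1 / 2\<close>.
  That the factor 2 does not depend on \<open>j\<close> matters because the estimate is applied in
  every step of a recursion.\<close>

lemma sum_geometric_le: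
  fixes q H :: real
  assumes "0 \<le> q" "2 * q \<le> H"
  shows "(\<Sum>i\<le>j. q ^ (j - i) * H ^ i) \<le> 2 * H ^ j"
proof (induction j)
  case (Suc j)
  have "(\<Sum>i\<le>j. q ^ (Suc j - i) * H ^ i) = q * (\<Sum>i\<le>j. q ^ (j - i) * H ^ i)"
    unfolding sum_distrib_left by (intro sum.cong) (auto simp: Suc_diff_le)
  also have "\<dots> \<le> q * (2 * H ^ j)"
    using Suc assms by (intro mult_left_mono) auto
  also have "\<dots> \<le> H * H ^ j"
    using assms mult_right_mono[of "2 * q" H "H ^ j"] by (simp add: mult_ac)
  finally show ?case by simp
qed auto

text \<open>
  The weight \<open>w\<close> plays the role of \<open>m1 n * m2 j\<close>, to which it is only geometrically equivalent: it is
  built from log-convex sequences, which makes the transfer condition hold with constants that do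
  not accumulate along the recursion.
\<close>

lemma cauchy_problem_bound:
  fixes c F :: "nat \<Rightarrow> nat \<Rightarrow> complex" and a :: "nat \<Rightarrow> complex"
    and m1 m2 :: "nat \<Rightarrow> real" and w :: "nat \<Rightarrow> nat \<Rightarrow> real"
  assumes k: "k \<ge> 1" and pos: "\<And>n. m1 n > 0" "\<And>n. m2 n > 0" "\<And>n j. w n j > 0"
    and rec: "\<And>n j. of_real (m1 (n + k) / m1 n) * c (n + k) j =
      (\<Sum>i\<le>j. a (j - i) * (of_real (m2 (i + p) / m2 i) * c n (i + p))) + F n j"
    and a: "Ca \<ge> 0" "Ka \<ge> 0" "\<And>l. cmod (a l) \<le> Ca * Ka ^ l"
    and params: "I \<ge> 0" "K \<ge> 1" "D \<ge> 0" "E \<ge> 0" "T \<ge> 0"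
    and init: "\<And>n j. n < k \<Longrightarrow> m1 n * m2 j * cmod (c n j) \<le> I * K ^ (n + j) * w n j"
    and F: "\<And>n j. m1 n * m2 j * cmod (F n j) \<le> I * K ^ (n + j) * w n j"
    and w_transfer: "\<And>n i j. i \<le> j \<Longrightarrow> m2 j * w n (i + p) \<le> E * D ^ (j - i) * m2 i * w (n + k) j"
    and w_step: "\<And>n j. w n j \<le> T * w (n + k) j"
  obtains L H where "L \<ge> 1" "H \<ge> 1"
    and "\<And>n j. m1 n * m2 j * cmod (c n j) \<le> I * L ^ n * H ^ j * w n j"
proof -
  \<comment> \<open>\<open>2 * (Ka * D)\<close> makes the convolution with the coefficients of
    \<open>a\<close> a geometric sum of ratio at most \<open>1 / 2\<close>.\<close>
  define H where "H = max K (2 * (Ka * D))"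
  \<comment> \<open>One step of the recursion costs \<open>2 * Ca * E * H ^ p\<close> for the moment
    derivatives, where \<open>H ^ p\<close> comes from the index shift \<open>i + p\<close>, and
    \<open>T\<close> for the source; \<open>L ^ k\<close> has to cover both.\<close>
  define L where "L = max K (2 * Ca * E * H ^ p + T)"
  have H: "H \<ge> 1" "H \<ge> K" "2 * (Ka * D) \<le> H" and L: "L \<ge> 1" "L \<ge> K"
    using params by (auto simp: H_def L_def)
  have Lk: "2 * Ca * E * H ^ p + T \<le> L ^ k"
    using self_le_power[OF L(1), of k] k by (simp add: L_def)
  have K_le: "K ^ (n + j) \<le> L ^ n * H ^ j" for n j
    unfolding power_add using L H params by (intro mult_mono power_mono) auto
  have bound: "m1 n * m2 j * cmod (c n j) \<le> I * L ^ n * H ^ j * w n j" for n j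
  proof (induction n arbitrary: j rule: less_induct)
    case (less n)
    show ?case
    proof (cases "n < k")
      case True
      have "m1 n * m2 j * cmod (c n j) \<le> I * K ^ (n + j) * w n j"
        by (rule init[OF True])
      also have "\<dots> \<le> I * (L ^ n * H ^ j) * w n j"
        using K_le params pos by (intro mult_right_mono mult_left_mono) (auto intro: less_imp_le)
      finally show ?thesis by (simp add: mult_ac)
    next
      case False
      define n' where "n' = n - k"
      have n: "n = n' + k" "n' < n"
        using False k by (auto simp: n'_def)
      define G where "G = I * L ^ n' * w n j"
      have G: "G \<ge> 0"
        using params L pos(3)[of n j] by (simp add: G_def)
      have term_le: "m1 n' * m2 j * cmod (a (j - i) * (of_real (m2 (i + p) / m2 i) * c n' (i + p)))
          \<le> Ca * E * H ^ p * G * ((Ka * D) ^ (j - i) * H ^ i)" if i: "i \<le> j" for i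
      proof -
        have "m1 n' * m2 j * cmod (a (j - i) * (of_real (m2 (i + p) / m2 i) * c n' (i + p))) =
            cmod (a (j - i)) * (m2 j / m2 i) * (m1 n' * m2 (i + p) * cmod (c n' (i + p)))"
          using pos(2)[of i] pos(2)[of "i + p"] by (simp add: norm_mult norm_divide)
        also have "\<dots> \<le> (Ca * Ka ^ (j - i)) * (m2 j / m2 i) * (I * L ^ n' * H ^ (i + p) * w n' (i + p))"
          using a pos
          by (intro mult_mono[OF _ less.IH[OF n(2), of "i + p"]] mult_right_mono)
            (auto intro!: mult_nonneg_nonneg divide_nonneg_nonneg intro: less_imp_le)
        also have "\<dots> = (Ca * Ka ^ (j - i)) * (I * L ^ n' * H ^ (i + p)) * ((m2 j * w n' (i + p)) / m2 i)"
          by simp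
        also have "\<dots> \<le> (Ca * Ka ^ (j - i)) * (I * L ^ n' * H ^ (i + p)) * (E * D ^ (j - i) * w n j)"
        proof (intro mult_left_mono)
          show "m2 j * w n' (i + p) / m2 i \<le> E * D ^ (j - i) * w n j"
            using w_transfer[OF i, of n'] pos(2)[of i] by (simp add: n(1) divide_le_eq mult_ac)
        qed (use a params L H in auto)
        also have "\<dots> = Ca * E * H ^ p * G * ((Ka * D) ^ (j - i) * H ^ i)"
          by (simp add: G_def power_add power_mult_distrib mult_ac)
        finally show ?thesis .
      qed
      have "m1 n * m2 j * cmod (c n j) = m1 n' * m2 j * cmod (of_real (m1 (n' + k) / m1 n') * c (n' + k) j)"
        using pos(1)[of n'] pos(1)[of n] by (simp add: n(1) norm_mult norm_divide)
      also have "\<dots> \<le> m1 n' * m2 j * ((\<Sum>i\<le>j. cmod (a (j - i) * (of_real (m2 (i + p) / m2 i) * c n' (i + p)))) + cmod (F n' j))"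
        unfolding rec using pos
        by (intro mult_left_mono order.trans[OF norm_triangle_ineq] add_right_mono norm_sum) (auto intro: less_imp_le)
      also have "\<dots> = (\<Sum>i\<le>j. m1 n' * m2 j * cmod (a (j - i) * (of_real (m2 (i + p) / m2 i) * c n' (i + p))))
          + m1 n' * m2 j * cmod (F n' j)"
        by (simp only: distrib_left sum_distrib_left)
      also have "\<dots> \<le> (\<Sum>i\<le>j. Ca * E * H ^ p * G * ((Ka * D) ^ (j - i) * H ^ i)) + T * G * H ^ j"
      proof (intro add_mono sum_mono)
        have "m1 n' * m2 j * cmod (F n' j) \<le> I * K ^ (n' + j) * w n' j"
          by (rule F)
        also have "\<dots> \<le> I * (L ^ n' * H ^ j) * (T * w n j)"
          using K_le w_step[of n' j] params pos L H
          by (intro mult_mono) (auto simp: n(1) intro: less_imp_le)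
        also have "\<dots> = T * G * H ^ j"
          by (simp add: G_def mult_ac)
        finally show "m1 n' * m2 j * cmod (F n' j) \<le> T * G * H ^ j" .
      qed (use term_le in auto)
      also have "\<dots> = Ca * E * H ^ p * G * (\<Sum>i\<le>j. (Ka * D) ^ (j - i) * H ^ i) + T * G * H ^ j"
        by (simp only: sum_distrib_left)
      also have "\<dots> \<le> Ca * E * H ^ p * G * (2 * H ^ j) + T * G * H ^ j"
        using a params H G by (intro add_right_mono mult_left_mono sum_geometric_le) auto
      also have "\<dots> = (2 * Ca * E * H ^ p + T) * (G * H ^ j)"
        by (simp add: algebra_simps)
      also have "\<dots> \<le> L ^ k * (G * H ^ j)"
        using Lk G H by (intro mult_right_mono) auto
      also have "\<dots> = I * L ^ n * H ^ j * w n j"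
        by (simp add: G_def n(1) power_add mult_ac)
      finally show ?thesis .
    qed
  qed
  show thesis
    using that[OF L(1) H(1) bound] .
qed

section \<open>Geometric equivalence in logarithmic form\<close>

text \<open>Geometric equivalence of positive double sequences, stated for their logarithms:
  products and real powers become linear combinations.\<close>

definition linearly_close :: "(nat \<Rightarrow> nat \<Rightarrow> real) \<Rightarrow> (nat \<Rightarrow> nat \<Rightarrow> real) \<Rightarrow> bool" where
  "linearly_close f g \<longleftrightarrow> (\<exists>B\<ge>0. \<forall>n j. \<bar>f n j - g n j\<bar> \<le> B * real (n + j + 1))"

lemma linearly_closeI:
  assumes "\<And>n j. \<bar>f n j - g n j\<bar> \<le> B * real (n + j + 1)"
  shows "linearly_close f g"
proof -
  have "\<bar>f n j - g n j\<bar> \<le> max B 0 * real (n + j + 1)" for n j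
    by (rule order.trans[OF assms mult_right_mono]) auto
  then show ?thesis
    unfolding linearly_close_def by (intro exI[of _ "max B 0"]) auto
qed

lemma linearly_close_sym: "linearly_close f g \<Longrightarrow> linearly_close g f"
  by (simp add: linearly_close_def abs_minus_commute)

lemma linearly_close_trans [trans]:
  assumes "linearly_close f g" "linearly_close g h"
  shows "linearly_close f h"
proof -
  obtain B B' where B: "\<And>n j. \<bar>f n j - g n j\<bar> \<le> B * real (n + j + 1)"
    "\<And>n j. \<bar>g n j - h n j\<bar> \<le> B' * real (n + j + 1)"
    using assms by (auto simp: linearly_close_def)
  have "\<bar>f n j - h n j\<bar> \<le> (B + B') * real (n + j + 1)" for n j
    using B(1)[of n j] B(2)[of n j] unfolding distrib_right by linarith
  then show ?thesis by (rule linearly_closeI)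
qed

lemma linearly_close_add:
  assumes "linearly_close f g" "linearly_close f' g'"
  shows "linearly_close (\<lambda>n j. f n j + f' n j) (\<lambda>n j. g n j + g' n j)"
proof -
  obtain B B' where B: "\<And>n j. \<bar>f n j - g n j\<bar> \<le> B * real (n + j + 1)"
    "\<And>n j. \<bar>f' n j - g' n j\<bar> \<le> B' * real (n + j + 1)"
    using assms by (auto simp: linearly_close_def)
  have "\<bar>(f n j + f' n j) - (g n j + g' n j)\<bar> \<le> (B + B') * real (n + j + 1)" for n j
    using B(1)[of n j] B(2)[of n j] unfolding distrib_right by linarith
  then show ?thesis by (rule linearly_closeI)
qed

lemma linearly_close_cmult:
  assumes "linearly_close f g"
  shows "linearly_close (\<lambda>n j. a * f n j) (\<lambda>n j. a * g n j)"
proof -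
  obtain B where B: "\<And>n j. \<bar>f n j - g n j\<bar> \<le> B * real (n + j + 1)"
    using assms by (auto simp: linearly_close_def)
  have "\<bar>a * f n j - a * g n j\<bar> \<le> \<bar>a\<bar> * B * real (n + j + 1)" for n j
    using mult_left_mono[OF B[of n j], of "\<bar>a\<bar>"] by (simp flip: abs_mult add: right_diff_distrib)
  then show ?thesis by (rule linearly_closeI)
qed

lemma linearly_close_fst:
  assumes "\<And>n. \<bar>f n - g n\<bar> \<le> B * real (n + 1)"
  shows "linearly_close (\<lambda>n j. f n) (\<lambda>n j. g n)"
proof (rule linearly_closeI)
  fix n j :: nat
  have "0 \<le> B * real (n + 1)"
    by (rule order.trans[OF abs_ge_zero assms])
  then have "B \<ge> 0"
    by (simp add: zero_le_mult_iff)
  then show "\<bar>f n - g n\<bar> \<le> B * real (n + j + 1)"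
    by (intro order.trans[OF assms] mult_left_mono) auto
qed

lemma linearly_close_swap:
  "linearly_close f g \<Longrightarrow> linearly_close (\<lambda>n j. f j n) (\<lambda>n j. g j n)"
  by (simp add: linearly_close_def) (metis add.commute)

lemma sequence_of_order_ln:
  assumes "sequence_of_order M s m" and M: "\<And>p. M p > 0"
  obtains B where "\<And>n. \<bar>ln (m n) - s * ln (M n)\<bar> \<le> B * real (n + 1)"
proof -
  obtain A B where AB: "A > 0" "B > 0" "\<And>p. A ^ p * M p powr s \<le> m p" "\<And>p. m p \<le> B ^ p * M p powr s"
    and m: "\<And>p. m p > 0"
    using assms by (auto simp: sequence_of_order_def)
  have "\<bar>ln (m n) - s * ln (M n)\<bar> \<le> (\<bar>ln A\<bar> + \<bar>ln B\<bar>) * real (n + 1)" for n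
  proof -
    have pos: "A ^ n * M n powr s > 0" "B ^ n * M n powr s > 0"
      using AB M[of n] by auto
    have "ln (A ^ n * M n powr s) \<le> ln (m n)" "ln (m n) \<le> ln (B ^ n * M n powr s)"
      using AB(3,4)[of n] m[of n] pos by (auto intro!: ln_mono)
    then have 1: "real n * ln A + s * ln (M n) \<le> ln (m n)" "ln (m n) \<le> real n * ln B + s * ln (M n)"
      using AB M[of n] by (auto simp: ln_mult ln_realpow ln_powr)
    have "\<bar>real n * x\<bar> \<le> real (n + 1) * \<bar>x\<bar>" for x
      by (simp add: abs_mult mult_right_mono)
    from this[of "ln A"] this[of "ln B"] 1
    have "\<bar>ln (m n) - s * ln (M n)\<bar> \<le> real (n + 1) * \<bar>ln A\<bar> + real (n + 1) * \<bar>ln B\<bar>"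
      by linarith
    then show ?thesis
      by (simp only: distrib_left mult.commute[of _ "real (n + 1)"])
  qed
  then show thesis by (rule that)
qed

section \<open>Log-convexity of strongly regular sequences\<close>

context
  fixes M :: "nat \<Rightarrow> real"
  assumes sr: "strongly_regular M"
begin

lemma strongly_regular_ln_Suc: "ln (M (Suc n)) = ln (M n) + ln (quot M n)"
  using strongly_regular_pos[OF sr, of n] strongly_regular_quot_pos[OF sr, of n]
    strongly_regular_pos[OF sr, of "Suc n"]
  by (simp add: quot_def ln_div)

lemma strongly_regular_ln_increment_ge: "ln (M (q + d)) - ln (M q) \<ge> real d * ln (quot M q)"
proof (induction d)
  case (Suc d)
  have "ln (quot M q) \<le> ln (quot M (q + d))"
    using quot_mono[OF sr, of q "q + d"] strongly_regular_quot_pos[OF sr] by (simp add: ln_mono)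
  with Suc show ?case
    by (simp add: strongly_regular_ln_Suc algebra_simps)
qed auto

lemma strongly_regular_ln_superadd: "ln (M a) + ln (M b) \<le> ln (M (a + b))"
proof (induction b)
  case 0
  then show ?case by (simp add: strongly_regular_0[OF sr])
next
  case (Suc b)
  have "ln (quot M b) \<le> ln (quot M (a + b))"
    using quot_mono[OF sr, of b "a + b"] strongly_regular_quot_pos[OF sr] by (simp add: ln_mono)
  with Suc show ?case
    by (simp add: strongly_regular_ln_Suc algebra_simps)
qed

text \<open>Since \<open>q <= q * k + X\<close>, the quotient of \<open>M\<close> at
  \<open>q\<close>, taken \<open>k\<close> times, is dominated by the \<open>k\<close> quotients
  from \<open>q * k + X\<close> on. Nothing is lost, not even a geometric factor, so the estimate
  can be repeated along the recursion.\<close>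

lemma strongly_regular_ln_dilated_increment_ge:
  assumes "i \<le> j" "k \<ge> 1"
  shows "real k * (ln (M j) - ln (M i)) \<le> ln (M (j * k + X)) - ln (M (i * k + X))"
  using assms(1)
proof (induction j rule: dec_induct)
  case (step j)
  have "j * 1 \<le> j * k"
    using assms(2) by (intro mult_le_mono) auto
  then have "j \<le> j * k + X" by linarith
  then have "ln (quot M j) \<le> ln (quot M (j * k + X))"
    using quot_mono[OF sr] strongly_regular_quot_pos[OF sr] by (simp add: ln_mono)
  then have "real k * ln (quot M j) \<le> real k * ln (quot M (j * k + X))"
    by (intro mult_left_mono) auto
  also have "\<dots> \<le> ln (M (j * k + X + k)) - ln (M (j * k + X))"
    by (rule strongly_regular_ln_increment_ge)
  finally show ?case
    using step by (simp add: strongly_regular_ln_Suc algebra_simps)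
qed auto

lemma strongly_regular_ln_subadd:
  obtains A where "A \<ge> 0" and "\<And>a b. ln (M (a + b)) \<le> ln (M a) + ln (M b) + A * real (a + b)"
proof -
  note pos = strongly_regular_pos[OF sr]
  obtain A where A: "A \<ge> 1" "\<And>p q. M (p + q) \<le> A ^ (p + q) * M p * M q"
    using strongly_regular_mg[OF sr] by blast
  have "ln (M (a + b)) \<le> ln (M a) + ln (M b) + ln A * real (a + b)" for a b
  proof -
    have "ln (M (a + b)) \<le> ln (A ^ (a + b) * M a * M b)"
      using A pos by (intro ln_mono) auto
    also have "\<dots> = ln (M a) + ln (M b) + ln A * real (a + b)"
      using A pos[of a] pos[of b] by (simp add: ln_mult ln_realpow del: of_nat_add)
    finally show ?thesis .
  qed
  then show thesis
    using that[of "ln A"] A(1) by simp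
qed

text \<open>Superadditivity of \<open>ln M\<close> gives the lower bound. Iterating (mg) gives the
  upper bound, with an error quadratic in \<open>k\<close> and \<open>p\<close> but linear in
  \<open>j\<close> and \<open>n\<close>.\<close>

lemma strongly_regular_ln_dilation_close:
  "linearly_close (\<lambda>n j. ln (M (j * k + n * p))) (\<lambda>n j. real k * ln (M j) + real p * ln (M n))"
proof -
  obtain A where A: "A \<ge> 0" "\<And>a b. ln (M (a + b)) \<le> ln (M a) + ln (M b) + A * real (a + b)"
    by (rule strongly_regular_ln_subadd) blast
  have low: "real q * ln (M x) \<le> ln (M (x * q))" for q x
  proof (induction q)
    case (Suc q)
    then show ?case
      using strongly_regular_ln_superadd[of x "x * q"] by (simp add: algebra_simps)
  qed (simp add: strongly_regular_0[OF sr])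
  have up: "ln (M (x * q)) \<le> real q * ln (M x) + A * real (q * q * x)" for q x
  proof (induction q)
    case (Suc q)
    have "ln (M (x * Suc q)) \<le> ln (M x) + ln (M (x * q)) + A * real (x + x * q)"
      using A(2)[of x "x * q"] by simp
    also have "\<dots> \<le> ln (M x) + (real q * ln (M x) + A * real (q * q * x)) + A * real (x + x * q)"
      using Suc by simp
    also have "\<dots> = real (Suc q) * ln (M x) + A * real (q * q * x + x + x * q)"
      by (simp add: algebra_simps)
    also have "\<dots> \<le> real (Suc q) * ln (M x) + A * real (Suc q * Suc q * x)"
      using A(1) by (intro add_left_mono mult_left_mono) (auto simp: algebra_simps)
    finally show ?case .
  qed (simp add: strongly_regular_0[OF sr])
  have "\<bar>ln (M (j * k + n * p)) - (real k * ln (M j) + real p * ln (M n))\<bar>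
      \<le> A * real (k * k + p * p + k + p) * real (n + j + 1)" for n j
  proof -
    have "j * k + n * p + k * k * j + p * p * n \<le> (k * k + p * p + k + p) * (n + j + 1)"
      by (simp add: algebra_simps)
    then have "A * real (j * k + n * p + k * k * j + p * p * n) \<le> A * real ((k * k + p * p + k + p) * (n + j + 1))"
      using A(1) by (intro mult_left_mono) (simp_all only: of_nat_le_iff)
    then have "A * real (j * k + n * p) + A * real (k * k * j) + A * real (p * p * n) \<le>
        A * real (k * k + p * p + k + p) * real (n + j + 1)"
      by (simp only: of_nat_add of_nat_mult algebra_simps)
    moreover have "0 \<le> A * real (k * k + p * p + k + p) * real (n + j + 1)"
      using A(1) by simp
    ultimately show ?thesis
      using low[of k j] low[of p n] up[of j k] up[of n p] A(2)[of "j * k" "n * p"]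
        strongly_regular_ln_superadd[of "j * k" "n * p"] by linarith
  qed
  then show ?thesis by (rule linearly_closeI)
qed

text \<open>The first quotients may be below 1, so \<open>M\<close> need not increase; no quotient
  falls below \<open>quot M 0\<close>, and the loss depends on \<open>d\<close> only.\<close>

lemma strongly_regular_ln_shift_ge: "ln (M q) \<le> ln (M (q + d)) + real d * \<bar>ln (quot M 0)\<bar>"
proof -
  have "ln (quot M 0) \<le> ln (quot M q)"
    using quot_mono[OF sr, of 0 q] strongly_regular_quot_pos[OF sr] by (simp add: ln_mono)
  then have "real d * (- \<bar>ln (quot M 0)\<bar>) \<le> real d * ln (quot M q)"
    by (intro mult_left_mono) auto
  with strongly_regular_ln_increment_ge[of d q] show ?thesis
    by simp
qed

end

section \<open>From the solution to the source term\<close>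

text \<open>For a fixed shift \<open>d\<close>, (mg) and the equivalence with a power of
  \<open>M\<close> suffice: each moment ratio is used only once in passing from the solution to the
  source, so geometric losses are acceptable.\<close>

lemma moment_ratio_geometric:
  assumes sr: "strongly_regular M" and ord: "sequence_of_order M s m" and s: "s > 0"
  obtains C K where "C \<ge> 0" "K \<ge> 1" and "\<And>n. m (n + d) / m n \<le> C * K ^ n"
proof -
  have m: "m n > 0" for n
    using ord by (simp add: sequence_of_order_def)
  obtain A where A: "A \<ge> 0" "\<And>a b. ln (M (a + b)) \<le> ln (M a) + ln (M b) + A * real (a + b)"
    by (rule strongly_regular_ln_subadd[OF sr]) blast
  obtain B where B: "\<And>n. \<bar>ln (m n) - s * ln (M n)\<bar> \<le> B * real (n + 1)"
    using sequence_of_order_ln[OF ord strongly_regular_pos[OF sr]] by blast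
  have B0: "B \<ge> 0"
    using order.trans[OF abs_ge_zero B[of 0]] by simp
  define X where "X = s * (ln (M d) + A * real d) + B * real (d + 2)"
  define Y where "Y = s * A + 2 * B"
  have "m (n + d) / m n \<le> exp X * exp Y ^ n" for n
  proof -
    have "s * ln (M (n + d)) \<le> s * (ln (M n) + ln (M d) + A * real (n + d))"
      using s A(2) by (intro mult_left_mono) auto
    then have "ln (m (n + d)) - ln (m n) \<le> s * (ln (M d) + A * real (n + d)) + B * real (n + d + 1) + B * real (n + 1)"
      using B[of "n + d"] B[of n] unfolding distrib_left by linarith
    also have "\<dots> = X + real n * Y"
      by (simp add: X_def Y_def algebra_simps)
    finally have "ln (m (n + d) / m n) \<le> X + real n * Y"
      using m[of n] m[of "n + d"] by (simp add: ln_div)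
    then have "m (n + d) / m n \<le> exp (X + real n * Y)"
      using m by (metis divide_pos_pos exp_le_cancel_iff exp_ln)
    then show ?thesis
      by (simp add: exp_add exp_of_nat_mult)
  qed
  moreover have "exp Y \<ge> 1"
    using s A B0 by (simp add: Y_def)
  ultimately show thesis
    using that[of "exp X" "exp Y"] by simp
qed

text \<open>Here the recursion is read as a formula for \<open>F\<close>; the convolution is handled
  as in \<open>cauchy_problem_bound\<close>, but without iteration.\<close>

lemma source_geometrically_bounded:
  fixes c F :: "nat \<Rightarrow> nat \<Rightarrow> complex" and a :: "nat \<Rightarrow> complex" and \<alpha> \<beta> :: "nat \<Rightarrow> real"
  assumes rec: "\<And>n j. of_real (\<alpha> n) * c (n + k) j =
      (\<Sum>i\<le>j. a (j - i) * (of_real (\<beta> i) * c n (i + p))) + F n j"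
    and c: "geometrically_bounded c"
    and a: "Ca \<ge> 0" "Ka \<ge> 1" "\<And>l. cmod (a l) \<le> Ca * Ka ^ l"
    and \<alpha>: "C1 \<ge> 0" "K1 \<ge> 1" "\<And>n. \<bar>\<alpha> n\<bar> \<le> C1 * K1 ^ n"
    and \<beta>: "C2 \<ge> 0" "K2 \<ge> 1" "\<And>n. \<bar>\<beta> n\<bar> \<le> C2 * K2 ^ n"
  shows "geometrically_bounded F"
proof -
  obtain C K where CK: "C \<ge> 0" "K \<ge> 1" "\<And>n j. cmod (c n j) \<le> C * K ^ (n + j)"
    using c by (auto simp: geometrically_bounded_def)
  define H where "H = max (2 * Ka) (K2 * K)"
  have H: "H \<ge> 1" "2 * Ka \<le> H" "K2 * K \<le> H"
    using a by (auto simp: H_def)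
  define Z where "Z = K1 * K * H"
  have K1K: "1 * 1 \<le> K1 * K"
    using \<alpha> CK by (intro mult_mono) auto
  have KK: "1 * K \<le> K1 * K"
    using \<alpha> CK by (intro mult_right_mono) auto
  have Z: "Z \<ge> 1" "K1 * K \<le> Z" "K \<le> Z" "H \<le> Z"
  proof -
    show "K1 * K \<le> Z"
      using mult_left_mono[OF H(1), of "K1 * K"] K1K by (simp add: Z_def)
    then show "Z \<ge> 1" "K \<le> Z"
      using K1K KK by auto
    show "H \<le> Z"
      using mult_right_mono[OF K1K, of H] H by (simp add: Z_def)
  qed
  define C' where "C' = C1 * C * K ^ k + 2 * Ca * C2 * C * K ^ p"
  have C': "C' \<ge> 0"
    using a \<alpha> \<beta> CK by (simp add: C'_def)
  have "cmod (F n j) \<le> C' * Z ^ (n + j)" for n j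
  proof -
    have F: "F n j = of_real (\<alpha> n) * c (n + k) j - (\<Sum>i\<le>j. a (j - i) * (of_real (\<beta> i) * c n (i + p)))"
      using rec[of n j] by simp
    have "cmod (of_real (\<alpha> n) * c (n + k) j) \<le> (C1 * K1 ^ n) * (C * K ^ (n + k + j))"
      unfolding norm_mult norm_of_real using \<alpha> CK by (intro mult_mono) auto
    also have "\<dots> = C1 * C * K ^ k * ((K1 * K) ^ n * K ^ j)"
      by (simp add: power_add power_mult_distrib mult_ac)
    also have "\<dots> \<le> C1 * C * K ^ k * (Z ^ n * Z ^ j)"
      using \<alpha> CK Z K1K by (intro mult_left_mono mult_mono power_mono) auto
    finally have 1: "cmod (of_real (\<alpha> n) * c (n + k) j) \<le> C1 * C * K ^ k * Z ^ (n + j)"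
      by (simp add: power_add)
    have "cmod (\<Sum>i\<le>j. a (j - i) * (of_real (\<beta> i) * c n (i + p)))
        \<le> (\<Sum>i\<le>j. Ca * C2 * C * K ^ p * K ^ n * (Ka ^ (j - i) * H ^ i))"
    proof (rule sum_norm_le)
      fix i assume "i \<in> {..j}"
      have "cmod (a (j - i) * (of_real (\<beta> i) * c n (i + p))) \<le> (Ca * Ka ^ (j - i)) * ((C2 * K2 ^ i) * (C * K ^ (n + (i + p))))"
        unfolding norm_mult norm_of_real using a \<beta> CK by (intro mult_mono) auto
      also have "\<dots> = Ca * C2 * C * K ^ p * K ^ n * (Ka ^ (j - i) * (K2 * K) ^ i)"
        by (simp add: power_add power_mult_distrib mult_ac)
      also have "\<dots> \<le> Ca * C2 * C * K ^ p * K ^ n * (Ka ^ (j - i) * H ^ i)"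
        using a \<beta> CK H by (intro mult_left_mono power_mono) auto
      finally show "cmod (a (j - i) * (of_real (\<beta> i) * c n (i + p)))
          \<le> Ca * C2 * C * K ^ p * K ^ n * (Ka ^ (j - i) * H ^ i)" .
    qed
    also have "\<dots> = Ca * C2 * C * K ^ p * K ^ n * (\<Sum>i\<le>j. Ka ^ (j - i) * H ^ i)"
      by (simp only: sum_distrib_left)
    also have "\<dots> \<le> Ca * C2 * C * K ^ p * K ^ n * (2 * H ^ j)"
      using a \<beta> CK H by (intro mult_left_mono sum_geometric_le) auto
    also have "\<dots> = 2 * Ca * C2 * C * K ^ p * (K ^ n * H ^ j)"
      by simp
    also have "\<dots> \<le> 2 * Ca * C2 * C * K ^ p * (Z ^ n * Z ^ j)"
      using a \<beta> CK Z H by (intro mult_left_mono mult_mono power_mono) auto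
    finally have 2: "cmod (\<Sum>i\<le>j. a (j - i) * (of_real (\<beta> i) * c n (i + p)))
        \<le> 2 * Ca * C2 * C * K ^ p * Z ^ (n + j)"
      by (simp add: power_add)
    show ?thesis
      unfolding F using 1 2 by (intro order.trans[OF norm_triangle_ineq4]) (simp add: C'_def distrib_right)
  qed
  then show ?thesis
    unfolding geometrically_bounded_def using C' Z(1) by blast
qed

theorem corollary2:
  fixes M M1 M2 m1 m2 :: "nat \<Rightarrow> real"
    and s1 s2 r :: real
    and k p :: nat
    and a :: "complex \<Rightarrow> complex"
    and \<phi> :: "nat \<Rightarrow> complex \<Rightarrow> complex"
    and f u :: "complex fps fps"
  assumes "strongly_regular M" and "admits_nonzero_proximate_order M"
    and "strongly_regular M1" and "admits_nonzero_proximate_order M1"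
    and "strongly_regular M2" and "admits_nonzero_proximate_order M2"
    and "moment_sequence M1 m1" and "moment_sequence M2 m2"
    and "s1 > 0" and "sequence_of_order M s1 m1"
    and "s2 > 0" and "sequence_of_order M s2 m2"
    and "1 \<le> k" and "k < p" and "s1 * real k \<ge> s2 * real p"
    and "r > 0"
    and "a analytic_on cball 0 r" and "\<forall>z\<in>cball 0 r. a z \<noteq> 0"
    and "(\<lambda>z. inverse (a z)) analytic_on cball 0 r"
    and "\<forall>j<k. \<phi> j analytic_on cball 0 r"
    and "formal_solution m1 m2 k p a f \<phi> u"
  shows "convergent_fps2 u \<longleftrightarrow>
         convergent_fps2 f \<and>
         (\<forall>j<p. convergent_fps (at_z_zero ((moment_deriv_z m2 ^^ j) u)))"
proof -
  note sr = assms(1) and sr2 = assms(5) and ord1 = assms(10) and ord2 = assms(12)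
    and k = assms(13) and sol = assms(21)
  have m1: "m1 n > 0" and m2: "m2 n > 0" for n
    using ord1 ord2 by (auto simp: sequence_of_order_def)
  define A where "A = fps_expansion a 0"
  note eqn = formal_solution_coeffs[OF sol m1 m2, folded A_def]
  have "convergent_fps A"
    unfolding A_def by (rule convergent_fps_expansion) fact+
  then obtain Ca Ka where A: "Ca \<ge> 0" "Ka \<ge> 1" "\<And>l. cmod (A $ l) \<le> Ca * Ka ^ l"
    by (auto simp: convergent_fps_iff)
  \<comment> \<open>At \<open>z = 0\<close> the moment derivative of order \<open>j\<close> is a
    positive multiple of the coefficient of \<open>z ^ j\<close>, so its convergence is inherited
    from \<open>u\<close>.\<close>
  have data: "at_z_zero ((moment_deriv_z m2 ^^ j) u) $ n = of_real (m2 j / m2 0) * u $ n $ j" for n j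
    by (simp add: at_z_zero_def moment_deriv_z_funpow_nth moment_deriv_funpow_nth[OF m2])
  show ?thesis
  proof
    assume "convergent_fps2 u"
    then have u: "geometrically_bounded (\<lambda>n j. u $ n $ j)"
      by (simp add: convergent_fps2_iff)
    obtain C1 K1 where 1: "C1 \<ge> 0" "K1 \<ge> 1" "\<And>n. m1 (n + k) / m1 n \<le> C1 * K1 ^ n"
      using moment_ratio_geometric[OF sr ord1 \<open>s1 > 0\<close>] by metis
    obtain C2 K2 where 2: "C2 \<ge> 0" "K2 \<ge> 1" "\<And>n. m2 (n + p) / m2 n \<le> C2 * K2 ^ n"
      using moment_ratio_geometric[OF sr ord2 \<open>s2 > 0\<close>] by metis
    have "geometrically_bounded (\<lambda>n j. f $ n $ j)"
      by (rule source_geometrically_bounded[where a = "fps_nth A" and \<alpha> = "\<lambda>n. m1 (n + k) / m1 n"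
            and \<beta> = "\<lambda>n. m2 (n + p) / m2 n", OF eqn(1) u A 1(1,2) _ 2(1,2)])
        (use 1(3) 2(3) m1 m2 in \<open>simp_all add: less_imp_le\<close>)
    then have "convergent_fps2 f"
      by (simp add: convergent_fps2_iff)
    moreover have "convergent_fps (at_z_zero ((moment_deriv_z m2 ^^ j) u))" for j
    proof -
      obtain C K where CK: "C \<ge> 0" "K \<ge> 1" "\<And>n j. cmod (u $ n $ j) \<le> C * K ^ (n + j)"
        using u by (auto simp: geometrically_bounded_def)
      have "cmod (at_z_zero ((moment_deriv_z m2 ^^ j) u) $ n) \<le> (m2 j / m2 0 * C * K ^ j) * K ^ n" for n
      proof -
        have "m2 j / m2 0 * cmod (u $ n $ j) \<le> m2 j / m2 0 * (C * K ^ (n + j))"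
          using CK(3) m2[of j] m2[of 0] by (intro mult_left_mono) auto
        then show ?thesis
          using m2[of j] m2[of 0] by (simp add: data norm_mult norm_divide power_add mult_ac)
      qed
      moreover have "m2 j / m2 0 * C * K ^ j \<ge> 0"
        using CK m2[of j] m2[of 0] by simp
      ultimately show ?thesis
        unfolding convergent_fps_iff using CK(2) by blast
    qed
    ultimately show "convergent_fps2 f \<and> (\<forall>j<p. convergent_fps (at_z_zero ((moment_deriv_z m2 ^^ j) u)))"
      by blast
  next
    assume "convergent_fps2 f \<and> (\<forall>j<p. convergent_fps (at_z_zero ((moment_deriv_z m2 ^^ j) u)))"
    then obtain Cf Kf where f: "Cf \<ge> 0" "Kf \<ge> 1" "\<And>n j. cmod (f $ n $ j) \<le> Cf * Kf ^ (n + j)"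
      by (auto simp: convergent_fps2_iff geometrically_bounded_def)
    define l where "l n = ln (M n)" for n
    define l2 where "l2 n = ln (M2 n)" for n
    \<comment> \<open>The exponent of \<open>M n\<close> that remains in \<open>m1 n\<close> once
      the weight contains \<open>M2 n powr (p / k)\<close>, which is equivalent to
      \<open>M n powr (s2 * p / k)\<close>.\<close>
    define \<sigma> where "\<sigma> = s1 - s2 * real p / real k"
    have \<sigma>: "\<sigma> \<ge> 0"
      using \<open>s1 * real k \<ge> s2 * real p\<close> k by (simp add: \<sigma>_def field_simps)
    \<comment> \<open>The logarithm of the \<open>k\<close>-th root of
      \<open>M2 (j * k + n * p)\<close> times \<open>M n powr \<sigma>\<close>. The first factor has
      the same value at \<open>(n, j + p)\<close> and at \<open>(n + k, j)\<close>.\<close>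
    define lw where "lw n j = (1 / real k) * l2 (j * k + n * p) + \<sigma> * l n" for n j
    define w where "w n j = exp (lw n j)" for n j
    have w: "w n j > 0" for n j
      by (simp add: w_def)

    obtain B1 where B1: "\<And>n. \<bar>ln (m1 n) - s1 * l n\<bar> \<le> B1 * real (n + 1)"
      unfolding l_def using sequence_of_order_ln[OF ord1 strongly_regular_pos[OF sr]] by blast
    obtain B2 where B2: "\<And>n. \<bar>ln (m2 n) - s2 * l n\<bar> \<le> B2 * real (n + 1)"
      unfolding l_def using sequence_of_order_ln[OF ord2 strongly_regular_pos[OF sr]] by blast
    obtain B3 where B3: "\<And>n. \<bar>ln (m2 n) - l2 n\<bar> \<le> B3 * real (n + 1)"
      unfolding l2_def using moment_sequence_equivalent[OF assms(8) sr2 assms(6) m2] by blast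
    obtain D0 where D0: "\<And>n. m2 (Suc n) \<le> D0 * quot M2 n * m2 n"
      using moment_sequence_ratio[OF assms(8) sr2 assms(6) m2] by blast

    \<comment> \<open>The dilation splits the first factor into \<open>M2 j\<close> and
      \<open>M2 n powr (p / k)\<close>. The link from \<open>M2\<close> to \<open>M\<close> runs
      through \<open>m2\<close>, which is equivalent to \<open>M2\<close> as a moment sequence and
      to a power of \<open>M\<close> by its order.\<close>
    have "linearly_close lw (\<lambda>n j. ln (m1 n) + ln (m2 j))"
    proof -
      have m2_l2: "linearly_close (\<lambda>n j. l2 n) (\<lambda>n j. ln (m2 n))"
        by (rule linearly_close_sym[OF linearly_close_fst[OF B3]])
      have "linearly_close lw (\<lambda>n j. (1 / real k) * (real k * l2 j + real p * l2 n) + \<sigma> * l n)"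
        unfolding lw_def l2_def
        by (intro linearly_close_add linearly_close_cmult strongly_regular_ln_dilation_close[OF sr2] linearly_close_fst[where B = 0]) simp
      also have "(\<lambda>n j. (1 / real k) * (real k * l2 j + real p * l2 n) + \<sigma> * l n) =
          (\<lambda>n j. l2 j + ((real p / real k) * l2 n + \<sigma> * l n))"
        using k by (simp add: fun_eq_iff field_simps)
      also have "linearly_close \<dots> (\<lambda>n j. ln (m2 j) + ((real p / real k) * (s2 * l n) + \<sigma> * l n))"
        by (intro linearly_close_add linearly_close_cmult linearly_close_swap[OF m2_l2]
            linearly_close_trans[OF m2_l2 linearly_close_fst[OF B2]] linearly_close_fst[where B = 0]) simp
      also have "(\<lambda>n j. ln (m2 j) + ((real p / real k) * (s2 * l n) + \<sigma> * l n)) = (\<lambda>n j. s1 * l n + ln (m2 j))"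
        using k by (simp add: fun_eq_iff \<sigma>_def field_simps)
      also have "linearly_close \<dots> (\<lambda>n j. ln (m1 n) + ln (m2 j))"
        by (intro linearly_close_add linearly_close_sym[OF linearly_close_fst[OF B1]]
            linearly_close_swap[OF linearly_close_fst[where B = 0]]) simp
      finally show ?thesis .
    qed
    then obtain B where B: "B \<ge> 0" "\<And>n j. \<bar>lw n j - (ln (m1 n) + ln (m2 j))\<bar> \<le> B * real (n + j + 1)"
      by (auto simp: linearly_close_def)
    define K0 where "K0 = exp B"
    have K0: "K0 \<ge> 1"
      using B by (simp add: K0_def)
    have m_exp: "m1 n * m2 j = exp (ln (m1 n) + ln (m2 j))" for n j
      using m1[of n] m2[of j] by (simp add: exp_add)
    have K0_pow: "K0 * K0 ^ (n + j) = exp (B * real (n + j + 1))" for n j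
      by (simp add: K0_def exp_add algebra_simps flip: exp_of_nat_mult)
    have m_le_w: "m1 n * m2 j \<le> K0 * K0 ^ (n + j) * w n j" for n j
      using B(2)[of n j] unfolding K0_pow w_def m_exp by (simp flip: exp_add)
    have w_le_m: "w n j \<le> K0 * K0 ^ (n + j) * (m1 n * m2 j)" for n j
      using B(2)[of n j] unfolding K0_pow w_def m_exp by (simp flip: exp_add)

    have "\<exists>C\<ge>0. \<exists>K\<ge>1. \<forall>n<k. \<forall>j. cmod (u $ n $ j) \<le> C * K ^ (n + j)"
    proof -
      have "\<exists>C\<ge>0. \<exists>K\<ge>1. \<forall>j. cmod (u $ n $ j) \<le> C * K ^ j" if n: "n < k" for n
      proof -
        have "convergent_fps (fps_expansion (\<phi> n) 0)"
          using assms(20) n \<open>r > 0\<close> by (intro convergent_fps_expansion) auto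
        then obtain C K where CK: "C \<ge> 0" "K \<ge> 1" "\<And>j. cmod (fps_expansion (\<phi> n) 0 $ j) \<le> C * K ^ j"
          by (auto simp: convergent_fps_iff)
        have "cmod (u $ n $ j) \<le> (m1 0 / m1 n * C) * K ^ j" for j
        proof -
          have "m1 n / m1 0 * cmod (u $ n $ j) \<le> C * K ^ j"
            using CK(3)[of j] m1[of n] m1[of 0] unfolding eqn(2)[OF n, of j, symmetric]
            by (simp add: norm_mult norm_divide)
          then show ?thesis
            using m1[of n] m1[of 0] by (simp add: field_simps)
        qed
        moreover have "m1 0 / m1 n * C \<ge> 0"
          using CK m1[of n] m1[of 0] by simp
        ultimately show ?thesis
          using CK(2) by blast
      qed
      then obtain C K where CK: "\<And>n. n < k \<Longrightarrow> C n \<ge> 0" "\<And>n. n < k \<Longrightarrow> K n \<ge> 1"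
        "\<And>n j. n < k \<Longrightarrow> cmod (u $ n $ j) \<le> C n * K n ^ j"
        by metis
      \<comment> \<open>Sums over the finitely many initial indices serve as common
        constants.\<close>
      define C' where "C' = (\<Sum>n<k. C n)"
      define K' where "K' = 1 + (\<Sum>n<k. K n)"
      have "(\<Sum>n<k. K n) \<ge> 0"
        using CK(2) by (intro sum_nonneg order.trans[OF zero_le_one]) auto
      then have K': "K' \<ge> 1"
        by (simp add: K'_def)
      have C': "C' \<ge> 0"
        using CK(1) by (auto simp: C'_def intro!: sum_nonneg)
      have "cmod (u $ n $ j) \<le> C' * K' ^ (n + j)" if n: "n < k" for n j
      proof -
        have "C n \<le> C'"
          unfolding C'_def using CK(1) n by (intro member_le_sum) auto
        moreover have "K n \<le> (\<Sum>n<k. K n)"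
          using CK(2) n by (intro member_le_sum) (auto intro: order.trans[OF zero_le_one])
        then have "K n \<le> K'"
          by (simp add: K'_def)
        ultimately have "C n * K n ^ j \<le> C' * K' ^ j"
          using CK(1,2)[OF n] C' by (intro mult_mono power_mono) auto
        also have "\<dots> \<le> C' * K' ^ (n + j)"
          using K' C' by (intro mult_left_mono power_increasing) auto
        finally show ?thesis
          using CK(3)[OF n, of j] by linarith
      qed
      with C' K' show ?thesis by blast
    qed
    then obtain Ci Ki where init: "Ci \<ge> 0" "Ki \<ge> 1"
      "\<And>n j. n < k \<Longrightarrow> cmod (u $ n $ j) \<le> Ci * Ki ^ (n + j)"
      by blast
    \<comment> \<open>\<open>K0\<close> pays for replacing \<open>m1 n * m2 j\<close> by the weight;
      the maxima let the same constants serve the initial coefficients and the source.\<close>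
    define I where "I = K0 * max Ci Cf"
    define K where "K = K0 * max Ki Kf"
    have weighted: "m1 n * m2 j * x \<le> I * K ^ (n + j) * w n j"
      if "x \<ge> 0" "x \<le> C * L ^ (n + j)" "0 \<le> C" "1 \<le> L" "C \<le> max Ci Cf" "L \<le> max Ki Kf" for x C L n j
    proof -
      have "x \<le> max Ci Cf * max Ki Kf ^ (n + j)"
        using that by (intro order.trans[OF that(2)] mult_mono power_mono) auto
      then have "m1 n * m2 j * x \<le> (K0 * K0 ^ (n + j) * w n j) * (max Ci Cf * max Ki Kf ^ (n + j))"
        using K0 w[of n j] that(1) by (intro mult_mono[OF m_le_w[of n j]]) (auto intro: less_imp_le)
      then show ?thesis
        by (simp add: I_def K_def power_mult_distrib mult_ac)
    qed
    have I: "I \<ge> 0"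
      using K0 f(1) by (simp add: I_def)
    have K: "K \<ge> 1"
      using mult_mono[of 1 K0 1 "max Ki Kf"] K0 f(2) by (simp add: K_def)
    \<comment> \<open>Shifting \<open>n\<close> by \<open>k\<close> moves the index of
      \<open>M2\<close> by \<open>k * p\<close> under a \<open>k\<close>-th root and that of
      \<open>M\<close> by \<open>k\<close> under the power \<open>\<sigma>\<close>.\<close>
    define T where "T = exp (real p * \<bar>ln (quot M2 0)\<bar> + \<sigma> * (real k * \<bar>ln (quot M 0)\<bar>))"
    define D where "D = max D0 1"
    have l_shift: "\<sigma> * l n \<le> \<sigma> * l (n + k) + \<sigma> * (real k * \<bar>ln (quot M 0)\<bar>)" for n
      using mult_left_mono[OF strongly_regular_ln_shift_ge[OF sr, of n k] \<sigma>] by (simp add: l_def distrib_left)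
    have w_step: "w n j \<le> T * w (n + k) j" for n j
    proof -
      have "l2 (j * k + n * p) \<le> l2 (j * k + n * p + k * p) + real (k * p) * \<bar>ln (quot M2 0)\<bar>"
        unfolding l2_def by (rule strongly_regular_ln_shift_ge[OF sr2])
      then have "(1 / real k) * l2 (j * k + n * p) \<le>
          (1 / real k) * (l2 (j * k + n * p + k * p) + real (k * p) * \<bar>ln (quot M2 0)\<bar>)"
        by (intro mult_left_mono) auto
      also have "\<dots> = (1 / real k) * l2 (j * k + (n + k) * p) + real p * \<bar>ln (quot M2 0)\<bar>"
        using k by (simp add: field_simps)
      finally have "lw n j \<le> lw (n + k) j + (real p * \<bar>ln (quot M2 0)\<bar> + \<sigma> * (real k * \<bar>ln (quot M 0)\<bar>))"
        unfolding lw_def using l_shift[of n] by linarith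
      then show ?thesis
        unfolding w_def T_def by (simp flip: exp_add add: add.commute)
    qed
    have D0_pow: "ln (m2 j) \<le> ln (m2 i) + (l2 j - l2 i) + real (j - i) * ln D" if "i \<le> j" for i j
      using that
    proof (induction j rule: dec_induct)
      case (step j)
      have q: "quot M2 j > 0"
        by (rule strongly_regular_quot_pos[OF sr2])
      have "m2 (Suc j) \<le> D * quot M2 j * m2 j"
        using D0[of j] q m2[of j] by (intro order.trans[OF D0] mult_right_mono) (auto simp: D_def)
      then have "ln (m2 (Suc j)) \<le> ln (D * quot M2 j * m2 j)"
        using m2 by (intro ln_mono) auto
      also have "\<dots> = ln D + (l2 (Suc j) - l2 j) + ln (m2 j)"
        using q m2[of j] by (simp add: D_def ln_mult l2_def strongly_regular_ln_Suc[OF sr2])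
      finally have "ln (m2 (Suc j)) \<le> ln D + (l2 (Suc j) - l2 j) + ln (m2 j)" .
      moreover have "real (Suc j - i) * ln D = real (j - i) * ln D + ln D"
        using step by (simp add: Suc_diff_le algebra_simps)
      ultimately show ?case
        using step by linarith
    qed auto
    \<comment> \<open>\<open>D0_pow\<close> replaces the increment of \<open>ln m2\<close> by that
      of \<open>l2\<close>, and the dilated increment with offset \<open>(n + k) * p\<close> bounds
      the latter by the increment of the first part of \<open>lw\<close>. Only the part with
      \<open>M\<close> loses a constant, which \<open>T\<close> covers.\<close>
    have w_transfer: "m2 j * w n (i + p) \<le> T * D ^ (j - i) * m2 i * w (n + k) j" if ij: "i \<le> j" for n i j
    proof -
      have "real k * (l2 j - l2 i) \<le> l2 (j * k + (n + k) * p) - l2 (i * k + (n + k) * p)"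
        unfolding l2_def by (rule strongly_regular_ln_dilated_increment_ge[OF sr2 ij k])
      then have "l2 j - l2 i \<le> (1 / real k) * l2 (j * k + (n + k) * p) - (1 / real k) * l2 ((i + p) * k + n * p)"
        using k by (simp add: field_simps)
      then have "ln (m2 j) + lw n (i + p) \<le> (real p * \<bar>ln (quot M2 0)\<bar> + \<sigma> * (real k * \<bar>ln (quot M 0)\<bar>))
          + real (j - i) * ln D + ln (m2 i) + lw (n + k) j"
        unfolding lw_def using D0_pow[OF ij] l_shift[of n]
          mult_nonneg_nonneg[of "real p" "\<bar>ln (quot M2 0)\<bar>"] by linarith
      then have "exp (ln (m2 j) + lw n (i + p)) \<le> exp ((real p * \<bar>ln (quot M2 0)\<bar> + \<sigma> * (real k * \<bar>ln (quot M 0)\<bar>))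
          + real (j - i) * ln D + ln (m2 i) + lw (n + k) j)"
        by simp
      moreover have "exp (real (j - i) * ln D) = D ^ (j - i)"
        by (simp add: exp_of_nat_mult D_def)
      ultimately show ?thesis
        using m2[of j] m2[of i] by (simp add: exp_add w_def T_def)
    qed
    obtain L H where LH: "L \<ge> 1" "H \<ge> 1"
      "\<And>n j. m1 n * m2 j * cmod (u $ n $ j) \<le> I * L ^ n * H ^ j * w n j"
    proof (rule cauchy_problem_bound[where c = "\<lambda>n j. u $ n $ j" and F = "\<lambda>n j. f $ n $ j"
          and a = "fps_nth A" and w = w and I = I and K = K and D = D and E = T and T = T,
          OF k m1 m2 w eqn(1) A(1) _ A(3) I K _ _ _ _ _ w_transfer w_step])
      show "m1 n * m2 j * cmod (u $ n $ j) \<le> I * K ^ (n + j) * w n j" if "n < k" for n j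
        using init(3)[OF that, of j] init(1,2) by (intro weighted) auto
      show "m1 n * m2 j * cmod (f $ n $ j) \<le> I * K ^ (n + j) * w n j" for n j
        using f(3)[of n j] f(1,2) by (intro weighted) auto
    qed (use A that in \<open>auto simp: T_def D_def\<close>)
    \<comment> \<open>Returning from the weight to \<open>m1 n * m2 j\<close> costs a second
      geometric factor in \<open>K0\<close>, but only once, after the recursion.\<close>
    have "cmod (u $ n $ j) \<le> (I * K0) * (L * H * K0) ^ (n + j)" for n j
    proof -
      have "m1 n * m2 j * cmod (u $ n $ j) \<le> I * L ^ n * H ^ j * (K0 * K0 ^ (n + j) * (m1 n * m2 j))"
        using I LH(1,2) by (intro order.trans[OF LH(3) mult_left_mono[OF w_le_m]]) auto
      then have "cmod (u $ n $ j) \<le> I * L ^ n * H ^ j * (K0 * K0 ^ (n + j))"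
        using mult_le_cancel_left_pos[of "m1 n * m2 j"] m1[of n] m2[of j] by (simp add: mult_ac)
      also have "\<dots> \<le> I * L ^ (n + j) * H ^ (n + j) * (K0 * K0 ^ (n + j))"
        using I LH K0 by (intro mult_mono power_increasing) auto
      finally show ?thesis
        by (simp add: power_mult_distrib mult_ac)
    qed
    moreover have "1 * 1 * 1 \<le> L * H * K0"
      using LH K0 by (intro mult_mono) auto
    ultimately show "convergent_fps2 u"
      unfolding convergent_fps2_iff geometrically_bounded_def
      using I K0 by (intro exI[of _ "I * K0"] conjI exI[of _ "L * H * K0"]) auto
  qed
qed

end
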